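(* Let $A=S(V,N)$ be the $N$-symmetric algebra of $V$, let $M,P$ be $A$-bimodules, and let $q\ge p\ge 0$ be such that $\nu(q-p)=\nu(q)-\nu(p)$. Let $f:\bigwedge^{\nu(p)}V\to P$ be a $k$-linear map and $z=m\otimes(x_1\wedge\cdots\wedge x_{\nu(q)})\in M\otimes\bigwedge^{\nu(q)}V$, where $m\in M$ and $x_1<\cdots<x_{\nu(q)}$ belong to the ordered basis $(e_1,\ldots,e_n)$ of $V$, viewed as a Koszul $p$-cochain and a Koszul $q$-chain via the isomorphisms $\phi_r:\bigwedge^r V\to Ant_r(V^{\otimes r})$. Then the left Koszul cap product, viewed in $(P\otimes_AM)\otimes\bigwedge^{\nu(q-p)}V$, is given by $$f\underset{K}{\frown}z=(-1)^{(q-p)p}\sum_{\sigma\in Sh(\nu(q-p),\nu(p))}\mathrm{sgn}(\sigma)\,\bigl(f(x_{\sigma(\nu(q-p)+1)}\wedge\cdots\wedge x_{\sigma(\nu(q))})\otimes_A m\bigr)\otimes(x_{\sigma(1)}\wedge\cdots\wedge x_{\sigma(\nu(q-p))}).$$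
   Context: $k$ is a field, $V$ a $k$-vector space of finite dimension $n\ge 2$ with ordered basis $(e_1,\ldots,e_n)$ (with $e_1<\cdots<e_n$), and $N$ is an integer with $2\le N\le n$. Tensor symbols $\otimes$ between elements of $V$ are omitted. For $r\ge1$, $Ant_r:V^{\otimes r}\to V^{\otimes r}$ is the linear map $Ant_r(z)=\sum_{\sigma\in\Sigma_r}\mathrm{sgn}(\sigma)\,\sigma\cdot z$, where $\Sigma_r$ is the group of permutations of $\{1,\ldots,r\}$ and $\sigma\cdot(x_1\ldots x_r)=x_{\sigma^{-1}(1)}\ldots x_{\sigma^{-1}(r)}$; $Ant_0=\mathrm{Id}_k$. There is an isomorphism $\phi_r:\bigwedge^r V\to Ant_r(V^{\otimes r})$, $e_{i_1}\wedge\cdots\wedge e_{i_r}\mapsto Ant_r(e_{i_1}\ldots e_{i_r})$ for $i_1<\cdots<i_r$. The $N$-symmetric algebra is $A=S(V,N)=T(V)/(R)$ with $R=Ant_N(V^{\otimes N})$. Elements of $V$ appearing as factors in bimodules mean their images in $A$. Put $W_r=\bigcap_{i+N+j=r}V^{\otimes i}\otimes R\otimes V^{\otimes j}\subseteq V^{\otimes r}$ (so $W_r=V^{\otimes r}$ for $r<N$). Define $\nu(2p')=Np'$ and $\nu(2p'+1)=Np'+1$. For all $p$ one has $W_{\nu(p)}=Ant_{\nu(p)}(V^{\otimes\nu(p)})$, so Koszul $p$-cochains (linear maps $f:W_{\nu(p)}\to P$) are identified with linear maps $f\circ\phi_{\nu(p)}:\bigwedge^{\nu(p)}V\to P$, denoted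 by the same letter, and Koszul $q$-chains (elements of $M\otimes W_{\nu(q)}$) with elements of $M\otimes\bigwedge^{\nu(q)}V$ via $\mathrm{id}\otimes\phi_{\nu(q)}$. Left Koszul cap product: for a Koszul $p$-cochain $f:W_{\nu(p)}\to P$ and a Koszul $q$-chain written as (a sum of) $z=m\otimes x_1\ldots x_{\nu(q)}\in M\otimes W_{\nu(q)}$ with $q\ge p$, the element $f\underset{K}{\frown}z\in(P\otimes_AM)\otimes W_{\nu(q-p)}$ is defined as follows, $f$ being applied to the indicated tensor positions, using the natural inclusions $W_{\nu(q)}\subseteq V^{\otimes i}\otimes W_{\nu(q-p)}\otimes V^{\otimes l}\otimes W_{\nu(p)}\otimes V^{\otimes j}$. (1) If $p$ and $q-p$ are not both odd (so $\nu(q-p)=\nu(q)-\nu(p)$): $f\underset{K}{\frown}z=(f(x_{\nu(q-p)+1}\ldots x_{\nu(q)})\otimes_Am)\otimes x_1\ldots x_{\nu(q-p)}$. (2) If $p$ is odd and $q$ is even (so $\nu(q-p)=\nu(q)-\nu(p)-N+2$): $f\underset{K}{\frown}z=-\sum_{0\le i+j\le N-2}\bigl(x_{\nu(q-p)+i+1}\ldots x_{\nu(q)-\nu(p)-j}\,f(x_{\nu(q)-\nu(p)-j+1}\ldots x_{\nu(q)-j})\otimes_A x_{\nu(q)-j+1}\ldots x_{\nu(q)}\,m\,x_1\ldots x_i\bigr)\otimes x_{i+1}\ldots x_{\nu(q-p)+i}$, the sum being over $i,j\ge0$. $Sh(a,b)$ denotes the set of $(a,b)$-shuffles: permutations $\sigma$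 of $\{1,\ldots,a+b\}$ with $\sigma(1)<\cdots<\sigma(a)$ and $\sigma(a+1)<\cdots<\sigma(a+b)$. *)

theory Defs
  imports
    "HOL-Combinatorics.Permutations"
    "HOL-Algebra.Module"
    "HOL-Algebra.QuotRing"
begin

section \<open>Linear algebra over a field, with explicit carriers\<close>

definition ordered_basis ::
  "('k, 'r) ring_scheme \<Rightarrow> ('k, 'v, 'c) module_scheme \<Rightarrow> nat \<Rightarrow> (nat \<Rightarrow> 'v) \<Rightarrow> bool" where
  "ordered_basis K V n e \<longleftrightarrow>
     e \<in> {1..n} \<rightarrow> carrier V \<and>
     (\<forall>v \<in> carrier V. \<exists>!c. c \<in> {1..n} \<rightarrow>\<^sub>E carrier K \<and> v = (\<Oplus>\<^bsub>V\<^esub> i \<in> {1..n}. c i \<odot>\<^bsub>V\<^esub> e i))"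

definition linear_maps ::
  "('k, 'r) ring_scheme \<Rightarrow> ('k, 'x, 'c) module_scheme \<Rightarrow> ('k, 'y, 'd) module_scheme \<Rightarrow> ('x \<Rightarrow> 'y) set" where
  "linear_maps K X Y =
     {h. h \<in> carrier X \<rightarrow> carrier Y \<and>
         (\<forall>x \<in> carrier X. \<forall>y \<in> carrier X. h (x \<oplus>\<^bsub>X\<^esub> y) = h x \<oplus>\<^bsub>Y\<^esub> h y) \<and>
         (\<forall>c \<in> carrier K. \<forall>x \<in> carrier X. h (c \<odot>\<^bsub>X\<^esub> x) = c \<odot>\<^bsub>Y\<^esub> h x)}"

text \<open>The unique linear map \<open>X \<rightarrow> Y\<close> sending \<open>g i\<close> to \<open>h i\<close> for all \<open>i \<in> I\<close>.  It is only used when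
  the \<open>g i\<close> span \<open>X\<close> and the assignment is compatible with the linear relations between the \<open>g i\<close>.\<close>

definition the_linear ::
  "('k, 'r) ring_scheme \<Rightarrow> ('k, 'x, 'c) module_scheme \<Rightarrow> ('k, 'y, 'd) module_scheme \<Rightarrow>
    'i set \<Rightarrow> ('i \<Rightarrow> 'x) \<Rightarrow> ('i \<Rightarrow> 'y) \<Rightarrow> 'x \<Rightarrow> 'y" where
  "the_linear K X Y I g h =
     (THE F. F \<in> linear_maps K X Y \<and> F \<in> extensional (carrier X) \<and> (\<forall>i \<in> I. F (g i) = h i))"

definition span_of ::
  "('k, 'r) ring_scheme \<Rightarrow> ('k, 'x, 'c) module_scheme \<Rightarrow> 'x set \<Rightarrow> 'x set" where
  "span_of K X S = \<Inter>{H. submodule H K X \<and> S \<subseteq> H}"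

text \<open>The quotient by a subspace, or (as an algebra) by a two-sided ideal: the library's
  \<open>Quot\<close> together with scalar multiplication.\<close>

definition quot :: "('k, 'x, 'c) module_scheme \<Rightarrow> 'x set \<Rightarrow> ('k, 'x set) module" where
  "quot X U =
     \<lparr>carrier = carrier (X Quot U), mult = mult (X Quot U), one = one (X Quot U),
      zero = zero (X Quot U), add = add (X Quot U),
      smult = (\<lambda>c C. \<Union>x \<in> C. U +>\<^bsub>X\<^esub> (c \<odot>\<^bsub>X\<^esub> x))\<rparr>"

text \<open>The multiplicative fields of a free vector space are irrelevant.\<close>

definition free_space :: "('k, 'r) ring_scheme \<Rightarrow> 's set \<Rightarrow> ('k, 's \<Rightarrow> 'k) module" where
  "free_space K S =
     \<lparr>carrier = {u. (\<forall>s. u s \<in> carrier K) \<and> (\<forall>s. s \<notin> S \<longrightarrow> u s = \<zero>\<^bsub>K\<^esub>) \<and> finite {s. u s \<noteq> \<zero>\<^bsub>K\<^esub>}},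
      mult = undefined, one = undefined,
      zero = (\<lambda>s. \<zero>\<^bsub>K\<^esub>), add = (\<lambda>u v s. u s \<oplus>\<^bsub>K\<^esub> v s),
      smult = (\<lambda>c u s. c \<otimes>\<^bsub>K\<^esub> u s)\<rparr>"

definition gen :: "('k, 'r) ring_scheme \<Rightarrow> 's \<Rightarrow> 's \<Rightarrow> 'k" where
  "gen K s = (\<lambda>t. if t = s then \<one>\<^bsub>K\<^esub> else \<zero>\<^bsub>K\<^esub>)"


section \<open>Bimodules and tensor products\<close>

record ('k, 'a, 'p) bimod = "('k, 'p) module" +
  lact :: "'a \<Rightarrow> 'p \<Rightarrow> 'p"
  ract :: "'p \<Rightarrow> 'a \<Rightarrow> 'p"

text \<open>Bimodules over a \<open>K\<close>-algebra \<open>A\<close>, with \<open>K\<close> acting symmetrically.\<close>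

locale bimodule = module K X
  for K :: "('k, 'r) ring_scheme" and A :: "('k, 'a, 'c) module_scheme"
    and X :: "('k, 'a, 'p, 'd) bimod_scheme" +
  assumes lact_closed: "\<lbrakk>a \<in> carrier A; x \<in> carrier X\<rbrakk> \<Longrightarrow> lact X a x \<in> carrier X"
    and ract_closed: "\<lbrakk>a \<in> carrier A; x \<in> carrier X\<rbrakk> \<Longrightarrow> ract X x a \<in> carrier X"
    and lact_add: "\<lbrakk>a \<in> carrier A; x \<in> carrier X; y \<in> carrier X\<rbrakk>
      \<Longrightarrow> lact X a (x \<oplus>\<^bsub>X\<^esub> y) = lact X a x \<oplus>\<^bsub>X\<^esub> lact X a y"
    and ract_add: "\<lbrakk>a \<in> carrier A; x \<in> carrier X; y \<in> carrier X\<rbrakk>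
      \<Longrightarrow> ract X (x \<oplus>\<^bsub>X\<^esub> y) a = ract X x a \<oplus>\<^bsub>X\<^esub> ract X y a"
    and add_lact: "\<lbrakk>a \<in> carrier A; b \<in> carrier A; x \<in> carrier X\<rbrakk>
      \<Longrightarrow> lact X (a \<oplus>\<^bsub>A\<^esub> b) x = lact X a x \<oplus>\<^bsub>X\<^esub> lact X b x"
    and add_ract: "\<lbrakk>a \<in> carrier A; b \<in> carrier A; x \<in> carrier X\<rbrakk>
      \<Longrightarrow> ract X x (a \<oplus>\<^bsub>A\<^esub> b) = ract X x a \<oplus>\<^bsub>X\<^esub> ract X x b"
    and lact_smult: "\<lbrakk>c \<in> carrier K; a \<in> carrier A; x \<in> carrier X\<rbrakk>
      \<Longrightarrow> lact X a (c \<odot>\<^bsub>X\<^esub> x) = c \<odot>\<^bsub>X\<^esub> lact X a x"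
    and ract_smult: "\<lbrakk>c \<in> carrier K; a \<in> carrier A; x \<in> carrier X\<rbrakk>
      \<Longrightarrow> ract X (c \<odot>\<^bsub>X\<^esub> x) a = c \<odot>\<^bsub>X\<^esub> ract X x a"
    and smult_lact: "\<lbrakk>c \<in> carrier K; a \<in> carrier A; x \<in> carrier X\<rbrakk>
      \<Longrightarrow> lact X (c \<odot>\<^bsub>A\<^esub> a) x = c \<odot>\<^bsub>X\<^esub> lact X a x"
    and smult_ract: "\<lbrakk>c \<in> carrier K; a \<in> carrier A; x \<in> carrier X\<rbrakk>
      \<Longrightarrow> ract X x (c \<odot>\<^bsub>A\<^esub> a) = c \<odot>\<^bsub>X\<^esub> ract X x a"
    and lact_assoc: "\<lbrakk>a \<in> carrier A; b \<in> carrier A; x \<in> carrier X\<rbrakk>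
      \<Longrightarrow> lact X (a \<otimes>\<^bsub>A\<^esub> b) x = lact X a (lact X b x)"
    and ract_assoc: "\<lbrakk>a \<in> carrier A; b \<in> carrier A; x \<in> carrier X\<rbrakk>
      \<Longrightarrow> ract X x (a \<otimes>\<^bsub>A\<^esub> b) = ract X (ract X x a) b"
    and lact_ract: "\<lbrakk>a \<in> carrier A; b \<in> carrier A; x \<in> carrier X\<rbrakk>
      \<Longrightarrow> ract X (lact X a x) b = lact X a (ract X x b)"
    and lact_one: "x \<in> carrier X \<Longrightarrow> lact X \<one>\<^bsub>A\<^esub> x = x"
    and ract_one: "x \<in> carrier X \<Longrightarrow> ract X x \<one>\<^bsub>A\<^esub> = x"

definition bilinear_relations ::
  "('k, 'r) ring_scheme \<Rightarrow> ('k, 'x, 'c) module_scheme \<Rightarrow> ('k, 'y, 'd) module_scheme \<Rightarrow> ('x \<times> 'y \<Rightarrow> 'k) set" where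
  "bilinear_relations K X Y =
     (let F = free_space K (carrier X \<times> carrier Y) in
       {gen K (x \<oplus>\<^bsub>X\<^esub> x', y) \<ominus>\<^bsub>F\<^esub> (gen K (x, y) \<oplus>\<^bsub>F\<^esub> gen K (x', y)) | x x' y.
          x \<in> carrier X \<and> x' \<in> carrier X \<and> y \<in> carrier Y} \<union>
       {gen K (x, y \<oplus>\<^bsub>Y\<^esub> y') \<ominus>\<^bsub>F\<^esub> (gen K (x, y) \<oplus>\<^bsub>F\<^esub> gen K (x, y')) | x y y'.
          x \<in> carrier X \<and> y \<in> carrier Y \<and> y' \<in> carrier Y} \<union>
       {gen K (c \<odot>\<^bsub>X\<^esub> x, y) \<ominus>\<^bsub>F\<^esub> (c \<odot>\<^bsub>F\<^esub> gen K (x, y)) | c x y.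
          c \<in> carrier K \<and> x \<in> carrier X \<and> y \<in> carrier Y} \<union>
       {gen K (x, c \<odot>\<^bsub>Y\<^esub> y) \<ominus>\<^bsub>F\<^esub> (c \<odot>\<^bsub>F\<^esub> gen K (x, y)) | c x y.
          c \<in> carrier K \<and> x \<in> carrier X \<and> y \<in> carrier Y})"

definition balanced_relations ::
  "('k, 'r) ring_scheme \<Rightarrow> ('k, 'a, 'c) module_scheme \<Rightarrow> ('k, 'a, 'p, 'd) bimod_scheme \<Rightarrow>
    ('k, 'a, 'm, 'e) bimod_scheme \<Rightarrow> ('p \<times> 'm \<Rightarrow> 'k) set" where
  "balanced_relations K A P M =
     (let F = free_space K (carrier P \<times> carrier M) in
       {gen K (ract P x a, y) \<ominus>\<^bsub>F\<^esub> gen K (x, lact M a y) | x a y.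
          x \<in> carrier P \<and> a \<in> carrier A \<and> y \<in> carrier M})"

definition tensor_kernel ::
  "('k, 'r) ring_scheme \<Rightarrow> ('k, 'x, 'c) module_scheme \<Rightarrow> ('k, 'y, 'd) module_scheme \<Rightarrow> ('x \<times> 'y \<Rightarrow> 'k) set" where
  "tensor_kernel K X Y =
     span_of K (free_space K (carrier X \<times> carrier Y)) (bilinear_relations K X Y)"

definition tensor ::
  "('k, 'r) ring_scheme \<Rightarrow> ('k, 'x, 'c) module_scheme \<Rightarrow> ('k, 'y, 'd) module_scheme \<Rightarrow>
    ('k, ('x \<times> 'y \<Rightarrow> 'k) set) module" where
  "tensor K X Y = quot (free_space K (carrier X \<times> carrier Y)) (tensor_kernel K X Y)"

definition tens ::
  "('k, 'r) ring_scheme \<Rightarrow> ('k, 'x, 'c) module_scheme \<Rightarrow> ('k, 'y, 'd) module_scheme \<Rightarrow>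
    'x \<Rightarrow> 'y \<Rightarrow> ('x \<times> 'y \<Rightarrow> 'k) set" where
  "tens K X Y x y = tensor_kernel K X Y +>\<^bsub>free_space K (carrier X \<times> carrier Y)\<^esub> gen K (x, y)"

definition tensor_over_kernel ::
  "('k, 'r) ring_scheme \<Rightarrow> ('k, 'a, 'c) module_scheme \<Rightarrow> ('k, 'a, 'p, 'd) bimod_scheme \<Rightarrow>
    ('k, 'a, 'm, 'e) bimod_scheme \<Rightarrow> ('p \<times> 'm \<Rightarrow> 'k) set" where
  "tensor_over_kernel K A P M =
     span_of K (free_space K (carrier P \<times> carrier M))
       (bilinear_relations K P M \<union> balanced_relations K A P M)"

definition tensor_over ::
  "('k, 'r) ring_scheme \<Rightarrow> ('k, 'a, 'c) module_scheme \<Rightarrow> ('k, 'a, 'p, 'd) bimod_scheme \<Rightarrow>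
    ('k, 'a, 'm, 'e) bimod_scheme \<Rightarrow> ('k, ('p \<times> 'm \<Rightarrow> 'k) set) module" where
  "tensor_over K A P M =
     quot (free_space K (carrier P \<times> carrier M)) (tensor_over_kernel K A P M)"

definition tens_over ::
  "('k, 'r) ring_scheme \<Rightarrow> ('k, 'a, 'c) module_scheme \<Rightarrow> ('k, 'a, 'p, 'd) bimod_scheme \<Rightarrow>
    ('k, 'a, 'm, 'e) bimod_scheme \<Rightarrow> 'p \<Rightarrow> 'm \<Rightarrow> ('p \<times> 'm \<Rightarrow> 'k) set" where
  "tens_over K A P M x y =
     tensor_over_kernel K A P M +>\<^bsub>free_space K (carrier P \<times> carrier M)\<^esub> gen K (x, y)"

definition id_tens ::
  "('k, 'r) ring_scheme \<Rightarrow> ('k, 'x, 'c) module_scheme \<Rightarrow> ('k, 'y, 'd) module_scheme \<Rightarrow>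
    ('k, 'z, 'e) module_scheme \<Rightarrow> ('y \<Rightarrow> 'z) \<Rightarrow> ('x \<times> 'y \<Rightarrow> 'k) set \<Rightarrow> ('x \<times> 'z \<Rightarrow> 'k) set" where
  "id_tens K X Y Z h =
     the_linear K (tensor K X Y) (tensor K X Z) (carrier X \<times> carrier Y)
       (\<lambda>(x, y). tens K X Y x y) (\<lambda>(x, y). tens K X Z x (h y))"


section \<open>The tensor, exterior and N-symmetric algebras\<close>

text \<open>The free associative algebra on a set \<open>S\<close>: words multiply by concatenation.\<close>

definition free_algebra :: "('k, 'r) ring_scheme \<Rightarrow> 's set \<Rightarrow> ('k, 's list \<Rightarrow> 'k) module" where
  "free_algebra K S =
     (free_space K (lists S))
       \<lparr>mult := (\<lambda>u v w. \<Oplus>\<^bsub>K\<^esub> i \<in> {..length w}. u (take i w) \<otimes>\<^bsub>K\<^esub> v (drop i w)),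
        one := gen K []\<rparr>"

text \<open>\<open>T(V)\<close> is the free algebra on the set \<open>V\<close> modulo linearity of \<open>V \<rightarrow> T(V)\<close>; its degree \<open>r\<close>
  component, spanned by the classes of words of length \<open>r\<close>, is the \<open>r\<close>-th tensor power.\<close>

definition talg_kernel :: "('k, 'r) ring_scheme \<Rightarrow> ('k, 'v, 'c) module_scheme \<Rightarrow> ('v list \<Rightarrow> 'k) set" where
  "talg_kernel K V =
     (let F = free_algebra K (carrier V) in
       Idl\<^bsub>F\<^esub>
        ({gen K [x \<oplus>\<^bsub>V\<^esub> y] \<ominus>\<^bsub>F\<^esub> (gen K [x] \<oplus>\<^bsub>F\<^esub> gen K [y]) | x y. x \<in> carrier V \<and> y \<in> carrier V} \<union>
         {gen K [c \<odot>\<^bsub>V\<^esub> x] \<ominus>\<^bsub>F\<^esub> (c \<odot>\<^bsub>F\<^esub> gen K [x]) | c x. c \<in> carrier K \<and> x \<in> carrier V}))"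

definition talg :: "('k, 'r) ring_scheme \<Rightarrow> ('k, 'v, 'c) module_scheme \<Rightarrow> ('k, ('v list \<Rightarrow> 'k) set) module" where
  "talg K V = quot (free_algebra K (carrier V)) (talg_kernel K V)"

definition word :: "('k, 'r) ring_scheme \<Rightarrow> ('k, 'v, 'c) module_scheme \<Rightarrow> 'v list \<Rightarrow> ('v list \<Rightarrow> 'k) set" where
  "word K V xs = talg_kernel K V +>\<^bsub>free_algebra K (carrier V)\<^esub> gen K xs"

definition tpow ::
  "('k, 'r) ring_scheme \<Rightarrow> ('k, 'v, 'c) module_scheme \<Rightarrow> nat \<Rightarrow> ('k, ('v list \<Rightarrow> 'k) set) module" where
  "tpow K V r =
     (talg K V)\<lparr>carrier := span_of K (talg K V) {word K V xs | xs. xs \<in> lists (carrier V) \<and> length xs = r}\<rparr>"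

definition seg :: "nat \<Rightarrow> nat \<Rightarrow> (nat \<Rightarrow> 'v) \<Rightarrow> 'v list" where
  "seg i j x = map x [i..<Suc j]"

definition perm_act ::
  "('k, 'r) ring_scheme \<Rightarrow> ('k, 'v, 'c) module_scheme \<Rightarrow> nat \<Rightarrow> (nat \<Rightarrow> nat) \<Rightarrow>
    ('v list \<Rightarrow> 'k) set \<Rightarrow> ('v list \<Rightarrow> 'k) set" where
  "perm_act K V r \<sigma> =
     the_linear K (tpow K V r) (tpow K V r) ({1..r} \<rightarrow> carrier V)
       (\<lambda>x. word K V (seg 1 r x)) (\<lambda>x. word K V (seg 1 r (x \<circ> inv_into UNIV \<sigma>)))"

definition Ant ::
  "('k, 'r) ring_scheme \<Rightarrow> ('k, 'v, 'c) module_scheme \<Rightarrow> nat \<Rightarrow>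
    ('v list \<Rightarrow> 'k) set \<Rightarrow> ('v list \<Rightarrow> 'k) set" where
  "Ant K V r z =
     (\<Oplus>\<^bsub>tpow K V r\<^esub> \<sigma> \<in> {\<sigma>. \<sigma> permutes {1..r}}. [sign \<sigma>] \<cdot>\<^bsub>tpow K V r\<^esub> perm_act K V r \<sigma> z)"

definition ealg_kernel :: "('k, 'r) ring_scheme \<Rightarrow> ('k, 'v, 'c) module_scheme \<Rightarrow> ('v list \<Rightarrow> 'k) set set" where
  "ealg_kernel K V = Idl\<^bsub>talg K V\<^esub> {word K V [x] \<otimes>\<^bsub>talg K V\<^esub> word K V [x] | x. x \<in> carrier V}"

definition ealg :: "('k, 'r) ring_scheme \<Rightarrow> ('k, 'v, 'c) module_scheme \<Rightarrow> ('k, ('v list \<Rightarrow> 'k) set set) module" where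
  "ealg K V = quot (talg K V) (ealg_kernel K V)"

definition wedge :: "('k, 'r) ring_scheme \<Rightarrow> ('k, 'v, 'c) module_scheme \<Rightarrow> 'v list \<Rightarrow> ('v list \<Rightarrow> 'k) set set" where
  "wedge K V xs = ealg_kernel K V +>\<^bsub>talg K V\<^esub> word K V xs"

definition extpow ::
  "('k, 'r) ring_scheme \<Rightarrow> ('k, 'v, 'c) module_scheme \<Rightarrow> nat \<Rightarrow> ('k, ('v list \<Rightarrow> 'k) set set) module" where
  "extpow K V r =
     (ealg K V)\<lparr>carrier := span_of K (ealg K V) {wedge K V xs | xs. xs \<in> lists (carrier V) \<and> length xs = r}\<rparr>"

definition nsym_rel :: "('k, 'r) ring_scheme \<Rightarrow> ('k, 'v, 'c) module_scheme \<Rightarrow> nat \<Rightarrow> ('v list \<Rightarrow> 'k) set set" where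
  "nsym_rel K V N = Ant K V N ` carrier (tpow K V N)"

definition nsym :: "('k, 'r) ring_scheme \<Rightarrow> ('k, 'v, 'c) module_scheme \<Rightarrow> nat \<Rightarrow>
    ('k, ('v list \<Rightarrow> 'k) set set) module" where
  "nsym K V N = quot (talg K V) (Idl\<^bsub>talg K V\<^esub> (nsym_rel K V N))"

definition nsym_proj :: "('k, 'r) ring_scheme \<Rightarrow> ('k, 'v, 'c) module_scheme \<Rightarrow> nat \<Rightarrow>
    ('v list \<Rightarrow> 'k) set \<Rightarrow> ('v list \<Rightarrow> 'k) set set" where
  "nsym_proj K V N t = Idl\<^bsub>talg K V\<^esub> (nsym_rel K V N) +>\<^bsub>talg K V\<^esub> t"


section \<open>Koszul cochains, chains and the left cap product\<close>

definition nu :: "nat \<Rightarrow> nat \<Rightarrow> nat" where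
  "nu N p = (if even p then N * (p div 2) else N * (p div 2) + 1)"

definition Wsp :: "('k, 'r) ring_scheme \<Rightarrow> ('k, 'v, 'c) module_scheme \<Rightarrow> nat \<Rightarrow> nat \<Rightarrow>
    ('k, ('v list \<Rightarrow> 'k) set) module" where
  "Wsp K V N r =
     (talg K V)\<lparr>carrier := carrier (tpow K V r) \<inter>
        (\<Inter>(i, j) \<in> {(i, j). i + N + j = r}.
           span_of K (talg K V)
             {u \<otimes>\<^bsub>talg K V\<^esub> \<rho> \<otimes>\<^bsub>talg K V\<^esub> t | u \<rho> t.
                u \<in> carrier (tpow K V i) \<and> \<rho> \<in> nsym_rel K V N \<and> t \<in> carrier (tpow K V j)})\<rparr>"

definition phi :: "('k, 'r) ring_scheme \<Rightarrow> ('k, 'v, 'c) module_scheme \<Rightarrow> nat \<Rightarrow> (nat \<Rightarrow> 'v) \<Rightarrow> nat \<Rightarrow>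
    ('v list \<Rightarrow> 'k) set set \<Rightarrow> ('v list \<Rightarrow> 'k) set" where
  "phi K V n e r =
     the_linear K (extpow K V r) (tpow K V r)
       {s \<in> {1..r} \<rightarrow> {1..n}. strict_mono_on {1..r} s}
       (\<lambda>s. wedge K V (seg 1 r (e \<circ> s))) (\<lambda>s. Ant K V r (word K V (seg 1 r (e \<circ> s))))"

text \<open>The space \<open>(P \<otimes>\<^sub>A M) \<otimes> W\<close> in which the cap product takes its values, with \<open>W = W\<^sub>a\<close>.\<close>

definition cap_target ::
  "('k, 'r) ring_scheme \<Rightarrow> ('k, 'v, 'c) module_scheme \<Rightarrow> nat \<Rightarrow>
    ('k, ('v list \<Rightarrow> 'k) set set, 'p, 'd) bimod_scheme \<Rightarrow>
    ('k, ('v list \<Rightarrow> 'k) set set, 'm, 'e) bimod_scheme \<Rightarrow> nat \<Rightarrow>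
    ('k, (('p \<times> 'm \<Rightarrow> 'k) set \<times> ('v list \<Rightarrow> 'k) set \<Rightarrow> 'k) set) module" where
  "cap_target K V N P M a = tensor K (tensor_over K (nsym K V N) P M) (Wsp K V N a)"

definition cap_tens ::
  "('k, 'r) ring_scheme \<Rightarrow> ('k, 'v, 'c) module_scheme \<Rightarrow> nat \<Rightarrow>
    ('k, ('v list \<Rightarrow> 'k) set set, 'p, 'd) bimod_scheme \<Rightarrow>
    ('k, ('v list \<Rightarrow> 'k) set set, 'm, 'e) bimod_scheme \<Rightarrow> nat \<Rightarrow>
    'p \<Rightarrow> 'm \<Rightarrow> ('v list \<Rightarrow> 'k) set \<Rightarrow> (('p \<times> 'm \<Rightarrow> 'k) set \<times> ('v list \<Rightarrow> 'k) set \<Rightarrow> 'k) set" where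
  "cap_tens K V N P M a y m w =
     tens K (tensor_over K (nsym K V N) P M) (Wsp K V N a) (tens_over K (nsym K V N) P M y m) w"

text \<open>The linear map \<open>u w v w' t \<mapsto> (v f(w') \<otimes>\<^sub>A t m u) \<otimes> w\<close> on
  \<open>V\<^sup>i \<otimes> W\<^sub>a \<otimes> V\<^sup>l \<otimes> W\<^sub>b \<otimes> V\<^sup>j\<close>, seen inside \<open>T(V)\<close>
  as the span of the products \<open>u w v w' t\<close>; the superscripts denote tensor powers of \<open>V\<close>.\<close>

definition contract ::
  "('k, 'r) ring_scheme \<Rightarrow> ('k, 'v, 'c) module_scheme \<Rightarrow> nat \<Rightarrow>
    ('k, ('v list \<Rightarrow> 'k) set set, 'p, 'd) bimod_scheme \<Rightarrow>
    ('k, ('v list \<Rightarrow> 'k) set set, 'm, 'e) bimod_scheme \<Rightarrow>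
    (('v list \<Rightarrow> 'k) set \<Rightarrow> 'p) \<Rightarrow> 'm \<Rightarrow> nat \<Rightarrow> nat \<Rightarrow> nat \<Rightarrow> nat \<Rightarrow> nat \<Rightarrow>
    ('v list \<Rightarrow> 'k) set \<Rightarrow> (('p \<times> 'm \<Rightarrow> 'k) set \<times> ('v list \<Rightarrow> 'k) set \<Rightarrow> 'k) set" where
  "contract K V N P M f m i a l b j =
     (let T = talg K V; \<pi> = nsym_proj K V N;
          I = carrier (tpow K V i) \<times> carrier (Wsp K V N a) \<times> carrier (tpow K V l) \<times>
              carrier (Wsp K V N b) \<times> carrier (tpow K V j);
          g = (\<lambda>(u, w, v, w', t). u \<otimes>\<^bsub>T\<^esub> w \<otimes>\<^bsub>T\<^esub> v \<otimes>\<^bsub>T\<^esub> w' \<otimes>\<^bsub>T\<^esub> t)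
      in the_linear K (T\<lparr>carrier := span_of K T (g ` I)\<rparr>) (cap_target K V N P M a) I g
           (\<lambda>(u, w, v, w', t).
              cap_tens K V N P M a (lact P (\<pi> v) (f w')) (ract M (lact M (\<pi> t) m) (\<pi> u)) w))"

text \<open>The linear map \<open>w w' \<mapsto> (f(w') \<otimes>\<^sub>A m) \<otimes> w\<close> on \<open>W\<^sub>a \<otimes> W\<^sub>b\<close>, seen inside \<open>T(V)\<close>.\<close>

definition contract0 ::
  "('k, 'r) ring_scheme \<Rightarrow> ('k, 'v, 'c) module_scheme \<Rightarrow> nat \<Rightarrow>
    ('k, ('v list \<Rightarrow> 'k) set set, 'p, 'd) bimod_scheme \<Rightarrow>
    ('k, ('v list \<Rightarrow> 'k) set set, 'm, 'e) bimod_scheme \<Rightarrow>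
    (('v list \<Rightarrow> 'k) set \<Rightarrow> 'p) \<Rightarrow> 'm \<Rightarrow> nat \<Rightarrow> nat \<Rightarrow>
    ('v list \<Rightarrow> 'k) set \<Rightarrow> (('p \<times> 'm \<Rightarrow> 'k) set \<times> ('v list \<Rightarrow> 'k) set \<Rightarrow> 'k) set" where
  "contract0 K V N P M f m a b =
     (let T = talg K V; I = carrier (Wsp K V N a) \<times> carrier (Wsp K V N b);
          g = (\<lambda>(w, w'). w \<otimes>\<^bsub>T\<^esub> w')
      in the_linear K (T\<lparr>carrier := span_of K T (g ` I)\<rparr>) (cap_target K V N P M a) I g
           (\<lambda>(w, w'). cap_tens K V N P M a (f w') m w))"

definition cap_pure ::
  "('k, 'r) ring_scheme \<Rightarrow> ('k, 'v, 'c) module_scheme \<Rightarrow> nat \<Rightarrow>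
    ('k, ('v list \<Rightarrow> 'k) set set, 'p, 'd) bimod_scheme \<Rightarrow>
    ('k, ('v list \<Rightarrow> 'k) set set, 'm, 'e) bimod_scheme \<Rightarrow> nat \<Rightarrow> nat \<Rightarrow>
    (('v list \<Rightarrow> 'k) set \<Rightarrow> 'p) \<Rightarrow> 'm \<Rightarrow> ('v list \<Rightarrow> 'k) set \<Rightarrow>
    (('p \<times> 'm \<Rightarrow> 'k) set \<times> ('v list \<Rightarrow> 'k) set \<Rightarrow> 'k) set" where
  "cap_pure K V N P M p q f m w =
     (if odd p \<and> odd (q - p)
      then \<ominus>\<^bsub>cap_target K V N P M (nu N (q - p))\<^esub>
        (\<Oplus>\<^bsub>cap_target K V N P M (nu N (q - p))\<^esub> ij \<in> {(i, j). i + j \<le> N - 2}.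
           contract K V N P M f m (fst ij) (nu N (q - p)) (N - 2 - fst ij - snd ij) (nu N p) (snd ij) w)
      else contract0 K V N P M f m (nu N (q - p)) (nu N p) w)"

text \<open>Only meaningful for \<open>p \<le> q\<close>, because of the truncated \<open>q - p\<close>.\<close>

definition koszul_cap ::
  "('k, 'r) ring_scheme \<Rightarrow> ('k, 'v, 'c) module_scheme \<Rightarrow> nat \<Rightarrow>
    ('k, ('v list \<Rightarrow> 'k) set set, 'p, 'd) bimod_scheme \<Rightarrow>
    ('k, ('v list \<Rightarrow> 'k) set set, 'm, 'e) bimod_scheme \<Rightarrow> nat \<Rightarrow> nat \<Rightarrow>
    (('v list \<Rightarrow> 'k) set \<Rightarrow> 'p) \<Rightarrow> ('m \<times> ('v list \<Rightarrow> 'k) set \<Rightarrow> 'k) set \<Rightarrow>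
    (('p \<times> 'm \<Rightarrow> 'k) set \<times> ('v list \<Rightarrow> 'k) set \<Rightarrow> 'k) set" where
  "koszul_cap K V N P M p q f =
     the_linear K (tensor K M (Wsp K V N (nu N q))) (cap_target K V N P M (nu N (q - p)))
       (carrier M \<times> carrier (Wsp K V N (nu N q)))
       (\<lambda>(m, w). tens K M (Wsp K V N (nu N q)) m w)
       (\<lambda>(m, w). cap_pure K V N P M p q f m w)"

text \<open>The cap product transported to exterior powers via the isomorphisms \<open>\<phi>\<^sub>r\<close>.\<close>

definition koszul_cap_ext ::
  "('k, 'r) ring_scheme \<Rightarrow> ('k, 'v, 'c) module_scheme \<Rightarrow> nat \<Rightarrow> (nat \<Rightarrow> 'v) \<Rightarrow> nat \<Rightarrow>
    ('k, ('v list \<Rightarrow> 'k) set set, 'p, 'd) bimod_scheme \<Rightarrow>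
    ('k, ('v list \<Rightarrow> 'k) set set, 'm, 'e) bimod_scheme \<Rightarrow> nat \<Rightarrow> nat \<Rightarrow>
    (('v list \<Rightarrow> 'k) set set \<Rightarrow> 'p) \<Rightarrow> ('m \<times> ('v list \<Rightarrow> 'k) set set \<Rightarrow> 'k) set \<Rightarrow>
    (('p \<times> 'm \<Rightarrow> 'k) set \<times> ('v list \<Rightarrow> 'k) set set \<Rightarrow> 'k) set" where
  "koszul_cap_ext K V n e N P M p q f z =
     (let a = nu N (q - p); b = nu N p; c = nu N q; PM = tensor_over K (nsym K V N) P M
      in inv_into (carrier (tensor K PM (extpow K V a)))
           (id_tens K PM (extpow K V a) (Wsp K V N a) (phi K V n e a))
           (koszul_cap K V N P M p q
              (f \<circ> inv_into (carrier (extpow K V b)) (phi K V n e b))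
              (id_tens K M (extpow K V c) (Wsp K V N c) (phi K V n e c) z)))"

definition shuffles_of :: "nat \<Rightarrow> nat \<Rightarrow> (nat \<Rightarrow> nat) set" where
  "shuffles_of a b =
     {\<sigma>. \<sigma> permutes {1..a + b} \<and> strict_mono_on {1..a} \<sigma> \<and> strict_mono_on {a + 1..a + b} \<sigma>}"

end

theory Submission
  imports Defs
begin

text \<open>
  Write \<open>a = \<nu>(q - p)\<close>, \<open>b = \<nu>(p)\<close>, so that \<open>a + b = \<nu>(q)\<close>.  Up to the sign, the cap product with \<open>f\<close>
  splits a tensor of degree \<open>a + b\<close> into its first \<open>a\<close> and its last \<open>b\<close> letters and applies \<open>f\<close> to
  the latter.  The hypothesis on \<open>\<nu>\<close> excludes that \<open>p\<close> and \<open>q - p\<close> are both odd unless \<open>N = 2\<close>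
  (\<open>nu_both_odd\<close>), and for \<open>N = 2\<close> the sum in the odd case has the single term \<open>i = j = 0\<close>, which is the
  same splitting with the sign \<open>-1 = (-1) ^ ((q - p) * p)\<close>.  What remains is the expansion of an antisymmetrized
  word: \<open>Ant(x\<^sub>1 ... x\<^sub>c)\<close> is the signed sum of all permuted words, and cutting every word after
  \<open>a\<close> letters groups the permutations by the shuffle that sorts the two parts.

  The grouping is never carried out on permutations.  Once a basis is fixed, a tensor of degree \<open>r\<close> is
  the family of its coefficients (\<open>coef\<close>), and \<open>Ant\<^sub>r(V\<^sup>r)\<close> is the space \<open>alt r\<close> of tensors whose
  coefficients change sign under adjacent swaps and vanish on words with equal neighbours.  Such a family
  is determined by its values on strictly increasing words, because adjacent swaps sort a word
  (\<open>adjacent_sort\<close>).  This gives dual bases by reading off coefficients: \<open>alt_expand\<close> for \<open>Ant\<^sub>r(V\<^sup>r)\<close>, and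
  \<open>double_expand\<close>, which writes an alternating tensor of degree \<open>a + b\<close> in the products of basis elements of
  degrees \<open>a\<close> and \<open>b\<close>.  Alternation can be tested on overlapping windows of length \<open>N\<close>, and this is the
  identity \<open>W\<^sub>r = Ant\<^sub>r(V\<^sup>r)\<close> for the degrees \<open>r = \<nu>(p)\<close> (\<open>Wsp_alt\<close>).

  The splitting map is therefore the linear map \<open>contr\<close> that reads the coefficient of every pair of
  increasing words \<open>I @ J\<close>.  On a word it vanishes unless both parts are increasing (\<open>contr_word\<close>).  Applied to
  the signed sum of the permutations of an increasing word it leaves exactly the shuffles
  (\<open>contr_shuffle\<close>), with the right signs.

  The maps in the statement are described by their values on spanning families.  Each of them is
  identified in the same way: a linear map with these values is exhibited, and \<open>the_linear_eq\<close> says that it is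
  the only one.  For the exterior power the existence comes from \<open>Ant\<close> killing words with a
  repeated neighbour, and the inverse of \<open>\<phi>\<^sub>r\<close> reads off the coefficients of increasing words (\<open>inv_phi\<close>).
\<close>

section \<open>Linear maps and spans\<close>

lemma submoduleI_smult:
  assumes "module K X" and "H \<subseteq> carrier X" and "\<zero>\<^bsub>X\<^esub> \<in> H"
    and "\<And>x y. x \<in> H \<Longrightarrow> y \<in> H \<Longrightarrow> x \<oplus>\<^bsub>X\<^esub> y \<in> H"
    and "\<And>c x. c \<in> carrier K \<Longrightarrow> x \<in> H \<Longrightarrow> c \<odot>\<^bsub>X\<^esub> x \<in> H"
  shows "submodule H K X"
proof -
  interpret X: module K X by fact
  have "\<ominus>\<^bsub>X\<^esub> x \<in> H" if "x \<in> H" for x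
  proof -
    have "x \<in> carrier X" using that assms(2) by blast
    then have "\<ominus>\<^bsub>X\<^esub> x = (\<ominus>\<^bsub>K\<^esub> \<one>\<^bsub>K\<^esub>) \<odot>\<^bsub>X\<^esub> x"
      by (simp add: X.smult_l_minus)
    then show ?thesis using assms(5)[of "\<ominus>\<^bsub>K\<^esub> \<one>\<^bsub>K\<^esub>" x] that by simp
  qed
  then show ?thesis by (intro X.submoduleI) (use assms in auto)
qed

lemma submodule_zero: "submodule H K X \<Longrightarrow> \<zero>\<^bsub>X\<^esub> \<in> H"
  using subgroup.one_closed[of H "add_monoid X"] by (simp add: submodule_def)

lemma submodule_add: "submodule H K X \<Longrightarrow> x \<in> H \<Longrightarrow> y \<in> H \<Longrightarrow> x \<oplus>\<^bsub>X\<^esub> y \<in> H"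
  using subgroup.m_closed[of H "add_monoid X"] by (simp add: submodule_def)

lemma submodule_smult: "submodule H K X \<Longrightarrow> c \<in> carrier K \<Longrightarrow> x \<in> H \<Longrightarrow> c \<odot>\<^bsub>X\<^esub> x \<in> H"
  by (rule submodule.smult_closed)

lemma submodule_subset: "submodule H K X \<Longrightarrow> H \<subseteq> carrier X"
  using subgroup.subset[of H "add_monoid X"] by (simp add: submodule_def)

lemma submodule_finsum:
  assumes "module K X" "submodule H K X" "g \<in> A \<rightarrow> H"
  shows "(\<Oplus>\<^bsub>X\<^esub> i \<in> A. g i) \<in> H"
proof -
  interpret X: module K X by fact
  have H: "H \<subseteq> carrier X" by (rule submodule_subset[OF assms(2)])
  show ?thesis using assms(3)
  proof (induction A rule: infinite_finite_induct)
    case (insert x A)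
    then show ?case
      using submodule_add[OF assms(2)] H by (subst X.finsum_insert) (auto simp: Pi_def)
  qed (simp_all add: submodule_zero[OF assms(2)] X.finsum_infinite)
qed

lemma span_incl: "S \<subseteq> span_of K X S"
  by (auto simp: span_of_def)

lemma span_least: "submodule H K X \<Longrightarrow> S \<subseteq> H \<Longrightarrow> span_of K X S \<subseteq> H"
  by (auto simp: span_of_def)

lemma span_submodule:
  assumes "module K X" "S \<subseteq> carrier X"
  shows "submodule (span_of K X S) K X"
proof -
  interpret X: module K X by fact
  have "span_of K X S \<subseteq> carrier X"
    using span_least[OF X.carrier_is_submodule assms(2)] .
  then show ?thesis
    by (intro submoduleI_smult[OF assms(1)])
      (auto simp: span_of_def intro: submodule_zero submodule_add submodule_smult)
qed

lemma span_subset: "module K X \<Longrightarrow> S \<subseteq> carrier X \<Longrightarrow> span_of K X S \<subseteq> carrier X"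
  by (rule submodule_subset[OF span_submodule])

lemma span_mono: "S \<subseteq> S' \<Longrightarrow> span_of K X S \<subseteq> span_of K X S'"
  by (auto simp: span_of_def)

lemma submodule_of_submodule:
  assumes "submodule H K X" "submodule H' K (X\<lparr>carrier := H\<rparr>)" "module K X"
  shows "submodule H' K X"
proof (rule submoduleI_smult[OF assms(3)])
  show "H' \<subseteq> carrier X" using submodule_subset[OF assms(2)] submodule_subset[OF assms(1)] by auto
  show "\<zero>\<^bsub>X\<^esub> \<in> H'" using submodule_zero[OF assms(2)] by simp
  show "x \<oplus>\<^bsub>X\<^esub> y \<in> H'" if "x \<in> H'" "y \<in> H'" for x y
    using submodule_add[OF assms(2) that] by simp
  show "c \<odot>\<^bsub>X\<^esub> x \<in> H'" if "c \<in> carrier K" "x \<in> H'" for c x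
    using submodule_smult[OF assms(2) that] by simp
qed

text \<open>The spaces of fixed degree are one and the same algebra with a smaller carrier; this transfers
  spanning families to them.\<close>

lemma span_in_submodule:
  assumes "module K X" "submodule H K X" "S \<subseteq> H" "H \<subseteq> span_of K X S"
  shows "span_of K (X\<lparr>carrier := H\<rparr>) S = H"
proof
  have "module K (X\<lparr>carrier := H\<rparr>)"
    using submodule.submodule_is_module[OF assms(2,1)] .
  from span_subset[OF this, of S] show "span_of K (X\<lparr>carrier := H\<rparr>) S \<subseteq> H"
    using assms(3) by simp
  show "H \<subseteq> span_of K (X\<lparr>carrier := H\<rparr>) S"
    unfolding span_of_def[of K "X\<lparr>carrier := H\<rparr>"]
    using span_least submodule_of_submodule[OF assms(2) _ assms(1)] assms(4) by blast
qed

lemma linear_mapsI: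
  assumes "\<And>x. x \<in> carrier X \<Longrightarrow> h x \<in> carrier Y"
    and "\<And>x y. x \<in> carrier X \<Longrightarrow> y \<in> carrier X \<Longrightarrow> h (x \<oplus>\<^bsub>X\<^esub> y) = h x \<oplus>\<^bsub>Y\<^esub> h y"
    and "\<And>c x. c \<in> carrier K \<Longrightarrow> x \<in> carrier X \<Longrightarrow> h (c \<odot>\<^bsub>X\<^esub> x) = c \<odot>\<^bsub>Y\<^esub> h x"
  shows "h \<in> linear_maps K X Y"
  using assms by (auto simp: linear_maps_def)

lemma lin_closed: "h \<in> linear_maps K X Y \<Longrightarrow> x \<in> carrier X \<Longrightarrow> h x \<in> carrier Y"
  by (auto simp: linear_maps_def)

lemma lin_add: "h \<in> linear_maps K X Y \<Longrightarrow> x \<in> carrier X \<Longrightarrow> y \<in> carrier X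
    \<Longrightarrow> h (x \<oplus>\<^bsub>X\<^esub> y) = h x \<oplus>\<^bsub>Y\<^esub> h y"
  by (auto simp: linear_maps_def)

lemma lin_smult: "h \<in> linear_maps K X Y \<Longrightarrow> c \<in> carrier K \<Longrightarrow> x \<in> carrier X
    \<Longrightarrow> h (c \<odot>\<^bsub>X\<^esub> x) = c \<odot>\<^bsub>Y\<^esub> h x"
  by (auto simp: linear_maps_def)

lemma lin_zero:
  assumes "module K X" "module K Y" "h \<in> linear_maps K X Y"
  shows "h \<zero>\<^bsub>X\<^esub> = \<zero>\<^bsub>Y\<^esub>"
proof -
  interpret X: module K X by fact
  interpret Y: module K Y by fact
  have "h (\<zero>\<^bsub>K\<^esub> \<odot>\<^bsub>X\<^esub> \<zero>\<^bsub>X\<^esub>) = \<zero>\<^bsub>K\<^esub> \<odot>\<^bsub>Y\<^esub> h \<zero>\<^bsub>X\<^esub>"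
    by (rule lin_smult[OF assms(3)]) auto
  then show ?thesis using lin_closed[OF assms(3)] by simp
qed

lemma lin_neg:
  assumes "module K X" "module K Y" "h \<in> linear_maps K X Y" "x \<in> carrier X"
  shows "h (\<ominus>\<^bsub>X\<^esub> x) = \<ominus>\<^bsub>Y\<^esub> h x"
proof -
  interpret X: module K X by fact
  interpret Y: module K Y by fact
  have "h ((\<ominus>\<^bsub>K\<^esub> \<one>\<^bsub>K\<^esub>) \<odot>\<^bsub>X\<^esub> x) = (\<ominus>\<^bsub>K\<^esub> \<one>\<^bsub>K\<^esub>) \<odot>\<^bsub>Y\<^esub> h x"
    by (rule lin_smult[OF assms(3)]) (use assms in auto)
  then show ?thesis using lin_closed[OF assms(3,4)] assms(4)
    by (simp add: X.smult_l_minus Y.smult_l_minus)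
qed

lemma lin_diff:
  assumes "module K X" "module K Y" "h \<in> linear_maps K X Y" "x \<in> carrier X" "y \<in> carrier X"
  shows "h (x \<ominus>\<^bsub>X\<^esub> y) = h x \<ominus>\<^bsub>Y\<^esub> h y"
proof -
  interpret X: module K X by fact
  show ?thesis using assms
    by (simp add: a_minus_def lin_add[OF assms(3)] lin_neg)
qed

lemma lin_finsum:
  assumes "module K X" "module K Y" "h \<in> linear_maps K X Y" "g \<in> A \<rightarrow> carrier X"
  shows "h (\<Oplus>\<^bsub>X\<^esub> i \<in> A. g i) = (\<Oplus>\<^bsub>Y\<^esub> i \<in> A. h (g i))"
proof -
  interpret X: module K X by fact
  interpret Y: module K Y by fact
  show ?thesis using assms(4)
  proof (induction A rule: infinite_finite_induct)
    case (insert x A)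
    then show ?case
      using lin_closed[OF assms(3)]
      by (subst X.finsum_insert; simp add: Pi_def lin_add[OF assms(3)] Y.finsum_insert)
  qed (simp_all add: lin_zero[OF assms(1-3)] X.finsum_infinite Y.finsum_infinite)
qed

lemma lin_comp:
  "h \<in> linear_maps K X Y \<Longrightarrow> g \<in> linear_maps K Y Z \<Longrightarrow> (\<lambda>x. g (h x)) \<in> linear_maps K X Z"
  by (auto simp: linear_maps_def Pi_def)

lemma lin_cong:
  assumes "h \<in> linear_maps K X Y" "module K X" "\<And>x. x \<in> carrier X \<Longrightarrow> h x = h' x"
  shows "h' \<in> linear_maps K X Y"
proof -
  interpret X: module K X by fact
  show ?thesis
    by (rule linear_mapsI)
      (use assms(1) in \<open>simp_all add: assms(3)[symmetric] lin_closed lin_add lin_smult\<close>)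
qed

lemma lin_restrict:
  "module K X \<Longrightarrow> h \<in> linear_maps K X Y \<Longrightarrow> restrict h (carrier X) \<in> linear_maps K X Y"
  by (erule lin_cong) auto

lemma lin_sub:
  "h \<in> linear_maps K X Y \<Longrightarrow> H \<subseteq> carrier X \<Longrightarrow> h \<in> linear_maps K (X\<lparr>carrier := H\<rparr>) Y"
  by (rule linear_mapsI) (auto simp: lin_closed lin_add lin_smult subset_iff)

lemma lin_into:
  "h \<in> linear_maps K X Y \<Longrightarrow> (\<And>x. x \<in> carrier X \<Longrightarrow> h x \<in> H) \<Longrightarrow> h \<in> linear_maps K X (Y\<lparr>carrier := H\<rparr>)"
  by (rule linear_mapsI) (auto simp: lin_closed lin_add lin_smult)

lemma diff_eq_zero_iff:
  assumes "module K X" "x \<in> carrier X" "y \<in> carrier X"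
  shows "x \<ominus>\<^bsub>X\<^esub> y = \<zero>\<^bsub>X\<^esub> \<longleftrightarrow> x = y"
proof -
  interpret X: module K X by fact
  have "x = (x \<ominus>\<^bsub>X\<^esub> y) \<oplus>\<^bsub>X\<^esub> y"
    using assms by (simp add: a_minus_def X.add.m_assoc X.l_neg)
  then show ?thesis using assms by (auto simp: a_minus_def X.r_neg)
qed

lemma lin_pointwise_smult:
  assumes "module K Y" "h \<in> linear_maps K X Y" "c \<in> carrier K"
  shows "(\<lambda>x. c \<odot>\<^bsub>Y\<^esub> h x) \<in> linear_maps K X Y"
proof -
  interpret Y: module K Y by fact
  show ?thesis using assms(2,3)
    by (intro linear_mapsI)
      (auto simp: lin_closed lin_add lin_smult Y.smult_r_distr Y.smult_assoc1[symmetric] Y.R.m_comm)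
qed

lemma lin_pointwise_add:
  assumes "module K Y" "h \<in> linear_maps K X Y" "g \<in> linear_maps K X Y"
  shows "(\<lambda>x. h x \<oplus>\<^bsub>Y\<^esub> g x) \<in> linear_maps K X Y"
proof -
  interpret Y: module K Y by fact
  show ?thesis using assms(2,3)
    by (intro linear_mapsI)
      (auto simp: lin_closed lin_add lin_smult Y.smult_r_distr Y.add.m_ac)
qed

lemma lin_const_zero: "module K Y \<Longrightarrow> (\<lambda>x. \<zero>\<^bsub>Y\<^esub>) \<in> linear_maps K X Y"
proof -
  assume "module K Y"
  then interpret Y: module K Y .
  show ?thesis by (rule linear_mapsI) auto
qed

lemma lin_pointwise_finsum:
  assumes "module K Y" "\<And>i. i \<in> A \<Longrightarrow> h i \<in> linear_maps K X Y" "module K X"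
  shows "(\<lambda>x. \<Oplus>\<^bsub>Y\<^esub> i \<in> A. h i x) \<in> linear_maps K X Y"
proof -
  interpret Y: module K Y by fact
  interpret X: module K X by fact
  show ?thesis
    using assms(2)
  proof (induction A rule: infinite_finite_induct)
    case (insert j A)
    have "(\<lambda>x. h j x \<oplus>\<^bsub>Y\<^esub> (\<Oplus>\<^bsub>Y\<^esub> i \<in> A. h i x)) \<in> linear_maps K X Y"
      by (rule lin_pointwise_add[OF assms(1)]) (use insert in auto)
    then show ?case
      by (rule lin_cong[OF _ assms(3)], subst Y.finsum_insert)
        (use insert in \<open>auto intro: lin_closed\<close>)
  qed (simp_all add: Y.finsum_infinite lin_const_zero[OF assms(1)])
qed

lemma lin_preimage_submodule:
  assumes "module K X" "module K Y" "h \<in> linear_maps K X Y" "submodule H K Y"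
  shows "submodule {x \<in> carrier X. h x \<in> H} K X"
proof -
  interpret X: module K X by fact
  show ?thesis
    by (rule submoduleI_smult[OF assms(1)])
      (auto simp: lin_zero[OF assms(1-3)] lin_add[OF assms(3)] lin_smult[OF assms(3)]
        intro: submodule_zero[OF assms(4)] submodule_add[OF assms(4)] submodule_smult[OF assms(4)])
qed

lemma zero_submodule:
  assumes "module K X" shows "submodule {\<zero>\<^bsub>X\<^esub>} K X"
proof -
  interpret X: module K X by fact
  show ?thesis by (rule submoduleI_smult[OF assms]) auto
qed

lemma lin_image_span:
  assumes "module K X" "module K Y" "h \<in> linear_maps K X Y" "S \<subseteq> carrier X" "x \<in> span_of K X S"
    "submodule H K Y" "h ` S \<subseteq> H"
  shows "h x \<in> H"
  using span_least[OF lin_preimage_submodule[OF assms(1-3,6)], of S] assms by auto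

lemma lin_zero_on_span:
  assumes "module K X" "module K Y" "h \<in> linear_maps K X Y" "S \<subseteq> carrier X"
    "\<And>x. x \<in> S \<Longrightarrow> h x = \<zero>\<^bsub>Y\<^esub>" "x \<in> span_of K X S"
  shows "h x = \<zero>\<^bsub>Y\<^esub>"
  using lin_image_span[OF assms(1-4,6) zero_submodule[OF assms(2)]] assms(5) by auto

lemma lin_eq_on_span:
  assumes "module K X" "module K Y" "h \<in> linear_maps K X Y" "g \<in> linear_maps K X Y" "S \<subseteq> carrier X"
    "\<And>x. x \<in> S \<Longrightarrow> h x = g x" "x \<in> span_of K X S"
  shows "h x = g x"
proof -
  interpret X: module K X by fact
  interpret Y: module K Y by fact
  have "submodule {x \<in> carrier X. h x = g x} K X"
    using lin_zero[OF assms(1-3)] lin_zero[OF assms(1,2,4)] assms(3,4)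
    by (intro submoduleI_smult[OF assms(1)]) (auto simp: lin_add lin_smult)
  from span_least[OF this, of S] show ?thesis using assms by auto
qed

text \<open>Uniqueness is agreement on a spanning family; the extensionality demanded of the unique map
  is what turns it into a restriction.\<close>

lemma the_linear_eq:
  assumes "module K X" "module K Y" "F \<in> linear_maps K X Y" "\<And>i. i \<in> I \<Longrightarrow> F (g i) = h i"
    "g ` I \<subseteq> carrier X" "carrier X \<subseteq> span_of K X (g ` I)"
  shows "the_linear K X Y I g h = restrict F (carrier X)"
  unfolding the_linear_def
proof (rule the_equality)
  show "restrict F (carrier X) \<in> linear_maps K X Y \<and> restrict F (carrier X) \<in> extensional (carrier X)
      \<and> (\<forall>i\<in>I. restrict F (carrier X) (g i) = h i)"
  proof (intro conjI ballI)
    show "restrict F (carrier X) (g i) = h i" if "i \<in> I" for i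
      using assms(5) that by (simp add: assms(4) image_subset_iff)
  qed (simp_all add: lin_restrict[OF assms(1,3)])
next
  fix G assume G: "G \<in> linear_maps K X Y \<and> G \<in> extensional (carrier X) \<and> (\<forall>i\<in>I. G (g i) = h i)"
  show "G = restrict F (carrier X)"
  proof (rule extensionalityI[of _ "carrier X"])
    fix x assume "x \<in> carrier X"
    have "G x = F x"
    proof (rule lin_eq_on_span[OF assms(1,2) _ assms(3,5)])
      show "G y = F y" if "y \<in> g ` I" for y
        using that G assms(4) by force
    qed (use G assms(6) \<open>x \<in> carrier X\<close> in blast)+
    show "G x = restrict F (carrier X) x" using \<open>G x = F x\<close> \<open>x \<in> carrier X\<close> by simp
  qed (use G in auto)
qed

lemma sign_smult:
  assumes "module K X" "x \<in> carrier X"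
  shows "[sign \<sigma>] \<cdot>\<^bsub>X\<^esub> x = ([sign \<sigma>] \<cdot>\<^bsub>K\<^esub> \<one>\<^bsub>K\<^esub>) \<odot>\<^bsub>X\<^esub> x"
proof -
  interpret X: module K X by fact
  show ?thesis
    by (rule sign_cases[of \<sigma>])
      (use assms(2) in \<open>simp_all add: add_pow_int_ge add_pow_int_lt X.smult_l_minus\<close>)
qed

section \<open>Quotients\<close>

text \<open>All axioms except the existence of negatives are equations or closure conditions and pass along a
  surjection; negatives are images of negatives.\<close>

lemma module_image:
  assumes "module K X" and surj: "carrier Y = \<pi> ` carrier X"
    and add: "\<And>x y. x \<in> carrier X \<Longrightarrow> y \<in> carrier X \<Longrightarrow> \<pi> (x \<oplus>\<^bsub>X\<^esub> y) = \<pi> x \<oplus>\<^bsub>Y\<^esub> \<pi> y"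
    and smult: "\<And>c x. c \<in> carrier K \<Longrightarrow> x \<in> carrier X \<Longrightarrow> \<pi> (c \<odot>\<^bsub>X\<^esub> x) = c \<odot>\<^bsub>Y\<^esub> \<pi> x"
    and zero: "\<pi> \<zero>\<^bsub>X\<^esub> = \<zero>\<^bsub>Y\<^esub>"
  shows "module K Y"
proof -
  interpret X: module K X by fact
  note e = add[symmetric] smult[symmetric] zero[symmetric]
  show ?thesis
  proof (rule moduleI)
    show "cring K" by (rule X.R.is_cring)
    show "abelian_group Y"
    proof (rule abelian_groupI)
      show "\<exists>y\<in>carrier Y. y \<oplus>\<^bsub>Y\<^esub> x = \<zero>\<^bsub>Y\<^esub>" if x: "x \<in> carrier Y" for x
      proof -
        obtain x' where x': "x' \<in> carrier X" "x = \<pi> x'" using x surj by auto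
        then have "\<pi> (\<ominus>\<^bsub>X\<^esub> x') \<oplus>\<^bsub>Y\<^esub> x = \<zero>\<^bsub>Y\<^esub>"
          by (simp add: e X.l_neg)
        then show ?thesis using x' surj by blast
      qed
    qed (use surj in \<open>auto simp: e X.add.m_ac\<close>)
  qed (use surj in \<open>auto simp: e X.smult_l_distr X.smult_r_distr X.smult_assoc1\<close>)
qed

lemma submodule_abelian_subgroup:
  assumes "module K X" "submodule U K X"
  shows "abelian_subgroup U X"
proof -
  interpret X: module K X by fact
  show ?thesis
    using assms(2) by (intro abelian_subgroupI3 additive_subgroupI X.abelian_group_axioms)
      (simp add: submodule_def)
qed

lemma quot_eq_iff:
  assumes "module K X" "submodule U K X" "x \<in> carrier X" "y \<in> carrier X"
  shows "U +>\<^bsub>X\<^esub> x = U +>\<^bsub>X\<^esub> y \<longleftrightarrow> x \<ominus>\<^bsub>X\<^esub> y \<in> U"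
proof -
  interpret X: module K X by fact
  interpret U: abelian_subgroup U X by (rule submodule_abelian_subgroup[OF assms(1,2)])
  have "U +>\<^bsub>X\<^esub> x = U +>\<^bsub>X\<^esub> y \<longleftrightarrow> x \<in> U +>\<^bsub>X\<^esub> y"
    using U.a_rcos_self[OF assms(3)] X.a_repr_independence[OF _ assms(4) U.a_subgroup] by metis
  also have "\<dots> \<longleftrightarrow> x \<ominus>\<^bsub>X\<^esub> y \<in> U"
  proof
    assume "x \<in> U +>\<^bsub>X\<^esub> y"
    then obtain u where "u \<in> U" "x = u \<oplus>\<^bsub>X\<^esub> y" by (auto simp: a_r_coset_def')
    then show "x \<ominus>\<^bsub>X\<^esub> y \<in> U"
      using assms U.a_subset by (auto simp: a_minus_def X.add.m_assoc X.r_neg subset_iff)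
  next
    assume *: "x \<ominus>\<^bsub>X\<^esub> y \<in> U"
    have "x = (x \<ominus>\<^bsub>X\<^esub> y) \<oplus>\<^bsub>X\<^esub> y"
      using assms(3,4) by (simp add: a_minus_def X.add.m_assoc X.l_neg)
    then show "x \<in> U +>\<^bsub>X\<^esub> y" using * by (auto simp: a_r_coset_def')
  qed
  finally show ?thesis .
qed

lemma quot_carrier: "carrier (quot X U) = (\<lambda>x. U +>\<^bsub>X\<^esub> x) ` carrier X"
  by (auto simp: quot_def FactRing_def A_RCOSETS_def')

lemma quot_add:
  assumes "module K X" "submodule U K X" "x \<in> carrier X" "y \<in> carrier X"
  shows "U +>\<^bsub>X\<^esub> (x \<oplus>\<^bsub>X\<^esub> y) = (U +>\<^bsub>X\<^esub> x) \<oplus>\<^bsub>quot X U\<^esub> (U +>\<^bsub>X\<^esub> y)"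
proof -
  interpret U: abelian_subgroup U X by (rule submodule_abelian_subgroup[OF assms(1,2)])
  show ?thesis by (simp add: quot_def FactRing_def U.a_rcos_sum assms(3,4))
qed

lemma quot_zero:
  assumes "module K X" "submodule U K X"
  shows "U +>\<^bsub>X\<^esub> \<zero>\<^bsub>X\<^esub> = \<zero>\<^bsub>quot X U\<^esub>"
proof -
  interpret X: module K X by fact
  interpret U: abelian_subgroup U X by (rule submodule_abelian_subgroup[OF assms(1,2)])
  show ?thesis by (simp add: quot_def FactRing_def X.a_coset_add_zero[OF U.a_subset])
qed

text \<open>The scalar multiple of a coset is a union over its representatives, and all members of that union
  coincide.\<close>

lemma quot_smult:
  assumes "module K X" "submodule U K X" "c \<in> carrier K" "x \<in> carrier X"
  shows "U +>\<^bsub>X\<^esub> (c \<odot>\<^bsub>X\<^esub> x) = c \<odot>\<^bsub>quot X U\<^esub> (U +>\<^bsub>X\<^esub> x)"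
proof -
  interpret X: module K X by fact
  interpret U: abelian_subgroup U X by (rule submodule_abelian_subgroup[OF assms(1,2)])
  have "U +>\<^bsub>X\<^esub> (c \<odot>\<^bsub>X\<^esub> y) = U +>\<^bsub>X\<^esub> (c \<odot>\<^bsub>X\<^esub> x)" if y: "y \<in> U +>\<^bsub>X\<^esub> x" for y
  proof -
    obtain u where u: "u \<in> U" "y = u \<oplus>\<^bsub>X\<^esub> x" using y by (auto simp: a_r_coset_def')
    have uc: "u \<in> carrier X" using u(1) U.a_subset by auto
    have "c \<odot>\<^bsub>X\<^esub> y \<ominus>\<^bsub>X\<^esub> c \<odot>\<^bsub>X\<^esub> x = c \<odot>\<^bsub>X\<^esub> u"
      using assms(3,4) uc by (simp add: u(2) X.smult_r_distr a_minus_def X.add.m_assoc X.r_neg)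
    then show ?thesis
      using submodule_smult[OF assms(2,3) u(1)] assms uc u(2)
      by (subst quot_eq_iff[OF assms(1,2)]) auto
  qed
  moreover have "x \<in> U +>\<^bsub>X\<^esub> x" by (rule U.a_rcos_self[OF assms(4)])
  ultimately have "(\<Union>y \<in> U +>\<^bsub>X\<^esub> x. U +>\<^bsub>X\<^esub> (c \<odot>\<^bsub>X\<^esub> y)) = U +>\<^bsub>X\<^esub> (c \<odot>\<^bsub>X\<^esub> x)"
    by (intro UN_constant_eq) blast+
  then show ?thesis by (simp add: quot_def)
qed

lemma quot_module:
  assumes "module K X" "submodule U K X"
  shows "module K (quot X U)"
  by (rule module_image[OF assms(1) quot_carrier quot_add[OF assms] quot_smult[OF assms] quot_zero[OF assms]])

lemma quot_proj_linear:
  assumes "module K X" "submodule U K X"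
  shows "(\<lambda>x. U +>\<^bsub>X\<^esub> x) \<in> linear_maps K X (quot X U)"
  by (rule linear_mapsI) (simp_all add: quot_carrier quot_add[OF assms] quot_smult[OF assms])

lemma quot_lift:
  assumes "module K X" "submodule U K X" "module K Y" "h \<in> linear_maps K X Y"
    and zero: "\<And>u. u \<in> U \<Longrightarrow> h u = \<zero>\<^bsub>Y\<^esub>"
  shows "\<exists>F \<in> linear_maps K (quot X U) Y. \<forall>x \<in> carrier X. F (U +>\<^bsub>X\<^esub> x) = h x"
proof -
  interpret X: module K X by fact
  interpret Y: module K Y by fact
  define F where "F C = h (SOME x. x \<in> carrier X \<and> C = U +>\<^bsub>X\<^esub> x)" for C
  have F: "F (U +>\<^bsub>X\<^esub> x) = h x" if x: "x \<in> carrier X" for x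
  proof -
    define y where "y = (SOME y. y \<in> carrier X \<and> U +>\<^bsub>X\<^esub> x = U +>\<^bsub>X\<^esub> y)"
    have y: "y \<in> carrier X \<and> U +>\<^bsub>X\<^esub> x = U +>\<^bsub>X\<^esub> y"
      unfolding y_def by (rule someI[of _ x]) (use x in auto)
    then have "x \<ominus>\<^bsub>X\<^esub> y \<in> U" using quot_eq_iff[OF assms(1,2) x] by blast
    then have "h x \<ominus>\<^bsub>Y\<^esub> h y = \<zero>\<^bsub>Y\<^esub>"
      using zero lin_diff[OF assms(1,3,4) x] y by metis
    then have "h x = h y"
      using lin_closed[OF assms(4)] x y diff_eq_zero_iff[OF assms(3)] by blast
    then show ?thesis by (simp only: F_def y_def[symmetric])
  qed
  have "F \<in> linear_maps K (quot X U) Y"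
    by (rule linear_mapsI)
      (auto simp: quot_carrier F quot_add[OF assms(1,2), symmetric] quot_smult[OF assms(1,2), symmetric]
        lin_closed[OF assms(4)] lin_add[OF assms(4)] lin_smult[OF assms(4)])
  then show ?thesis using F by blast
qed

lemma span_image_lin:
  assumes "module K X" "module K Y" "h \<in> linear_maps K X Y" "carrier Y \<subseteq> h ` carrier X"
    "S \<subseteq> carrier X" "carrier X \<subseteq> span_of K X S"
  shows "carrier Y \<subseteq> span_of K Y (h ` S)"
proof
  fix y assume "y \<in> carrier Y"
  then obtain x where x: "x \<in> carrier X" "y = h x" using assms(4) by auto
  have "h ` S \<subseteq> carrier Y" using assms(5) lin_closed[OF assms(3)] by auto
  from span_submodule[OF assms(2) this] show "y \<in> span_of K Y (h ` S)"
    using lin_image_span[OF assms(1-3,5)] x assms(6) span_incl by (metis in_mono)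
qed

section \<open>Free modules and tensor products\<close>

lemma free_space_simps:
  "u \<in> carrier (free_space K S) \<longleftrightarrow>
     (\<forall>s. u s \<in> carrier K) \<and> (\<forall>s. s \<notin> S \<longrightarrow> u s = \<zero>\<^bsub>K\<^esub>) \<and> finite {s. u s \<noteq> \<zero>\<^bsub>K\<^esub>}"
  "\<zero>\<^bsub>free_space K S\<^esub> = (\<lambda>s. \<zero>\<^bsub>K\<^esub>)"
  "u \<oplus>\<^bsub>free_space K S\<^esub> v = (\<lambda>s. u s \<oplus>\<^bsub>K\<^esub> v s)"
  "c \<odot>\<^bsub>free_space K S\<^esub> u = (\<lambda>s. c \<otimes>\<^bsub>K\<^esub> u s)"
  by (auto simp: free_space_def)

lemma free_space_module:
  assumes "cring K" shows "module K (free_space K S)"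
proof -
  interpret K: cring K by fact
  have fin: "finite {s. u s \<oplus>\<^bsub>K\<^esub> v s \<noteq> \<zero>\<^bsub>K\<^esub>}"
    if "finite {s. u s \<noteq> \<zero>\<^bsub>K\<^esub>}" "finite {s. v s \<noteq> \<zero>\<^bsub>K\<^esub>}" for u v
    by (rule finite_subset[OF _ finite_UnI[OF that]]) auto
  have fin': "finite {s. c \<otimes>\<^bsub>K\<^esub> u s \<noteq> \<zero>\<^bsub>K\<^esub>}"
    if "finite {s. u s \<noteq> \<zero>\<^bsub>K\<^esub>}" "c \<in> carrier K" for c u
    by (rule finite_subset[OF _ that(1)]) (use that in auto)
  show ?thesis
  proof (rule moduleI)
    show "abelian_group (free_space K S)"
    proof (rule abelian_groupI)
      fix x assume x: "x \<in> carrier (free_space K S)"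
      then have "(\<lambda>s. \<ominus>\<^bsub>K\<^esub> \<one>\<^bsub>K\<^esub> \<otimes>\<^bsub>K\<^esub> x s) \<in> carrier (free_space K S)"
        by (auto simp: free_space_simps intro!: fin')
      moreover have "(\<lambda>s. \<ominus>\<^bsub>K\<^esub> \<one>\<^bsub>K\<^esub> \<otimes>\<^bsub>K\<^esub> x s) \<oplus>\<^bsub>free_space K S\<^esub> x = \<zero>\<^bsub>free_space K S\<^esub>"
        using x by (auto simp: free_space_simps K.l_minus K.l_neg)
      ultimately show "\<exists>y\<in>carrier (free_space K S). y \<oplus>\<^bsub>free_space K S\<^esub> x = \<zero>\<^bsub>free_space K S\<^esub>"
        by blast
    qed (auto simp: free_space_simps K.add.m_ac intro!: fin)
  qed (auto simp: free_space_simps assms K.l_distr K.r_distr K.m_assoc intro!: fin')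
qed

lemma gen_closed:
  assumes "cring K" "s \<in> S" shows "gen K s \<in> carrier (free_space K S)"
proof -
  interpret K: cring K by fact
  have "finite {t. gen K s t \<noteq> \<zero>\<^bsub>K\<^esub>}"
    by (rule finite_subset[of _ "{s}"]) (auto simp: gen_def)
  then show ?thesis using assms(2) by (auto simp: free_space_simps gen_def)
qed

text \<open>Induction on a finite set containing the support: one coefficient is split off at a time.\<close>

lemma free_space_span:
  assumes "cring K" shows "carrier (free_space K S) \<subseteq> span_of K (free_space K S) (gen K ` S)"
proof -
  interpret K: cring K by fact
  let ?F = "free_space K S"
  interpret F: module K ?F by (rule free_space_module[OF assms])
  have g: "gen K ` S \<subseteq> carrier ?F" using gen_closed[OF assms] by auto
  note sub = span_submodule[OF F.module_axioms g]
  have "u \<in> span_of K ?F (gen K ` S)"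
    if "finite T" "u \<in> carrier ?F" "{s. u s \<noteq> \<zero>\<^bsub>K\<^esub>} \<subseteq> T" for T u
    using that
  proof (induction T arbitrary: u rule: finite_induct)
    case empty
    then have "u = \<zero>\<^bsub>?F\<^esub>" by (auto simp: free_space_simps)
    then show ?case using submodule_zero[OF sub] by simp
  next
    case (insert s T)
    show ?case
    proof (cases "u s = \<zero>\<^bsub>K\<^esub>")
      case True
      then show ?thesis using insert by (intro insert.IH) auto
    next
      case False
      then have s: "s \<in> S" using insert by (auto simp: free_space_simps)
      let ?v = "u(s := \<zero>\<^bsub>K\<^esub>)"
      have c: "u s \<in> carrier K" using insert by (auto simp: free_space_simps)
      have "finite {t. ?v t \<noteq> \<zero>\<^bsub>K\<^esub>}"
        by (rule finite_subset[OF _ insert(1)]) (use insert in auto)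
      then have v: "?v \<in> carrier ?F" using insert by (auto simp: free_space_simps)
      have "?v \<in> span_of K ?F (gen K ` S)"
        by (rule insert.IH[OF v]) (use insert in auto)
      moreover have "u s \<odot>\<^bsub>?F\<^esub> gen K s \<in> span_of K ?F (gen K ` S)"
        by (rule submodule_smult[OF sub c])
          (rule subsetD[OF span_incl], use s in simp)
      moreover have "u = ?v \<oplus>\<^bsub>?F\<^esub> (u s \<odot>\<^bsub>?F\<^esub> gen K s)"
        using insert(4) c by (auto simp: free_space_simps gen_def fun_eq_iff)
      ultimately show ?thesis
        using submodule_add[OF sub, of ?v "u s \<odot>\<^bsub>?F\<^esub> gen K s"] by simp
    qed
  qed
  then show ?thesis by (auto simp: free_space_simps)
qed

lemma free_space_lift:
  assumes "module K Y" "h \<in> S \<rightarrow> carrier Y"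
  shows "\<exists>F \<in> linear_maps K (free_space K S) Y. \<forall>s \<in> S. F (gen K s) = h s"
proof -
  interpret Y: module K Y by fact
  let ?X = "free_space K S"
  interpret X: module K ?X by (rule free_space_module[OF Y.R.is_cring])
  define F where "F u = (\<Oplus>\<^bsub>Y\<^esub> s \<in> {s. u s \<noteq> \<zero>\<^bsub>K\<^esub>}. u s \<odot>\<^bsub>Y\<^esub> h s)" for u
  have F: "F u = (\<Oplus>\<^bsub>Y\<^esub> s \<in> T. u s \<odot>\<^bsub>Y\<^esub> h s)"
    if "u \<in> carrier ?X" "finite T" "{s. u s \<noteq> \<zero>\<^bsub>K\<^esub>} \<subseteq> T" "T \<subseteq> S" for u T
    unfolding F_def
    by (rule Y.add.finprod_mono_neutral_cong_left)
      (use that assms(2) in \<open>auto simp: free_space_simps Pi_def subset_iff\<close>)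
  have supp: "finite {s. u s \<noteq> \<zero>\<^bsub>K\<^esub>}" "{s. u s \<noteq> \<zero>\<^bsub>K\<^esub>} \<subseteq> S" if "u \<in> carrier ?X" for u
    using that by (auto simp: free_space_simps)
  have h: "h s \<in> carrier Y" if "s \<in> S" for s using assms(2) that by auto
  have uc: "u s \<in> carrier K" if "u \<in> carrier ?X" for u s using that by (auto simp: free_space_simps)
  have "F \<in> linear_maps K ?X Y"
  proof (rule linear_mapsI)
    fix u assume u: "u \<in> carrier ?X"
    show "F u \<in> carrier Y"
      unfolding F_def by (rule Y.finsum_closed) (use supp(2)[OF u] h uc[OF u] in auto)
    fix v assume v: "v \<in> carrier ?X"
    let ?T = "{s. u s \<noteq> \<zero>\<^bsub>K\<^esub>} \<union> {s. v s \<noteq> \<zero>\<^bsub>K\<^esub>}"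
    have T: "finite ?T" "?T \<subseteq> S" using supp[OF u] supp[OF v] by auto
    have "F (u \<oplus>\<^bsub>?X\<^esub> v) = (\<Oplus>\<^bsub>Y\<^esub> s \<in> ?T. (u \<oplus>\<^bsub>?X\<^esub> v) s \<odot>\<^bsub>Y\<^esub> h s)"
      by (rule F[OF _ T(1) _ T(2)]) (use u v in auto, auto simp: free_space_simps)
    also have "\<dots> = (\<Oplus>\<^bsub>Y\<^esub> s \<in> ?T. u s \<odot>\<^bsub>Y\<^esub> h s \<oplus>\<^bsub>Y\<^esub> v s \<odot>\<^bsub>Y\<^esub> h s)"
      by (rule Y.add.finprod_cong') (use T h uc[OF u] uc[OF v] in
          \<open>auto simp: free_space_simps Y.smult_l_distr subset_iff\<close>)
    also have "\<dots> = (\<Oplus>\<^bsub>Y\<^esub> s \<in> ?T. u s \<odot>\<^bsub>Y\<^esub> h s) \<oplus>\<^bsub>Y\<^esub> (\<Oplus>\<^bsub>Y\<^esub> s \<in> ?T. v s \<odot>\<^bsub>Y\<^esub> h s)"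
      by (rule Y.finsum_addf) (use T h uc[OF u] uc[OF v] in \<open>auto simp: subset_iff\<close>)
    also have "\<dots> = F u \<oplus>\<^bsub>Y\<^esub> F v"
      using F[OF u T(1) _ T(2)] F[OF v T(1) _ T(2)] by simp
    finally show "F (u \<oplus>\<^bsub>?X\<^esub> v) = F u \<oplus>\<^bsub>Y\<^esub> F v" .
  next
    fix c u assume c: "c \<in> carrier K" and u: "u \<in> carrier ?X"
    let ?T = "{s. u s \<noteq> \<zero>\<^bsub>K\<^esub>}"
    have T: "finite ?T" "?T \<subseteq> S" using supp[OF u] by auto
    have "F (c \<odot>\<^bsub>?X\<^esub> u) = (\<Oplus>\<^bsub>Y\<^esub> s \<in> ?T. (c \<odot>\<^bsub>?X\<^esub> u) s \<odot>\<^bsub>Y\<^esub> h s)"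
      by (rule F[OF _ T(1) _ T(2)]) (use u c in auto, auto simp: free_space_simps)
    also have "\<dots> = (\<Oplus>\<^bsub>Y\<^esub> s \<in> ?T. c \<odot>\<^bsub>Y\<^esub> (u s \<odot>\<^bsub>Y\<^esub> h s))"
      by (rule Y.add.finprod_cong') (use T h uc[OF u] c in
          \<open>auto simp: free_space_simps Y.smult_assoc1 subset_iff\<close>)
    also have "\<dots> = c \<odot>\<^bsub>Y\<^esub> F u"
      unfolding F_def using T h uc[OF u] c by (intro Y.finsum_smult_ldistr[symmetric]) auto
    finally show "F (c \<odot>\<^bsub>?X\<^esub> u) = c \<odot>\<^bsub>Y\<^esub> F u" .
  qed
  moreover have "F (gen K s) = h s" if s: "s \<in> S" for s
  proof -
    have "F (gen K s) = (\<Oplus>\<^bsub>Y\<^esub> t \<in> {s}. gen K s t \<odot>\<^bsub>Y\<^esub> h t)"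
      by (rule F) (use s gen_closed[OF Y.R.is_cring s] in \<open>auto simp: gen_def\<close>)
    also have "\<dots> = h s" using h[OF s] by (simp add: gen_def)
    finally show ?thesis .
  qed
  ultimately show ?thesis by blast
qed

definition bilinear_map ::
  "('k, 'r) ring_scheme \<Rightarrow> ('k, 'x, 'c) module_scheme \<Rightarrow> ('k, 'y, 'd) module_scheme \<Rightarrow>
    ('k, 'z, 'e) module_scheme \<Rightarrow> ('x \<Rightarrow> 'y \<Rightarrow> 'z) \<Rightarrow> bool" where
  "bilinear_map K X Y Z B \<longleftrightarrow>
     (\<forall>x \<in> carrier X. B x \<in> linear_maps K Y Z) \<and>
     (\<forall>y \<in> carrier Y. (\<lambda>x. B x y) \<in> linear_maps K X Z)"

lemma bilinear_relations_closed:
  assumes "module K X" "module K Y"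
  shows "bilinear_relations K X Y \<subseteq> carrier (free_space K (carrier X \<times> carrier Y))"
proof -
  interpret X: module K X by fact
  interpret Y: module K Y by fact
  have K: "cring K" using assms(1) by (simp add: module_def)
  interpret F: module K "free_space K (carrier X \<times> carrier Y)"
    by (rule free_space_module[OF K])
  note g = gen_closed[OF K]
  show ?thesis
    unfolding bilinear_relations_def Let_def
    by (auto intro!: F.minus_closed F.a_closed F.smult_closed g)
qed

text \<open>Stated for any subspace containing the bilinear relations, so that it serves the tensor product
  over the field as well as the balanced one.\<close>

lemma quot_bilinear:
  fixes K :: "('k, 'r) ring_scheme" and X :: "('k, 'x, 'c) module_scheme" and Y :: "('k, 'y, 'd) module_scheme"
  defines "F \<equiv> free_space K (carrier X \<times> carrier Y)"
  assumes X: "module K X" and Y: "module K Y" and U: "submodule U K F" and sub: "bilinear_relations K X Y \<subseteq> U"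
  shows "bilinear_map K X Y (quot F U) (\<lambda>x y. U +>\<^bsub>F\<^esub> gen K (x, y))"
proof -
  interpret X: module K X by fact
  interpret Y: module K Y by fact
  have K: "cring K" using X by (simp add: module_def)
  have Fm: "module K F" unfolding F_def by (rule free_space_module[OF K])
  interpret F: module K F by (rule Fm)
  have g: "gen K (x, y) \<in> carrier F" if "x \<in> carrier X" "y \<in> carrier Y" for x y
    unfolding F_def by (rule gen_closed[OF K]) (use that in auto)
  note pr = quot_proj_linear[OF Fm U]
  note ad = lin_add[OF pr, symmetric] and sm = lin_smult[OF pr, symmetric] and cl = lin_closed[OF pr]
  note eq = quot_eq_iff[OF Fm U, THEN iffD2]
  note rel = subsetD[OF sub, unfolded bilinear_relations_def Let_def F_def[symmetric]]
  show ?thesis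
    unfolding bilinear_map_def
  proof (intro conjI ballI)
    fix x assume x: "x \<in> carrier X"
    show "(\<lambda>y. U +>\<^bsub>F\<^esub> gen K (x, y)) \<in> linear_maps K Y (quot F U)"
    proof (rule linear_mapsI)
      fix y assume y: "y \<in> carrier Y"
      show "U +>\<^bsub>F\<^esub> gen K (x, y) \<in> carrier (quot F U)" using cl g x y by auto
      { fix y' assume y': "y' \<in> carrier Y"
        show "U +>\<^bsub>F\<^esub> gen K (x, y \<oplus>\<^bsub>Y\<^esub> y') =
            (U +>\<^bsub>F\<^esub> gen K (x, y)) \<oplus>\<^bsub>quot F U\<^esub> (U +>\<^bsub>F\<^esub> gen K (x, y'))"
          unfolding ad[OF g[OF x y] g[OF x y']]
          by (rule eq, use g x y y' in simp_all, rule rel) (use x y y' in blast) }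
      { fix c assume c: "c \<in> carrier K"
        show "U +>\<^bsub>F\<^esub> gen K (x, c \<odot>\<^bsub>Y\<^esub> y) = c \<odot>\<^bsub>quot F U\<^esub> (U +>\<^bsub>F\<^esub> gen K (x, y))"
          unfolding sm[OF c g[OF x y]]
          by (rule eq, use g x y c in simp_all, rule rel) (use x y c in blast) }
    qed
  next
    fix y assume y: "y \<in> carrier Y"
    show "(\<lambda>x. U +>\<^bsub>F\<^esub> gen K (x, y)) \<in> linear_maps K X (quot F U)"
    proof (rule linear_mapsI)
      fix x assume x: "x \<in> carrier X"
      show "U +>\<^bsub>F\<^esub> gen K (x, y) \<in> carrier (quot F U)" using cl g x y by auto
      { fix x' assume x': "x' \<in> carrier X"
        show "U +>\<^bsub>F\<^esub> gen K (x \<oplus>\<^bsub>X\<^esub> x', y) =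
            (U +>\<^bsub>F\<^esub> gen K (x, y)) \<oplus>\<^bsub>quot F U\<^esub> (U +>\<^bsub>F\<^esub> gen K (x', y))"
          unfolding ad[OF g[OF x y] g[OF x' y]]
          by (rule eq, use g x y x' in simp_all, rule rel) (use x y x' in blast) }
      { fix c assume c: "c \<in> carrier K"
        show "U +>\<^bsub>F\<^esub> gen K (c \<odot>\<^bsub>X\<^esub> x, y) = c \<odot>\<^bsub>quot F U\<^esub> (U +>\<^bsub>F\<^esub> gen K (x, y))"
          unfolding sm[OF c g[OF x y]]
          by (rule eq, use g x y c in simp_all, rule rel) (use x y c in blast) }
    qed
  qed
qed

lemma tensor_kernel_submodule:
  assumes "module K X" "module K Y"
  shows "submodule (tensor_kernel K X Y) K (free_space K (carrier X \<times> carrier Y))"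
  unfolding tensor_kernel_def
  by (rule span_submodule[OF free_space_module bilinear_relations_closed[OF assms]])
    (use assms(1) in \<open>simp add: module_def\<close>)

lemma tensor_module:
  assumes "module K X" "module K Y" shows "module K (tensor K X Y)"
  unfolding tensor_def
  by (rule quot_module[OF free_space_module tensor_kernel_submodule[OF assms]])
    (use assms(1) in \<open>simp add: module_def\<close>)

lemma tens_bilinear:
  assumes "module K X" "module K Y" shows "bilinear_map K X Y (tensor K X Y) (tens K X Y)"
  using quot_bilinear[OF assms tensor_kernel_submodule[OF assms]]
  by (simp add: tensor_def tens_def[abs_def] tensor_kernel_def span_incl)

lemma tensor_span:
  assumes "module K X" "module K Y"
  shows "carrier (tensor K X Y) \<subseteq>
    span_of K (tensor K X Y) ((\<lambda>(x, y). tens K X Y x y) ` (carrier X \<times> carrier Y))"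
proof -
  have K: "cring K" using assms(1) by (simp add: module_def)
  let ?F = "free_space K (carrier X \<times> carrier Y)"
  have "carrier (tensor K X Y) \<subseteq> span_of K (tensor K X Y)
      ((\<lambda>u. tensor_kernel K X Y +>\<^bsub>?F\<^esub> u) ` (gen K ` (carrier X \<times> carrier Y)))"
    using gen_closed[OF K, of _ "carrier X \<times> carrier Y"] unfolding tensor_def
    by (intro span_image_lin[OF free_space_module[OF K] _ quot_proj_linear[OF free_space_module[OF K]
          tensor_kernel_submodule[OF assms]] _ _ free_space_span[OF K]]
        quot_module[OF free_space_module[OF K] tensor_kernel_submodule[OF assms]])
      (auto simp: quot_carrier)
  moreover have "(\<lambda>u. tensor_kernel K X Y +>\<^bsub>?F\<^esub> u) ` (gen K ` (carrier X \<times> carrier Y))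
      = (\<lambda>(x, y). tens K X Y x y) ` (carrier X \<times> carrier Y)"
    by (auto simp: image_image tens_def image_iff)
  ultimately show ?thesis by simp
qed

lemma tensor_lift:
  assumes "module K X" "module K Y" "module K Z" "bilinear_map K X Y Z B"
  shows "\<exists>F \<in> linear_maps K (tensor K X Y) Z.
    \<forall>x \<in> carrier X. \<forall>y \<in> carrier Y. F (tens K X Y x y) = B x y"
proof -
  interpret X: module K X by fact
  interpret Y: module K Y by fact
  interpret Z: module K Z by fact
  have K: "cring K" using assms(1) by (simp add: module_def)
  let ?F = "free_space K (carrier X \<times> carrier Y)"
  have Fm: "module K ?F" by (rule free_space_module[OF K])
  interpret F: module K ?F by (rule Fm)
  note g = gen_closed[OF K, of _ "carrier X \<times> carrier Y"]
  have B1: "B x \<in> linear_maps K Y Z" if "x \<in> carrier X" for x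
    using assms(4) that by (auto simp: bilinear_map_def)
  have B2: "(\<lambda>x. B x y) \<in> linear_maps K X Z" if "y \<in> carrier Y" for y
    using assms(4) that by (auto simp: bilinear_map_def)
  have "(\<lambda>(x, y). B x y) \<in> carrier X \<times> carrier Y \<rightarrow> carrier Z"
    using lin_closed[OF B1] by auto
  from free_space_lift[OF assms(3) this] obtain h where h: "h \<in> linear_maps K ?F Z"
    and hg: "\<And>x y. x \<in> carrier X \<Longrightarrow> y \<in> carrier Y \<Longrightarrow> h (gen K (x, y)) = B x y" by auto
  have Bc: "B x y \<in> carrier Z" if "x \<in> carrier X" "y \<in> carrier Y" for x y
    using lin_closed[OF B1] that by auto
  have "h u = \<zero>\<^bsub>Z\<^esub>" if "u \<in> bilinear_relations K X Y" for u
    using that unfolding bilinear_relations_def Let_def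
    by (auto simp: lin_diff[OF Fm assms(3) h] lin_add[OF h] lin_smult[OF h] g hg Bc
        lin_add[OF B1] lin_add[OF B2] lin_smult[OF B1] lin_smult[OF B2] diff_eq_zero_iff[OF assms(3)])
  then have "h u = \<zero>\<^bsub>Z\<^esub>" if "u \<in> tensor_kernel K X Y" for u
    using lin_zero_on_span[OF Fm assms(3) h bilinear_relations_closed[OF assms(1,2)]] that
    by (auto simp: tensor_kernel_def)
  from quot_lift[OF Fm tensor_kernel_submodule[OF assms(1,2)] assms(3) h this]
  obtain G where "G \<in> linear_maps K (tensor K X Y) Z"
    and "\<And>u. u \<in> carrier ?F \<Longrightarrow> G (tensor_kernel K X Y +>\<^bsub>?F\<^esub> u) = h u"
    by (auto simp: tensor_def)
  then show ?thesis using g hg by (intro bexI[of _ G]) (auto simp: tens_def)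
qed


text \<open>Membership in \<open>lists\<close> serves as an atomic closure condition, and intervals stay in the form \<open>{1..r}\<close>.\<close>

declare in_lists_conv_set [simp del] in_listsD [rule del] in_listsI [rule del]
  One_nat_def [simp del]

section \<open>Algebras and ideals\<close>

text \<open>The ground ring as a module over itself, so that coordinate functionals are linear maps like any other.\<close>

definition self_module :: "('k, 'r) ring_scheme \<Rightarrow> ('k, 'k) module" where
  "self_module K = \<lparr>carrier = carrier K, mult = mult K, one = one K, zero = zero K, add = add K, smult = mult K\<rparr>"

lemma self_module_simps [simp]:
  "carrier (self_module K) = carrier K" "zero (self_module K) = zero K" "add (self_module K) = add K"
  "smult (self_module K) = mult K" "finsum (self_module K) = finsum K"
  by (simp_all add: self_module_def finsum_def finprod_def fun_eq_iff)

lemma self_module: "cring K \<Longrightarrow> module K (self_module K)"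
proof -
  assume "cring K"
  then interpret K: cring K .
  have "abelian_group (self_module K)"
    by (rule abelian_groupI) (auto simp: K.add.m_ac intro: K.add.l_inv_ex)
  then show ?thesis
    by (intro moduleI) (auto simp: K.l_distr K.r_distr K.m_assoc K.is_cring)
qed

text \<open>Associative algebras, not necessarily commutative.\<close>

definition kalg :: "('k, 'r) ring_scheme \<Rightarrow> ('k, 'a, 'c) module_scheme \<Rightarrow> bool" where
  "kalg K T \<longleftrightarrow> module K T \<and> ring T \<and>
     (\<forall>x \<in> carrier T. (\<lambda>y. x \<otimes>\<^bsub>T\<^esub> y) \<in> linear_maps K T T) \<and>
     (\<forall>y \<in> carrier T. (\<lambda>x. x \<otimes>\<^bsub>T\<^esub> y) \<in> linear_maps K T T)"

lemma kalg_module: "kalg K T \<Longrightarrow> module K T"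
  and kalg_ring: "kalg K T \<Longrightarrow> ring T"
  and kalg_left: "kalg K T \<Longrightarrow> x \<in> carrier T \<Longrightarrow> (\<lambda>y. x \<otimes>\<^bsub>T\<^esub> y) \<in> linear_maps K T T"
  and kalg_right: "kalg K T \<Longrightarrow> y \<in> carrier T \<Longrightarrow> (\<lambda>x. x \<otimes>\<^bsub>T\<^esub> y) \<in> linear_maps K T T"
  by (auto simp: kalg_def)

lemma kalg_ideal_submodule:
  assumes "kalg K T" "ideal I T" shows "submodule I K T"
proof -
  interpret I: ideal I T by fact
  interpret T: module K T by (rule kalg_module[OF assms(1)])
  show ?thesis
  proof (rule submoduleI_smult[OF T.module_axioms])
    show "c \<odot>\<^bsub>T\<^esub> x \<in> I" if "c \<in> carrier K" "x \<in> I" for c x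
    proof -
      have x: "x \<in> carrier T" using that I.a_subset by auto
      have "(c \<odot>\<^bsub>T\<^esub> \<one>\<^bsub>T\<^esub>) \<otimes>\<^bsub>T\<^esub> x = c \<odot>\<^bsub>T\<^esub> x"
        using lin_smult[OF kalg_right[OF assms(1) x] that(1) I.one_closed] x by simp
      then show ?thesis using I.I_l_closed[OF that(2), of "c \<odot>\<^bsub>T\<^esub> \<one>\<^bsub>T\<^esub>"] that(1) by simp
    qed
  qed (use I.a_subset in auto)
qed

lemma ideal_quot_mult:
  assumes "ideal I T" "x \<in> carrier T" "y \<in> carrier T"
  shows "(I +>\<^bsub>T\<^esub> x) \<otimes>\<^bsub>quot T I\<^esub> (I +>\<^bsub>T\<^esub> y) = I +>\<^bsub>T\<^esub> (x \<otimes>\<^bsub>T\<^esub> y)"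
  using ideal.rcoset_mult_add[OF assms] by (simp add: quot_def FactRing_def)

lemma ideal_quot_one: "\<one>\<^bsub>quot T I\<^esub> = I +>\<^bsub>T\<^esub> \<one>\<^bsub>T\<^esub>"
  by (simp add: quot_def FactRing_def)

lemma quot_kalg:
  assumes "kalg K T" "ideal I T" shows "kalg K (quot T I)"
proof -
  interpret I: ideal I T by fact
  note Tm = kalg_module[OF assms(1)] and sub = kalg_ideal_submodule[OF assms]
  note Qm = quot_module[OF Tm sub]
  interpret T: module K T by (rule Tm)
  interpret Q: module K "quot T I" by (rule Qm)
  have "ring (quot T I)"
  proof -
    interpret R: ring "T Quot I" by (rule I.quotient_is_ring)
    show ?thesis
    proof (rule ringI)
      show "abelian_group (quot T I)" by (rule Q.abelian_group_axioms)
      show "monoid (quot T I)"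
        by (rule monoidI) (simp_all add: quot_def R.m_assoc)
    qed (simp_all add: quot_def R.l_distr R.r_distr)
  qed
  moreover have induced: "G \<in> linear_maps K (quot T I) (quot T I)"
    if g: "g \<in> linear_maps K T T" and G: "\<And>y. y \<in> carrier T \<Longrightarrow> G (I +>\<^bsub>T\<^esub> y) = I +>\<^bsub>T\<^esub> g y" for g G
    by (rule linear_mapsI)
      (auto simp: quot_carrier G quot_add[OF Tm sub, symmetric] quot_smult[OF Tm sub, symmetric]
        lin_closed[OF g] lin_add[OF g] lin_smult[OF g])
  moreover have "(\<lambda>y. x \<otimes>\<^bsub>quot T I\<^esub> y) \<in> linear_maps K (quot T I) (quot T I)"
    "(\<lambda>y. y \<otimes>\<^bsub>quot T I\<^esub> x) \<in> linear_maps K (quot T I) (quot T I)"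
    if x: "x \<in> carrier (quot T I)" for x
  proof -
    obtain x' where x': "x' \<in> carrier T" "x = I +>\<^bsub>T\<^esub> x'" using x by (auto simp: quot_carrier)
    show "(\<lambda>y. x \<otimes>\<^bsub>quot T I\<^esub> y) \<in> linear_maps K (quot T I) (quot T I)"
      by (rule induced[OF kalg_left[OF assms(1) x'(1)]]) (simp add: x' ideal_quot_mult[OF assms(2)])
    show "(\<lambda>y. y \<otimes>\<^bsub>quot T I\<^esub> x) \<in> linear_maps K (quot T I) (quot T I)"
      by (rule induced[OF kalg_right[OF assms(1) x'(1)]]) (simp add: x' ideal_quot_mult[OF assms(2)])
  qed
  ultimately show ?thesis using Qm by (simp add: kalg_def)
qed

text \<open>By linearity it is enough to test a linear map on products \<open>b g b'\<close> of generators \<open>g\<close> of the ideal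
  with elements of a spanning set: the elements all of whose two-sided multiples are killed form an
  ideal.  Applied with words as spanning set, only products of words occur.\<close>

lemma lin_vanish_ideal:
  assumes "kalg K T" "module K Y" "h \<in> linear_maps K T Y" "G \<subseteq> carrier T"
    and B: "B \<subseteq> carrier T" "carrier T \<subseteq> span_of K T B"
    and van: "\<And>b g b'. b \<in> B \<Longrightarrow> g \<in> G \<Longrightarrow> b' \<in> B \<Longrightarrow> h (b \<otimes>\<^bsub>T\<^esub> g \<otimes>\<^bsub>T\<^esub> b') = \<zero>\<^bsub>Y\<^esub>"
    and z: "z \<in> Idl\<^bsub>T\<^esub> G"
  shows "h z = \<zero>\<^bsub>Y\<^esub>"
proof -
  interpret T: ring T by (rule kalg_ring[OF assms(1)])
  interpret Tm: module K T by (rule kalg_module[OF assms(1)])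
  interpret Y: module K Y by fact
  note Tm = kalg_module[OF assms(1)]
  note l = kalg_left[OF assms(1)] and r = kalg_right[OF assms(1)]
  have 1: "h (b \<otimes>\<^bsub>T\<^esub> g \<otimes>\<^bsub>T\<^esub> y) = \<zero>\<^bsub>Y\<^esub>" if "b \<in> B" "g \<in> G" "y \<in> carrier T" for b g y
  proof (rule lin_zero_on_span[OF Tm assms(2) lin_comp[OF l assms(3)] B(1)])
    show "b \<otimes>\<^bsub>T\<^esub> g \<in> carrier T" using that B(1) assms(4) by auto
  qed (use van that B(2) in auto)
  have 2: "h (x \<otimes>\<^bsub>T\<^esub> g \<otimes>\<^bsub>T\<^esub> y) = \<zero>\<^bsub>Y\<^esub>" if "x \<in> carrier T" "g \<in> G" "y \<in> carrier T" for x g y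
  proof (rule lin_zero_on_span[OF Tm assms(2) lin_comp[OF lin_comp[OF r r] assms(3)] B(1)])
    show "g \<in> carrier T" using that assms(4) by auto
  qed (use 1 that B(2) in auto)
  define H where "H = {z \<in> carrier T. \<forall>x \<in> carrier T. \<forall>y \<in> carrier T. h (x \<otimes>\<^bsub>T\<^esub> z \<otimes>\<^bsub>T\<^esub> y) = \<zero>\<^bsub>Y\<^esub>}"
  have hyp: "(\<lambda>z. h (x \<otimes>\<^bsub>T\<^esub> z \<otimes>\<^bsub>T\<^esub> y)) \<in> linear_maps K T Y" if "x \<in> carrier T" "y \<in> carrier T" for x y
    by (rule lin_comp[OF lin_comp[OF l r] assms(3)]) (use that in auto)
  have "ideal H T"
  proof (rule idealI[OF T.ring_axioms])
    show "subgroup H (add_monoid T)"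
    proof (rule T.add.subgroupI)
      show "H \<noteq> {}" using lin_zero[OF Tm assms(2) hyp] by (auto simp: H_def)
      show "\<ominus>\<^bsub>T\<^esub> a \<in> H" if "a \<in> H" for a
        using that lin_neg[OF Tm assms(2) hyp] by (auto simp: H_def)
      show "a \<oplus>\<^bsub>T\<^esub> b \<in> H" if "a \<in> H" "b \<in> H" for a b
        using that lin_add[OF hyp] by (auto simp: H_def)
    qed (auto simp: H_def)
    show "x \<otimes>\<^bsub>T\<^esub> a \<in> H" if "a \<in> H" "x \<in> carrier T" for a x
      using that by (auto simp: H_def T.m_assoc[symmetric])
    show "a \<otimes>\<^bsub>T\<^esub> x \<in> H" if "a \<in> H" "x \<in> carrier T" for a x
    proof -
      have "x' \<otimes>\<^bsub>T\<^esub> (a \<otimes>\<^bsub>T\<^esub> x) \<otimes>\<^bsub>T\<^esub> y = x' \<otimes>\<^bsub>T\<^esub> a \<otimes>\<^bsub>T\<^esub> (x \<otimes>\<^bsub>T\<^esub> y)"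
        if "x' \<in> carrier T" "y \<in> carrier T" for x' y
        using that \<open>a \<in> H\<close> \<open>x \<in> carrier T\<close> by (auto simp: H_def T.m_assoc)
      then show ?thesis using that by (auto simp: H_def)
    qed
  qed
  moreover have "G \<subseteq> H" using 2 assms(4) by (auto simp: H_def)
  ultimately have "z \<in> H" using T.genideal_minimal z by blast
  then have z: "z \<in> carrier T" and
    *: "\<And>x y. x \<in> carrier T \<Longrightarrow> y \<in> carrier T \<Longrightarrow> h (x \<otimes>\<^bsub>T\<^esub> z \<otimes>\<^bsub>T\<^esub> y) = \<zero>\<^bsub>Y\<^esub>"
    by (auto simp: H_def)
  show ?thesis using *[OF T.one_closed T.one_closed] z by simp
qed

section \<open>The tensor algebra\<close>

lemma free_algebra_simps [simp]:
  "carrier (free_algebra K S) = carrier (free_space K (lists S))"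
  "zero (free_algebra K S) = zero (free_space K (lists S))"
  "add (free_algebra K S) = add (free_space K (lists S))"
  "smult (free_algebra K S) = smult (free_space K (lists S))"
  "\<one>\<^bsub>free_algebra K S\<^esub> = gen K []"
  by (simp_all add: free_algebra_def free_space_def)

lemma free_algebra_mult:
  "u \<otimes>\<^bsub>free_algebra K S\<^esub> v = (\<lambda>w. \<Oplus>\<^bsub>K\<^esub> i \<in> {..length w}. u (take i w) \<otimes>\<^bsub>K\<^esub> v (drop i w))"
  by (simp add: free_algebra_def free_space_def)

lemma free_algebra_linear_maps [simp]:
  "linear_maps K (free_algebra K S) Y = linear_maps K (free_space K (lists S)) Y"
  "linear_maps K Y (free_algebra K S) = linear_maps K Y (free_space K (lists S))"
  by (simp_all add: linear_maps_def)

lemma free_algebra_span [simp]: "span_of K (free_algebra K S) G = span_of K (free_space K (lists S)) G"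
  by (simp add: span_of_def submodule_def submodule_axioms_def)

lemma free_algebra_module: "cring K \<Longrightarrow> module K (free_algebra K S)"
  by (rule module_image[where \<pi> = "\<lambda>x. x", OF free_space_module]) auto

lemma free_algebra_gen_mult:
  assumes "cring K"
  shows "gen K x \<otimes>\<^bsub>free_algebra K S\<^esub> gen K y = gen K (x @ y)"
proof
  interpret K: cring K by fact
  fix w
  have 1: "gen K x (take i w) \<otimes>\<^bsub>K\<^esub> gen K y (drop i w) =
      (if i = length x \<and> w = x @ y then \<one>\<^bsub>K\<^esub> else \<zero>\<^bsub>K\<^esub>)" if "i \<le> length w" for i
    using that by (auto simp: gen_def)
  have "(\<Oplus>\<^bsub>K\<^esub> i \<in> {..length w}. gen K x (take i w) \<otimes>\<^bsub>K\<^esub> gen K y (drop i w)) =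
      (\<Oplus>\<^bsub>K\<^esub> i \<in> {..length w}. if length x = i then (if w = x @ y then \<one>\<^bsub>K\<^esub> else \<zero>\<^bsub>K\<^esub>) else \<zero>\<^bsub>K\<^esub>)"
    by (rule K.add.finprod_cong') (auto simp: 1)
  also have "\<dots> = gen K (x @ y) w"
  proof (cases "w = x @ y")
    case True
    then show ?thesis
      using K.add.finprod_singleton[of "length x" "{..length w}" "\<lambda>i. \<one>\<^bsub>K\<^esub>"] by (simp add: gen_def)
  next
    case False
    then show ?thesis by (simp add: gen_def cong: if_cong)
  qed
  finally show "(gen K x \<otimes>\<^bsub>free_algebra K S\<^esub> gen K y) w = gen K (x @ y) w"
    by (simp add: free_algebra_mult)
qed

lemma free_algebra_mult_closed:
  assumes "cring K" "u \<in> carrier (free_algebra K S)" "v \<in> carrier (free_algebra K S)"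
  shows "u \<otimes>\<^bsub>free_algebra K S\<^esub> v \<in> carrier (free_algebra K S)"
proof -
  interpret K: cring K by fact
  let ?U = "{s. u s \<noteq> \<zero>\<^bsub>K\<^esub>}" and ?V = "{s. v s \<noteq> \<zero>\<^bsub>K\<^esub>}"
  let ?w = "u \<otimes>\<^bsub>free_algebra K S\<^esub> v"
  have u: "u s \<in> carrier K" "u s \<noteq> \<zero>\<^bsub>K\<^esub> \<Longrightarrow> s \<in> lists S" "finite ?U" for s
    using assms(2) by (auto simp: free_space_simps)
  have v: "v s \<in> carrier K" "v s \<noteq> \<zero>\<^bsub>K\<^esub> \<Longrightarrow> s \<in> lists S" "finite ?V" for s
    using assms(3) by (auto simp: free_space_simps)
  have supp: "\<exists>x y. u x \<noteq> \<zero>\<^bsub>K\<^esub> \<and> v y \<noteq> \<zero>\<^bsub>K\<^esub> \<and> w = x @ y" if w: "?w w \<noteq> \<zero>\<^bsub>K\<^esub>" for w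
  proof (rule ccontr)
    assume no: "\<not> ?thesis"
    have "u (take i w) \<otimes>\<^bsub>K\<^esub> v (drop i w) = \<zero>\<^bsub>K\<^esub>" for i
    proof -
      have "u (take i w) = \<zero>\<^bsub>K\<^esub> \<or> v (drop i w) = \<zero>\<^bsub>K\<^esub>"
        using no append_take_drop_id[of i w] by metis
      then show ?thesis using u v by auto
    qed
    then show False using w by (simp add: free_algebra_mult)
  qed
  have "{w. ?w w \<noteq> \<zero>\<^bsub>K\<^esub>} \<subseteq> (\<lambda>(x, y). x @ y) ` (?U \<times> ?V)"
    using supp by (auto simp: image_iff)
  then have "finite {w. ?w w \<noteq> \<zero>\<^bsub>K\<^esub>}"
    by (rule finite_subset) (use u v in auto)
  moreover have "w \<in> lists S" if "?w w \<noteq> \<zero>\<^bsub>K\<^esub>" for w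
  proof -
    from supp[OF that] obtain x y where "u x \<noteq> \<zero>\<^bsub>K\<^esub>" "v y \<noteq> \<zero>\<^bsub>K\<^esub>" "w = x @ y" by blast
    then show ?thesis using u(2) v(2) by auto
  qed
  moreover have "?w w \<in> carrier K" for w
    unfolding free_algebra_mult by (rule K.finsum_closed) (use u v in auto)
  ultimately show ?thesis by (auto simp: free_space_simps)
qed

lemma free_algebra_left_right:
  assumes "cring K" and uF: "u \<in> carrier (free_algebra K S)"
  shows "(\<lambda>v. u \<otimes>\<^bsub>free_algebra K S\<^esub> v) \<in> linear_maps K (free_algebra K S) (free_algebra K S)" (is ?left)
    and "(\<lambda>v. v \<otimes>\<^bsub>free_algebra K S\<^esub> u) \<in> linear_maps K (free_algebra K S) (free_algebra K S)" (is ?right)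
proof -
  interpret K: cring K by fact
  let ?F = "free_algebra K S"
  have c: "v s \<in> carrier K" if "v \<in> carrier ?F" for v s using that by (auto simp: free_space_simps)
  note cl = free_algebra_mult_closed[OF assms(1)]
  have lc: "a \<otimes>\<^bsub>K\<^esub> (k \<otimes>\<^bsub>K\<^esub> b) = k \<otimes>\<^bsub>K\<^esub> (a \<otimes>\<^bsub>K\<^esub> b)"
    if "a \<in> carrier K" "b \<in> carrier K" "k \<in> carrier K" for a b k
    using that by (rule_tac K.m_lcomm)
  have add: "u \<otimes>\<^bsub>?F\<^esub> (v \<oplus>\<^bsub>?F\<^esub> w) = (u \<otimes>\<^bsub>?F\<^esub> v) \<oplus>\<^bsub>?F\<^esub> (u \<otimes>\<^bsub>?F\<^esub> w)"
    "(v \<oplus>\<^bsub>?F\<^esub> w) \<otimes>\<^bsub>?F\<^esub> u = (v \<otimes>\<^bsub>?F\<^esub> u) \<oplus>\<^bsub>?F\<^esub> (w \<otimes>\<^bsub>?F\<^esub> u)"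
    if "v \<in> carrier ?F" "w \<in> carrier ?F" for v w
    using c[OF uF] c[OF that(1)] c[OF that(2)]
    by (auto simp: free_algebra_mult free_space_simps K.r_distr K.l_distr)
  have smult: "u \<otimes>\<^bsub>?F\<^esub> (k \<odot>\<^bsub>?F\<^esub> v) = k \<odot>\<^bsub>?F\<^esub> (u \<otimes>\<^bsub>?F\<^esub> v)"
    "(k \<odot>\<^bsub>?F\<^esub> v) \<otimes>\<^bsub>?F\<^esub> u = k \<odot>\<^bsub>?F\<^esub> (v \<otimes>\<^bsub>?F\<^esub> u)"
    if "k \<in> carrier K" "v \<in> carrier ?F" for k v
    using c[OF uF] c[OF that(2)] that(1)
    by (auto simp: free_algebra_mult free_space_simps lc K.m_assoc K.finsum_rdistr)
  show ?left by (rule linear_mapsI) (intro cl uF add smult; assumption)+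
  show ?right by (rule linear_mapsI) (intro cl uF add smult; assumption)+
qed

text \<open>Associativity is trilinear, hence a statement about words, where it is associativity of
  concatenation.\<close>

lemma free_algebra_kalg:
  assumes "cring K" shows "kalg K (free_algebra K S)"
proof -
  interpret K: cring K by fact
  let ?F = "free_algebra K S"
  note Fm = free_algebra_module[OF assms, of S]
  interpret F: module K ?F by (rule Fm)
  note l = free_algebra_left_right(1)[OF assms, of _ S] and r = free_algebra_left_right(2)[OF assms, of _ S]
  let ?B = "gen K ` lists S"
  have g: "gen K w \<in> carrier ?F" if "w \<in> lists S" for w using gen_closed[OF assms that] by simp
  then have B: "?B \<subseteq> carrier ?F" by auto
  have sp: "v \<in> span_of K ?F ?B" if "v \<in> carrier ?F" for v
    using free_space_span[OF assms, of "lists S"] that by auto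
  note cl = free_algebra_mult_closed[OF assms, of _ S]
  note gm = free_algebra_gen_mult[OF assms, where S = S]
  note ext = lin_eq_on_span[OF Fm Fm _ _ B _ sp]
  have a1: "(gen K x \<otimes>\<^bsub>?F\<^esub> gen K y) \<otimes>\<^bsub>?F\<^esub> w = gen K x \<otimes>\<^bsub>?F\<^esub> (gen K y \<otimes>\<^bsub>?F\<^esub> w)"
    if "x \<in> lists S" "y \<in> lists S" "w \<in> carrier ?F" for x y w
    by (rule ext[OF l[OF cl[OF g g]] lin_comp[OF l[OF g] l[OF g]]]) (use that in \<open>auto simp: gm\<close>)
  have a2: "(gen K x \<otimes>\<^bsub>?F\<^esub> v) \<otimes>\<^bsub>?F\<^esub> w = gen K x \<otimes>\<^bsub>?F\<^esub> (v \<otimes>\<^bsub>?F\<^esub> w)"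
    if "x \<in> lists S" "v \<in> carrier ?F" "w \<in> carrier ?F" for x v w
    by (rule ext[OF lin_comp[OF l[OF g] r] lin_comp[OF r l[OF g]]])
      (use that in \<open>auto intro!: a1 simp del: free_algebra_simps\<close>)
  have a3: "(u \<otimes>\<^bsub>?F\<^esub> v) \<otimes>\<^bsub>?F\<^esub> w = u \<otimes>\<^bsub>?F\<^esub> (v \<otimes>\<^bsub>?F\<^esub> w)"
    if "u \<in> carrier ?F" "v \<in> carrier ?F" "w \<in> carrier ?F" for u v w
    by (rule ext[OF lin_comp[OF r r] r[OF cl]])
      (use that in \<open>auto intro!: a2 simp del: free_algebra_simps\<close>)
  have id: "(\<lambda>x. x) \<in> linear_maps K ?F ?F" by (rule linear_mapsI) auto
  have one: "\<one>\<^bsub>?F\<^esub> = gen K []" by simp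
  have g0: "gen K [] \<in> carrier ?F" by (rule g) auto
  have ul: "gen K [] \<otimes>\<^bsub>?F\<^esub> u = u" if "u \<in> carrier ?F" for u
    by (rule ext[OF l[OF g0] id _ that]) (auto simp: gm)
  have ur: "u \<otimes>\<^bsub>?F\<^esub> gen K [] = u" if "u \<in> carrier ?F" for u
    by (rule ext[OF r[OF g0] id _ that]) (auto simp: gm)
  have "ring ?F"
  proof (rule ringI)
    show "monoid ?F"
      by (rule monoidI) (use cl a3 ul ur g0 in \<open>simp_all add: one del: free_algebra_simps\<close>)
  qed (use lin_add[OF l] lin_add[OF r] F.abelian_group_axioms in \<open>simp_all del: free_algebra_simps free_algebra_linear_maps\<close>)
  then show ?thesis using Fm l r by (simp add: kalg_def del: free_algebra_simps free_algebra_linear_maps)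
qed

definition talg_gens :: "('k, 'r) ring_scheme \<Rightarrow> ('k, 'v, 'c) module_scheme \<Rightarrow> ('v list \<Rightarrow> 'k) set" where
  "talg_gens K V =
     (let F = free_algebra K (carrier V) in
        {gen K [x \<oplus>\<^bsub>V\<^esub> y] \<ominus>\<^bsub>F\<^esub> (gen K [x] \<oplus>\<^bsub>F\<^esub> gen K [y]) | x y. x \<in> carrier V \<and> y \<in> carrier V} \<union>
         {gen K [c \<odot>\<^bsub>V\<^esub> x] \<ominus>\<^bsub>F\<^esub> (c \<odot>\<^bsub>F\<^esub> gen K [x]) | c x. c \<in> carrier K \<and> x \<in> carrier V})"

lemma talg_kernel_gens: "talg_kernel K V = Idl\<^bsub>free_algebra K (carrier V)\<^esub> talg_gens K V"
  by (simp add: talg_kernel_def talg_gens_def Let_def)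

lemma talg_gensI:
  "x \<in> carrier V \<Longrightarrow> y \<in> carrier V \<Longrightarrow> gen K [x \<oplus>\<^bsub>V\<^esub> y] \<ominus>\<^bsub>free_algebra K (carrier V)\<^esub>
    (gen K [x] \<oplus>\<^bsub>free_algebra K (carrier V)\<^esub> gen K [y]) \<in> talg_gens K V"
  "c \<in> carrier K \<Longrightarrow> x \<in> carrier V \<Longrightarrow> gen K [c \<odot>\<^bsub>V\<^esub> x] \<ominus>\<^bsub>free_algebra K (carrier V)\<^esub>
    (c \<odot>\<^bsub>free_algebra K (carrier V)\<^esub> gen K [x]) \<in> talg_gens K V"
  unfolding talg_gens_def Let_def by blast+

locale vmod =
  fixes K :: "('k, 'r) ring_scheme" and V :: "('k, 'v, 'c) module_scheme"
  assumes V: "module K V"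
begin

abbreviation F where "F \<equiv> free_algebra K (carrier V)"
abbreviation T where "T \<equiv> talg K V"
abbreviation wd where "wd \<equiv> word K V"
abbreviation tp where "tp r \<equiv> carrier (tpow K V r)"

sublocale V: module K V by (rule V)

lemma K: "cring K" by (rule V.R.is_cring)

lemma gen_F: "xs \<in> lists (carrier V) \<Longrightarrow> gen K xs \<in> carrier F"
  using gen_closed[OF K] by simp

lemma talg_gens_closed: "talg_gens K V \<subseteq> carrier F"
proof -
  interpret F: module K F by (rule free_algebra_module[OF K])
  show ?thesis
    unfolding talg_gens_def Let_def
    by (auto simp del: free_algebra_simps intro!: F.minus_closed F.a_closed F.smult_closed gen_F)
qed

lemma talg_kernel_ideal: "ideal (talg_kernel K V) F"
  unfolding talg_kernel_gens
  using ring.genideal_ideal[OF kalg_ring[OF free_algebra_kalg[OF K]] talg_gens_closed] .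

lemma talg_kernel_submodule: "submodule (talg_kernel K V) K F"
  by (rule kalg_ideal_submodule[OF free_algebra_kalg[OF K] talg_kernel_ideal])

lemma talg_kalg: "kalg K T"
  unfolding talg_def by (rule quot_kalg[OF free_algebra_kalg[OF K] talg_kernel_ideal])

sublocale T: module K T by (rule kalg_module[OF talg_kalg])
sublocale TR: ring T by (rule kalg_ring[OF talg_kalg])

lemmas Tm = kalg_module[OF talg_kalg]
lemmas Tl = kalg_left[OF talg_kalg] and Tr = kalg_right[OF talg_kalg]

lemma word_closed [simp]: "xs \<in> lists (carrier V) \<Longrightarrow> wd xs \<in> carrier T"
  using gen_F by (auto simp: talg_def word_def quot_carrier simp del: free_algebra_simps)

lemma word_mult:
  "xs \<in> lists (carrier V) \<Longrightarrow> ys \<in> lists (carrier V) \<Longrightarrow> wd xs \<otimes>\<^bsub>T\<^esub> wd ys = wd (xs @ ys)"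
  using ideal_quot_mult[OF talg_kernel_ideal gen_F gen_F]
  by (simp add: talg_def word_def free_algebra_gen_mult[OF K])

lemma word_one: "\<one>\<^bsub>T\<^esub> = wd []"
  by (simp add: talg_def word_def ideal_quot_one)

lemma talg_span: "carrier T \<subseteq> span_of K T (wd ` lists (carrier V))"
proof -
  have "carrier T \<subseteq> span_of K T ((\<lambda>u. talg_kernel K V +>\<^bsub>F\<^esub> u) ` (gen K ` lists (carrier V)))"
    unfolding talg_def
  proof (rule span_image_lin[OF free_algebra_module[OF K]])
    show "module K (quot F (talg_kernel K V))" using Tm by (simp add: talg_def)
    show "(+>\<^bsub>F\<^esub>) (talg_kernel K V) \<in> linear_maps K F (quot F (talg_kernel K V))"
      by (rule quot_proj_linear[OF free_algebra_module[OF K] talg_kernel_submodule])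
    show "carrier F \<subseteq> span_of K F (gen K ` lists (carrier V))"
      using free_space_span[OF K] by simp
  qed (use gen_F in \<open>auto simp: quot_carrier simp del: free_algebra_simps\<close>)
  then show ?thesis by (simp add: image_image word_def)
qed

text \<open>The only relations of the tensor algebra, restated in the quotient.\<close>

lemma word1_linear: "(\<lambda>x. wd [x]) \<in> linear_maps K V T"
proof (rule linear_mapsI)
  interpret F: module K F by (rule free_algebra_module[OF K])
  note Fm = free_algebra_module[OF K, of "carrier V"]
  note pr = quot_proj_linear[OF Fm talg_kernel_submodule]
  note eq = quot_eq_iff[OF Fm talg_kernel_submodule, THEN iffD2]
  have ker: "talg_gens K V \<subseteq> talg_kernel K V"
    unfolding talg_kernel_gens
    by (rule ring.genideal_self[OF kalg_ring[OF free_algebra_kalg[OF K]] talg_gens_closed])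
  have g: "gen K [x] \<in> carrier F" if "x \<in> carrier V" for x by (rule gen_F) (use that in auto)
  note [simp del] = free_algebra_simps
  fix x assume x: "x \<in> carrier V"
  show "wd [x] \<in> carrier T" using x by simp
  { fix y assume y: "y \<in> carrier V"
    show "wd [x \<oplus>\<^bsub>V\<^esub> y] = wd [x] \<oplus>\<^bsub>T\<^esub> wd [y]"
      unfolding word_def talg_def lin_add[OF pr g[OF x] g[OF y], symmetric]
      by (rule eq) (use g x y in \<open>auto intro!: subsetD[OF ker] talg_gensI\<close>) }
  { fix c assume c: "c \<in> carrier K"
    show "wd [c \<odot>\<^bsub>V\<^esub> x] = c \<odot>\<^bsub>T\<^esub> wd [x]"
      unfolding word_def talg_def lin_smult[OF pr c g[OF x], symmetric]
      by (rule eq) (use g x c in \<open>auto intro!: subsetD[OF ker] talg_gensI\<close>) }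
qed

lemma word_linear:
  assumes "xs \<in> lists (carrier V)" "ys \<in> lists (carrier V)"
  shows "(\<lambda>x. wd (xs @ x # ys)) \<in> linear_maps K V T"
proof -
  have "(\<lambda>x. wd xs \<otimes>\<^bsub>T\<^esub> wd [x] \<otimes>\<^bsub>T\<^esub> wd ys) \<in> linear_maps K V T"
    by (rule lin_comp[OF lin_comp[OF word1_linear Tl] Tr]) (use assms in auto)
  then show ?thesis
    by (rule lin_cong[OF _ V]) (use assms in \<open>simp add: word_mult\<close>)
qed

lemma tp_def: "tp r = span_of K T {wd xs | xs. xs \<in> lists (carrier V) \<and> length xs = r}"
  by (simp add: tpow_def)

lemma tp_words: "{wd xs | xs. xs \<in> lists (carrier V) \<and> length xs = r} \<subseteq> carrier T"
  by auto

lemma tp_submodule: "submodule (tp r) K T"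
  unfolding tp_def by (rule span_submodule[OF Tm tp_words])

lemma tp_subset: "tp r \<subseteq> carrier T"
  by (rule submodule_subset[OF tp_submodule])

lemma word_tp: "xs \<in> lists (carrier V) \<Longrightarrow> length xs = r \<Longrightarrow> wd xs \<in> tp r"
  unfolding tp_def by (rule subsetD[OF span_incl]) blast

lemma tpow_eq: "tpow K V r = T\<lparr>carrier := tp r\<rparr>"
  by (simp add: tpow_def)

lemma tpow_module: "module K (tpow K V r)"
  by (subst tpow_eq) (rule submodule.submodule_is_module[OF tp_submodule Tm])

lemma tpow_span: "span_of K (tpow K V r) {wd xs | xs. xs \<in> lists (carrier V) \<and> length xs = r} = tp r"
  by (subst tpow_eq, rule span_in_submodule[OF Tm tp_submodule]) (use word_tp in \<open>auto simp: tp_def[symmetric]\<close>)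

lemma tp_mult:
  assumes "z \<in> tp a" "z' \<in> tp b" shows "z \<otimes>\<^bsub>T\<^esub> z' \<in> tp (a + b)"
proof -
  have 1: "wd xs \<otimes>\<^bsub>T\<^esub> z' \<in> tp (a + b)" if xs: "xs \<in> lists (carrier V)" "length xs = a" for xs
  proof (rule lin_image_span[OF Tm Tm Tl[OF word_closed[OF xs(1)]] tp_words _ tp_submodule])
    show "z' \<in> span_of K T {wd xs |xs. xs \<in> lists (carrier V) \<and> length xs = b}"
      using assms(2) by (simp add: tp_def)
    show "(\<otimes>\<^bsub>T\<^esub>) (wd xs) ` {wd xs |xs. xs \<in> lists (carrier V) \<and> length xs = b} \<subseteq> tp (a + b)"
      using xs by (auto simp: word_mult intro!: word_tp)
  qed
  show ?thesis
  proof (rule lin_image_span[OF Tm Tm Tr tp_words _ tp_submodule])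
    show "z \<in> span_of K T {wd xs |xs. xs \<in> lists (carrier V) \<and> length xs = a}"
      using assms(1) by (simp add: tp_def)
    show "z' \<in> carrier T" using assms(2) tp_subset by auto
  qed (use 1 in auto)
qed

end


section \<open>Coordinates\<close>

text \<open>The coefficient at a word of basis indices of a word of vectors: the product of the coordinates of the
  letters, and zero when the lengths differ.\<close>

fun cprod :: "('k, 'r) ring_scheme \<Rightarrow> (nat \<Rightarrow> 'v \<Rightarrow> 'k) \<Rightarrow> nat list \<Rightarrow> 'v list \<Rightarrow> 'k" where
  "cprod K d [] [] = \<one>\<^bsub>K\<^esub>"
| "cprod K d (i # I) (x # xs) = d i x \<otimes>\<^bsub>K\<^esub> cprod K d I xs"
| "cprod K d _ _ = \<zero>\<^bsub>K\<^esub>"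

locale based = vmod K V for K :: "('k, 'r) ring_scheme" and V :: "('k, 'v, 'c) module_scheme" +
  fixes n :: nat and e :: "nat \<Rightarrow> 'v"
  assumes basis: "ordered_basis K V n e"
begin

sublocale selfK: module K "self_module K" by (rule self_module[OF K])

lemmas Sm = self_module[OF K]

lemma e_closed: "i \<in> {1..n} \<Longrightarrow> e i \<in> carrier V"
  using basis by (auto simp: ordered_basis_def)

definition coords where
  "coords v = (THE c. c \<in> {1..n} \<rightarrow>\<^sub>E carrier K \<and> v = (\<Oplus>\<^bsub>V\<^esub> i \<in> {1..n}. c i \<odot>\<^bsub>V\<^esub> e i))"

text \<open>Indices outside \<open>{1..n}\<close> get coordinate zero, so that words of arbitrary numbers are legitimate indices
  and range conditions disappear from the swap rules for coefficients.\<close>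

definition coord where "coord i v = (if i \<in> {1..n} then coords v i else \<zero>\<^bsub>K\<^esub>)"

lemma coords:
  assumes "v \<in> carrier V"
  shows "coords v \<in> {1..n} \<rightarrow>\<^sub>E carrier K" "v = (\<Oplus>\<^bsub>V\<^esub> i \<in> {1..n}. coords v i \<odot>\<^bsub>V\<^esub> e i)"
proof -
  have "\<exists>!c. c \<in> {1..n} \<rightarrow>\<^sub>E carrier K \<and> v = (\<Oplus>\<^bsub>V\<^esub> i \<in> {1..n}. c i \<odot>\<^bsub>V\<^esub> e i)"
    using basis assms by (auto simp: ordered_basis_def)
  from theI'[OF this] show "coords v \<in> {1..n} \<rightarrow>\<^sub>E carrier K"
    "v = (\<Oplus>\<^bsub>V\<^esub> i \<in> {1..n}. coords v i \<odot>\<^bsub>V\<^esub> e i)"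
    by (simp_all add: coords_def)
qed

lemma coord_closed: "v \<in> carrier V \<Longrightarrow> coord i v \<in> carrier K"
  using coords(1)[of v] by (auto simp: coord_def)

lemma coord_expand:
  assumes "v \<in> carrier V" shows "v = (\<Oplus>\<^bsub>V\<^esub> i \<in> {1..n}. coord i v \<odot>\<^bsub>V\<^esub> e i)"
proof -
  have "(\<Oplus>\<^bsub>V\<^esub> i \<in> {1..n}. coords v i \<odot>\<^bsub>V\<^esub> e i) = (\<Oplus>\<^bsub>V\<^esub> i \<in> {1..n}. coord i v \<odot>\<^bsub>V\<^esub> e i)"
    by (rule V.M.add.finprod_cong')
      (use coord_closed[OF assms] e_closed in \<open>auto simp: coord_def intro!: V.smult_closed PiE_mem[OF coords(1)[OF assms]]\<close>)
  then show ?thesis using coords(2)[OF assms] by simp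
qed

lemma coord_eqI:
  assumes "\<And>i. i \<in> {1..n} \<Longrightarrow> c i \<in> carrier K" "v = (\<Oplus>\<^bsub>V\<^esub> i \<in> {1..n}. c i \<odot>\<^bsub>V\<^esub> e i)" "i \<in> {1..n}"
  shows "coord i v = c i"
proof -
  have "v \<in> carrier V" unfolding assms(2) by (rule V.M.finsum_closed) (auto simp: assms(1) e_closed)
  then have ex: "\<exists>!c. c \<in> {1..n} \<rightarrow>\<^sub>E carrier K \<and> v = (\<Oplus>\<^bsub>V\<^esub> i \<in> {1..n}. c i \<odot>\<^bsub>V\<^esub> e i)"
    using basis by (auto simp: ordered_basis_def)
  have "coords v = restrict c {1..n}"
    unfolding coords_def
  proof (rule the1_equality[OF ex], intro conjI)
    show "v = (\<Oplus>\<^bsub>V\<^esub> i \<in> {1..n}. restrict c {1..n} i \<odot>\<^bsub>V\<^esub> e i)"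
      unfolding assms(2) by (rule V.M.add.finprod_cong') (auto simp: assms(1) e_closed)
  qed (use assms(1) in auto)
  then show ?thesis using assms(3) by (simp add: coord_def)
qed

lemma coord_linear: "coord i \<in> linear_maps K V (self_module K)"
proof (cases "i \<in> {1..n}")
  case False
  then have "coord i = (\<lambda>x. \<zero>\<^bsub>K\<^esub>)" by (auto simp: coord_def)
  then show ?thesis using lin_const_zero[OF Sm, of V] by simp
next
  case i: True
  show ?thesis
  proof (rule linear_mapsI)
    fix x assume x: "x \<in> carrier V"
    show "coord i x \<in> carrier (self_module K)" using coord_closed x by simp
    { fix y assume y: "y \<in> carrier V"
      have "x \<oplus>\<^bsub>V\<^esub> y = (\<Oplus>\<^bsub>V\<^esub> j \<in> {1..n}. coord j x \<odot>\<^bsub>V\<^esub> e j) \<oplus>\<^bsub>V\<^esub> (\<Oplus>\<^bsub>V\<^esub> j \<in> {1..n}. coord j y \<odot>\<^bsub>V\<^esub> e j)"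
        using coord_expand[OF x] coord_expand[OF y] by simp
      also have "\<dots> = (\<Oplus>\<^bsub>V\<^esub> j \<in> {1..n}. coord j x \<odot>\<^bsub>V\<^esub> e j \<oplus>\<^bsub>V\<^esub> coord j y \<odot>\<^bsub>V\<^esub> e j)"
        by (rule V.M.finsum_addf[symmetric]) (auto simp: e_closed coord_closed x y)
      also have "\<dots> = (\<Oplus>\<^bsub>V\<^esub> j \<in> {1..n}. (coord j x \<oplus>\<^bsub>K\<^esub> coord j y) \<odot>\<^bsub>V\<^esub> e j)"
        by (rule V.M.add.finprod_cong') (auto simp: e_closed coord_closed x y V.smult_l_distr)
      finally show "coord i (x \<oplus>\<^bsub>V\<^esub> y) = coord i x \<oplus>\<^bsub>self_module K\<^esub> coord i y"
        by (subst coord_eqI[OF _ _ i]) (auto simp: coord_closed x y) }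
    { fix c assume c: "c \<in> carrier K"
      have "c \<odot>\<^bsub>V\<^esub> x = c \<odot>\<^bsub>V\<^esub> (\<Oplus>\<^bsub>V\<^esub> j \<in> {1..n}. coord j x \<odot>\<^bsub>V\<^esub> e j)"
        using coord_expand[OF x] by simp
      also have "\<dots> = (\<Oplus>\<^bsub>V\<^esub> j \<in> {1..n}. c \<odot>\<^bsub>V\<^esub> (coord j x \<odot>\<^bsub>V\<^esub> e j))"
        by (rule V.finsum_smult_ldistr) (auto simp: e_closed coord_closed x c)
      also have "\<dots> = (\<Oplus>\<^bsub>V\<^esub> j \<in> {1..n}. (c \<otimes>\<^bsub>K\<^esub> coord j x) \<odot>\<^bsub>V\<^esub> e j)"
        by (rule V.M.add.finprod_cong') (auto simp: e_closed coord_closed x c V.smult_assoc1)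
      finally show "coord i (c \<odot>\<^bsub>V\<^esub> x) = c \<odot>\<^bsub>self_module K\<^esub> coord i x"
        by (subst coord_eqI[OF _ _ i]) (auto simp: coord_closed x c) }
  qed
qed

lemma coord_e:
  assumes "j \<in> {1..n}" shows "coord i (e j) = (if i = j then \<one>\<^bsub>K\<^esub> else \<zero>\<^bsub>K\<^esub>)"
proof (cases "i \<in> {1..n}")
  case True
  have "(\<Oplus>\<^bsub>V\<^esub> i \<in> {1..n}. (if j = i then \<one>\<^bsub>K\<^esub> else \<zero>\<^bsub>K\<^esub>) \<odot>\<^bsub>V\<^esub> e i)
      = (\<Oplus>\<^bsub>V\<^esub> i \<in> {1..n}. if j = i then e i else \<zero>\<^bsub>V\<^esub>)"
    by (rule V.M.add.finprod_cong') (auto simp: e_closed)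
  also have "\<dots> = e j"
    by (rule V.M.add.finprod_singleton) (use assms e_closed in auto)
  finally show ?thesis
    by (subst coord_eqI[OF _ _ True, of "\<lambda>i. if j = i then \<one>\<^bsub>K\<^esub> else \<zero>\<^bsub>K\<^esub>"]) auto
qed (use assms in \<open>auto simp: coord_def\<close>)

lemma basis_span: "carrier V \<subseteq> span_of K V (e ` {1..n})"
proof
  fix v assume v: "v \<in> carrier V"
  have sub: "submodule (span_of K V (e ` {1..n})) K V"
    by (rule span_submodule[OF V]) (use e_closed in auto)
  show "v \<in> span_of K V (e ` {1..n})"
    by (subst coord_expand[OF v], rule submodule_finsum[OF V sub])
      (use submodule_smult[OF sub coord_closed[OF v]] span_incl[of "e ` {1..n}" K V] in auto)
qed

abbreviation cp where "cp \<equiv> cprod K coord"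

lemma cp_closed: "xs \<in> lists (carrier V) \<Longrightarrow> cp I xs \<in> carrier K"
proof (induction I arbitrary: xs)
  case Nil
  then show ?case by (cases xs) auto
next
  case (Cons i I)
  then show ?case by (cases xs) (auto simp: coord_closed)
qed

lemma cp_length: "length I \<noteq> length xs \<Longrightarrow> xs \<in> lists (carrier V) \<Longrightarrow> cp I xs = \<zero>\<^bsub>K\<^esub>"
proof (induction I arbitrary: xs)
  case Nil
  then show ?case by (cases xs) auto
next
  case (Cons i I)
  then show ?case by (cases xs) (auto simp: coord_closed)
qed

lemma cp_append:
  "length I = length xs \<Longrightarrow> xs \<in> lists (carrier V) \<Longrightarrow> ys \<in> lists (carrier V) \<Longrightarrow>
    cp (I @ J) (xs @ ys) = cp I xs \<otimes>\<^bsub>K\<^esub> cp J ys"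
proof (induction I arbitrary: xs)
  case Nil
  then show ?case by (cases xs) (auto simp: cp_closed)
next
  case (Cons i I)
  then show ?case by (cases xs) (auto simp: coord_closed cp_closed V.R.m_assoc)
qed

lemma cp_linear:
  assumes "xs \<in> lists (carrier V)" "ys \<in> lists (carrier V)"
  shows "(\<lambda>x. cp I (xs @ x # ys)) \<in> linear_maps K V (self_module K)"
proof (cases "length I = length xs + Suc (length ys)")
  case False
  show ?thesis
    by (rule lin_cong[OF lin_const_zero[OF Sm, of V] V]) (use False assms in \<open>simp add: cp_length\<close>)
next
  case True
  define I1 I2 where "I1 = take (length xs) I" and "I2 = drop (length xs) I"
  have I: "I = I1 @ I2" "length I1 = length xs" "length I2 = Suc (length ys)"
    using True by (auto simp: I1_def I2_def)
  then obtain i I3 where I2: "I2 = i # I3" "length I3 = length ys" by (cases I2) auto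
  have "(\<lambda>x. (cp I1 xs \<otimes>\<^bsub>K\<^esub> cp I3 ys) \<odot>\<^bsub>self_module K\<^esub> coord i x) \<in> linear_maps K V (self_module K)"
    by (rule lin_pointwise_smult[OF Sm coord_linear]) (use assms cp_closed in simp)
  then show ?thesis
    by (rule lin_cong[OF _ V])
      (use assms in \<open>simp add: I I2 cp_append cp_closed coord_closed V.R.m_ac\<close>)
qed

text \<open>The product of coordinates is linear in every letter, hence it respects the relations of the tensor
  algebra in the middle of any word.\<close>

lemma coef_ex:
  "\<exists>h \<in> linear_maps K T (self_module K). \<forall>xs \<in> lists (carrier V). h (wd xs) = cp I xs"
proof -
  have "cp I \<in> lists (carrier V) \<rightarrow> carrier (self_module K)" using cp_closed by auto
  from free_space_lift[OF Sm this] obtain g where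
    g: "g \<in> linear_maps K F (self_module K)" and gg: "\<And>xs. xs \<in> lists (carrier V) \<Longrightarrow> g (gen K xs) = cp I xs"
    by auto
  note Fm = free_algebra_module[OF K, of "carrier V"]
  interpret F: module K F by (rule Fm)
  interpret FR: ring F by (rule kalg_ring[OF free_algebra_kalg[OF K]])
  have B: "gen K ` lists (carrier V) \<subseteq> carrier F" using gen_F by auto
  note l = kalg_left[OF free_algebra_kalg[OF K]] and r = kalg_right[OF free_algebra_kalg[OF K]]
  have "g z = \<zero>\<^bsub>self_module K\<^esub>" if z: "z \<in> talg_kernel K V" for z
  proof (rule lin_vanish_ideal[OF free_algebra_kalg[OF K] Sm g talg_gens_closed B _ _ z[unfolded talg_kernel_gens]])
    show "carrier F \<subseteq> span_of K F (gen K ` lists (carrier V))" using free_space_span[OF K] by simp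
    fix b u b' assume "b \<in> gen K ` lists (carrier V)" "b' \<in> gen K ` lists (carrier V)" and u: "u \<in> talg_gens K V"
    then obtain xs ys where xs: "b = gen K xs" "xs \<in> lists (carrier V)" and ys: "b' = gen K ys" "ys \<in> lists (carrier V)"
      by auto
    define h where "h z = g (b \<otimes>\<^bsub>F\<^esub> z \<otimes>\<^bsub>F\<^esub> b')" for z
    have h: "h \<in> linear_maps K F (self_module K)"
      unfolding h_def[abs_def]
      by (rule lin_comp[OF lin_comp[OF l r] g]) (use xs ys gen_F in \<open>auto simp del: free_algebra_simps\<close>)
    have hg: "h (gen K [x]) = cp I (xs @ x # ys)" if "x \<in> carrier V" for x
      using that xs ys by (simp add: h_def free_algebra_gen_mult[OF K] gg)
    have g1: "gen K [x] \<in> carrier F" if "x \<in> carrier V" for x by (rule gen_F) (use that in auto)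
    note cpl = cp_linear[OF xs(2) ys(2), of I]
    have cpc: "cp I (xs @ x # ys) \<in> carrier (self_module K)" if "x \<in> carrier V" for x
      using lin_closed[OF cpl that] .
    note [simp del] = free_algebra_simps
    from u consider (add) x y where "x \<in> carrier V" "y \<in> carrier V"
        "u = gen K [x \<oplus>\<^bsub>V\<^esub> y] \<ominus>\<^bsub>F\<^esub> (gen K [x] \<oplus>\<^bsub>F\<^esub> gen K [y])"
      | (smult) c x where "c \<in> carrier K" "x \<in> carrier V"
        "u = gen K [c \<odot>\<^bsub>V\<^esub> x] \<ominus>\<^bsub>F\<^esub> (c \<odot>\<^bsub>F\<^esub> gen K [x])"
      unfolding talg_gens_def Let_def by blast
    then have "h u = \<zero>\<^bsub>self_module K\<^esub>"
    proof cases
      case add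
      have eq: "h u = h (gen K [x \<oplus>\<^bsub>V\<^esub> y]) \<ominus>\<^bsub>self_module K\<^esub> (h (gen K [x]) \<oplus>\<^bsub>self_module K\<^esub> h (gen K [y]))"
        using add g1 by (simp add: lin_diff[OF Fm Sm h] lin_add[OF h])
      show ?thesis
        unfolding eq by (subst diff_eq_zero_iff[OF Sm])
          (use add lin_add[OF cpl add(1,2)] cpc in \<open>auto simp: hg\<close>)
    next
      case smult
      have eq: "h u = h (gen K [c \<odot>\<^bsub>V\<^esub> x]) \<ominus>\<^bsub>self_module K\<^esub> (c \<odot>\<^bsub>self_module K\<^esub> h (gen K [x]))"
        using smult g1 by (simp add: lin_diff[OF Fm Sm h] lin_smult[OF h])
      show ?thesis
        unfolding eq by (subst diff_eq_zero_iff[OF Sm])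
          (use smult lin_smult[OF cpl smult(1,2)] cpc in \<open>auto simp: hg\<close>)
    qed
    then show "g (b \<otimes>\<^bsub>F\<^esub> u \<otimes>\<^bsub>F\<^esub> b') = \<zero>\<^bsub>self_module K\<^esub>" by (simp add: h_def)
  qed
  from quot_lift[OF Fm talg_kernel_submodule Sm g this]
  obtain G where "G \<in> linear_maps K T (self_module K)"
    and "\<And>x. x \<in> carrier F \<Longrightarrow> G (talg_kernel K V +>\<^bsub>F\<^esub> x) = g x"
    by (auto simp: talg_def)
  then show ?thesis using gen_F gg by (intro bexI[of _ G]) (auto simp: word_def)
qed

definition coef where
  "coef I = (SOME h. h \<in> linear_maps K T (self_module K) \<and> (\<forall>xs \<in> lists (carrier V). h (wd xs) = cp I xs))"

lemma coef_linear: "coef I \<in> linear_maps K T (self_module K)"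
  and coef_word: "xs \<in> lists (carrier V) \<Longrightarrow> coef I (wd xs) = cp I xs"
proof -
  have ex: "\<exists>h. h \<in> linear_maps K T (self_module K) \<and> (\<forall>xs \<in> lists (carrier V). h (wd xs) = cp I xs)"
    using coef_ex[of I] by blast
  have "coef I \<in> linear_maps K T (self_module K) \<and> (\<forall>xs \<in> lists (carrier V). coef I (wd xs) = cp I xs)"
    unfolding coef_def by (fact someI_ex[OF ex])
  then show "coef I \<in> linear_maps K T (self_module K)"
    "xs \<in> lists (carrier V) \<Longrightarrow> coef I (wd xs) = cp I xs" by auto
qed

lemma coef_closed [simp]: "z \<in> carrier T \<Longrightarrow> coef I z \<in> carrier K"
  using lin_closed[OF coef_linear] by simp

lemma coef_add: "z \<in> carrier T \<Longrightarrow> z' \<in> carrier T \<Longrightarrow> coef I (z \<oplus>\<^bsub>T\<^esub> z') = coef I z \<oplus>\<^bsub>K\<^esub> coef I z'"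
  using lin_add[OF coef_linear] by simp

lemma coef_smult: "c \<in> carrier K \<Longrightarrow> z \<in> carrier T \<Longrightarrow> coef I (c \<odot>\<^bsub>T\<^esub> z) = c \<otimes>\<^bsub>K\<^esub> coef I z"
  using lin_smult[OF coef_linear] by simp

lemma coef_finsum: "g \<in> A \<rightarrow> carrier T \<Longrightarrow> coef I (\<Oplus>\<^bsub>T\<^esub> i \<in> A. g i) = (\<Oplus>\<^bsub>K\<^esub> i \<in> A. coef I (g i))"
  using lin_finsum[OF Tm Sm coef_linear] by simp

lemma coef_mult:
  assumes "z \<in> tp a" "length I = a" "z' \<in> carrier T"
  shows "coef (I @ J) (z \<otimes>\<^bsub>T\<^esub> z') = coef I z \<otimes>\<^bsub>K\<^esub> coef J z'"
proof -
  have 1: "coef (I @ J) (wd xs \<otimes>\<^bsub>T\<^esub> z') = coef I (wd xs) \<odot>\<^bsub>self_module K\<^esub> coef J z'"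
    if xs: "xs \<in> lists (carrier V)" "length xs = a" for xs
  proof (rule lin_eq_on_span[OF Tm Sm lin_comp[OF Tl coef_linear] lin_pointwise_smult[OF Sm coef_linear]])
    show "z' \<in> span_of K T (wd ` lists (carrier V))" using talg_span assms(3) by auto
  qed (use xs assms(2) in \<open>auto simp: word_mult coef_word cp_append cp_closed\<close>)
  have "(\<lambda>z. coef J z' \<odot>\<^bsub>self_module K\<^esub> coef I z) \<in> linear_maps K T (self_module K)"
    by (rule lin_pointwise_smult[OF Sm coef_linear]) (use assms in simp)
  then have lin: "(\<lambda>z. coef I z \<otimes>\<^bsub>K\<^esub> coef J z') \<in> linear_maps K T (self_module K)"
    by (rule lin_cong[OF _ Tm]) (use assms(3) in \<open>simp add: V.R.m_comm\<close>)
  show ?thesis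
  proof (rule lin_eq_on_span[OF Tm Sm lin_comp[OF Tr coef_linear] lin tp_words])
    show "z \<in> span_of K T {wd xs |xs. xs \<in> lists (carrier V) \<and> length xs = a}"
      using assms(1) by (simp add: tp_def)
  qed (use assms 1 in auto)
qed

definition basis_word where "basis_word I = wd (map e I)"

definition idx where "idx r = {I. set I \<subseteq> {1..n} \<and> length I = r}"

lemma idx_finite [simp]: "finite (idx r)"
  unfolding idx_def by (rule finite_lists_length_eq) simp

lemma map_e_lists: "set I \<subseteq> {1..n} \<Longrightarrow> map e I \<in> lists (carrier V)"
  using e_closed by (auto simp: in_lists_conv_set)

lemma basis_word_tp: "I \<in> idx r \<Longrightarrow> basis_word I \<in> tp r"
  unfolding basis_word_def idx_def by (rule word_tp) (auto intro: map_e_lists)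

lemma basis_word_closed: "set I \<subseteq> {1..n} \<Longrightarrow> basis_word I \<in> carrier T"
  by (simp add: basis_word_def map_e_lists)

lemma coef_basis_word: "set J \<subseteq> {1..n} \<Longrightarrow> coef I (basis_word J) = (if I = J then \<one>\<^bsub>K\<^esub> else \<zero>\<^bsub>K\<^esub>)"
proof -
  have "set J \<subseteq> {1..n} \<Longrightarrow> cp I (map e J) = (if I = J then \<one>\<^bsub>K\<^esub> else \<zero>\<^bsub>K\<^esub>)"
  proof (induction J arbitrary: I)
    case Nil
    then show ?case by (cases I) auto
  next
    case (Cons j J)
    then show ?case by (cases I) (auto simp: coord_e cp_closed map_e_lists)
  qed
  then show "set J \<subseteq> {1..n} \<Longrightarrow> coef I (basis_word J) = (if I = J then \<one>\<^bsub>K\<^esub> else \<zero>\<^bsub>K\<^esub>)"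
    by (simp add: basis_word_def coef_word map_e_lists)
qed

lemma basis_word_append: "set I \<subseteq> {1..n} \<Longrightarrow> set J \<subseteq> {1..n} \<Longrightarrow> basis_word I \<otimes>\<^bsub>T\<^esub> basis_word J = basis_word (I @ J)"
  by (simp add: basis_word_def word_mult map_e_lists)

lemma basis_word_image_closed: "basis_word ` idx r \<subseteq> carrier T"
  using basis_word_closed by (auto simp: idx_def)

text \<open>Induction on the word: its first letter is a combination of basis vectors.\<close>

lemma tp_span_basis_word: "tp r \<subseteq> span_of K T (basis_word ` idx r)"
proof -
  have sub: "submodule (span_of K T (basis_word ` idx r)) K T" for r
    by (rule span_submodule[OF Tm basis_word_image_closed])
  have "wd xs \<in> span_of K T (basis_word ` idx (length xs))" if "xs \<in> lists (carrier V)" for xs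
    using that
  proof (induction xs)
    case Nil
    show ?case by (rule subsetD[OF span_incl]) (auto simp: idx_def basis_word_def intro!: image_eqI[of _ _ "[]"])
  next
    case (Cons x xs)
    then have xs: "xs \<in> lists (carrier V)" and x: "x \<in> carrier V" by auto
    have 1: "wd [e i] \<otimes>\<^bsub>T\<^esub> wd xs \<in> span_of K T (basis_word ` idx (Suc (length xs)))" if i: "i \<in> {1..n}" for i
    proof (rule lin_image_span[OF Tm Tm Tl basis_word_image_closed Cons.IH sub])
      show "wd [e i] \<in> carrier T" using e_closed i by simp
      have "wd [e i] \<otimes>\<^bsub>T\<^esub> basis_word J = basis_word (i # J)" if "J \<in> idx (length xs)" for J
        using basis_word_append[of "[i]" J] that i by (auto simp: basis_word_def idx_def)
      then show "(\<otimes>\<^bsub>T\<^esub>) (wd [e i]) ` basis_word ` idx (length xs) \<subseteq> span_of K T (basis_word ` idx (Suc (length xs)))"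
        using i by (auto intro!: subsetD[OF span_incl] simp: idx_def)
    qed
    have "wd [x] \<otimes>\<^bsub>T\<^esub> wd xs \<in> span_of K T (basis_word ` idx (Suc (length xs)))"
    proof (rule lin_image_span[OF V Tm lin_comp[OF word1_linear Tr] _ _ sub])
      show "x \<in> span_of K V (e ` {1..n})" using basis_span x by auto
    qed (use 1 xs e_closed in auto)
    then show ?case using x xs by (simp add: word_mult)
  qed
  then show ?thesis
    unfolding tp_def by (intro span_least[OF sub]) auto
qed

lemma finsum_delta:
  assumes "module K X" "finite A" "j \<in> A" "g \<in> A \<rightarrow> carrier X"
  shows "(\<Oplus>\<^bsub>X\<^esub> i \<in> A. (if i = j then \<one>\<^bsub>K\<^esub> else \<zero>\<^bsub>K\<^esub>) \<odot>\<^bsub>X\<^esub> g i) = g j"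
proof -
  interpret X: module K X by fact
  have "(\<Oplus>\<^bsub>X\<^esub> i \<in> A. (if i = j then \<one>\<^bsub>K\<^esub> else \<zero>\<^bsub>K\<^esub>) \<odot>\<^bsub>X\<^esub> g i) = (\<Oplus>\<^bsub>X\<^esub> i \<in> A. if j = i then g i else \<zero>\<^bsub>X\<^esub>)"
    by (rule X.M.add.finprod_cong') (use assms in \<open>auto simp: Pi_def\<close>)
  also have "\<dots> = g j" by (rule X.M.add.finprod_singleton) (use assms in auto)
  finally show ?thesis .
qed

lemma finsum_linear:
  assumes "module K Y" "\<And>i. i \<in> A \<Longrightarrow> g i \<in> carrier Y" "\<And>i. i \<in> A \<Longrightarrow> c i \<in> linear_maps K X (self_module K)"
    "module K X"
  shows "(\<lambda>z. \<Oplus>\<^bsub>Y\<^esub> i \<in> A. c i z \<odot>\<^bsub>Y\<^esub> g i) \<in> linear_maps K X Y"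
proof (rule lin_pointwise_finsum[OF assms(1) _ assms(4)])
  interpret Y: module K Y by fact
  fix i assume i: "i \<in> A"
  show "(\<lambda>z. c i z \<odot>\<^bsub>Y\<^esub> g i) \<in> linear_maps K X Y"
    by (rule linear_mapsI)
      (use lin_closed[OF assms(3)[OF i]] assms(2)[OF i] lin_add[OF assms(3)[OF i]] lin_smult[OF assms(3)[OF i]] in
        \<open>auto simp: Y.smult_l_distr Y.smult_assoc1\<close>)
qed

text \<open>Both sides are linear, so this is checked on basis words.\<close>

lemma tp_expand:
  assumes "z \<in> tp r" shows "z = (\<Oplus>\<^bsub>T\<^esub> I \<in> idx r. coef I z \<odot>\<^bsub>T\<^esub> basis_word I)"
proof (rule lin_eq_on_span[OF Tm Tm _ finsum_linear[OF Tm _ coef_linear Tm] basis_word_image_closed])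
  show "(\<lambda>z. z) \<in> linear_maps K T T" by (rule linear_mapsI) auto
  show "z \<in> span_of K T (basis_word ` idx r)" using tp_span_basis_word assms by auto
  fix x assume "x \<in> basis_word ` idx r"
  then obtain J where J: "J \<in> idx r" "x = basis_word J" by auto
  show "x = (\<Oplus>\<^bsub>T\<^esub> I \<in> idx r. coef I x \<odot>\<^bsub>T\<^esub> basis_word I)"
    using finsum_delta[OF Tm idx_finite J(1), of basis_word] J basis_word_closed by (auto simp: coef_basis_word idx_def)
qed (use basis_word_closed in \<open>auto simp: idx_def\<close>)

lemma tp_eqI:
  assumes "z \<in> tp r" "z' \<in> tp r" "\<And>I. I \<in> idx r \<Longrightarrow> coef I z = coef I z'"
  shows "z = z'"
proof -
  have "(\<Oplus>\<^bsub>T\<^esub> I \<in> idx r. coef I z \<odot>\<^bsub>T\<^esub> basis_word I) = (\<Oplus>\<^bsub>T\<^esub> I \<in> idx r. coef I z' \<odot>\<^bsub>T\<^esub> basis_word I)"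
    by (rule T.M.add.finprod_cong')
      (use assms subsetD[OF tp_subset assms(2)] basis_word_closed in \<open>auto simp: idx_def\<close>)
  then show ?thesis using tp_expand[OF assms(1)] tp_expand[OF assms(2)] by simp
qed

lemma coef_outside:
  assumes "z \<in> tp r" "I \<notin> idx r" shows "coef I z = \<zero>\<^bsub>K\<^esub>"
proof -
  have "coef I z = \<zero>\<^bsub>self_module K\<^esub>"
    by (rule lin_zero_on_span[OF Tm Sm coef_linear basis_word_image_closed _ subsetD[OF tp_span_basis_word assms(1)]])
      (use assms(2) coef_basis_word in \<open>force simp: idx_def\<close>)
  then show ?thesis by simp
qed

lemma coef_combination:
  assumes "\<And>I. I \<in> idx r \<Longrightarrow> c I \<in> carrier K" "J \<in> idx r"
  shows "coef J (\<Oplus>\<^bsub>T\<^esub> I \<in> idx r. c I \<odot>\<^bsub>T\<^esub> basis_word I) = c J"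
proof -
  have "coef J (\<Oplus>\<^bsub>T\<^esub> I \<in> idx r. c I \<odot>\<^bsub>T\<^esub> basis_word I) = (\<Oplus>\<^bsub>K\<^esub> I \<in> idx r. coef J (c I \<odot>\<^bsub>T\<^esub> basis_word I))"
    by (rule coef_finsum) (use assms basis_word_closed in \<open>auto simp: idx_def\<close>)
  also have "\<dots> = (\<Oplus>\<^bsub>K\<^esub> I \<in> idx r. (if I = J then \<one>\<^bsub>K\<^esub> else \<zero>\<^bsub>K\<^esub>) \<otimes>\<^bsub>K\<^esub> c I)"
    by (rule V.R.add.finprod_cong') (use assms basis_word_closed in \<open>auto simp: idx_def coef_smult coef_basis_word\<close>)
  also have "\<dots> = c J"
    using finsum_delta[OF Sm idx_finite assms(2), of c] assms(1) by simp
  finally show ?thesis .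
qed

lemma combination_tp:
  assumes "\<And>I. I \<in> idx r \<Longrightarrow> c I \<in> carrier K"
  shows "(\<Oplus>\<^bsub>T\<^esub> I \<in> idx r. c I \<odot>\<^bsub>T\<^esub> basis_word I) \<in> tp r"
  by (rule submodule_finsum[OF Tm tp_submodule])
    (use assms in \<open>auto intro!: submodule_smult[OF tp_submodule] basis_word_tp\<close>)

end


section \<open>Sorting by adjacent transpositions\<close>

text \<open>The inner loop of insertion sort: \<open>y\<close> moves to the right past the smaller letters.  The set \<open>A\<close> has
  to shrink on the way, since the letters behind a letter \<open>z\<close> that has been passed are all greater than \<open>z\<close>.\<close>

lemma adjacent_sort_insert:
  fixes y :: "'a :: linorder"
  assumes "\<And>xs i ys. Q (xs @ i # i # ys)" "\<And>xs i j ys. Q (xs @ j # i # ys) \<Longrightarrow> Q (xs @ i # j # ys)"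
    "\<And>m. sorted_wrt (<) m \<Longrightarrow> set m \<subseteq> A \<Longrightarrow> Q m" "y \<in> A" "set l \<subseteq> A" "sorted_wrt (<) l"
  shows "Q (y # l)"
  using assms
proof (induction l arbitrary: y Q A)
  case Nil
  show ?case by (rule Nil(3)) (use Nil in auto)
next
  case (Cons z l)
  consider "y < z" | "y = z" | "z < y" by force
  then show ?case
  proof cases
    case 1
    show ?thesis by (rule Cons.prems(3)) (use Cons.prems 1 in auto)
  next
    case 2
    then show ?thesis using Cons.prems(1)[of "[]" z l] by simp
  next
    case 3
    have "Q (z # y # l)"
    proof (rule Cons.IH[where Q = "\<lambda>m. Q (z # m)" and A = "A \<inter> {z<..}"])
      show "Q (z # xs @ i # i # ys)" for xs i ys using Cons.prems(1)[of "z # xs" i ys] by simp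
      show "Q (z # xs @ i # j # ys)" if "Q (z # xs @ j # i # ys)" for xs i j ys
        using Cons.prems(2)[of "z # xs" j i ys] that by simp
      show "Q (z # m)" if "sorted_wrt (<) m" "set m \<subseteq> A \<inter> {z<..}" for m
        by (rule Cons.prems(3)) (use that Cons.prems in auto)
    qed (use Cons.prems 3 in auto)
    then show ?thesis using Cons.prems(2)[of "[]" z y l] by simp
  qed
qed

text \<open>A property of words that survives adjacent swaps and holds for words with equal neighbours and for
  strictly increasing words holds for all words.  Here it plays the part of the generation of the symmetric
  group by adjacent transpositions.\<close>

lemma adjacent_sort:
  fixes xs :: "'a :: linorder list"
  assumes "\<And>xs i ys. Q (xs @ i # i # ys)" "\<And>xs i j ys. Q (xs @ j # i # ys) \<Longrightarrow> Q (xs @ i # j # ys)"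
    "\<And>m. sorted_wrt (<) m \<Longrightarrow> set m \<subseteq> A \<Longrightarrow> Q m" "set xs \<subseteq> A"
  shows "Q xs"
  using assms
proof (induction xs arbitrary: Q)
  case Nil
  then show ?case by simp
next
  case (Cons y xs)
  show ?case
  proof (rule Cons.IH[where Q = "\<lambda>m. Q (y # m)"])
    show "Q (y # xs @ i # i # ys)" for xs i ys using Cons.prems(1)[of "y # xs" i ys] by simp
    show "Q (y # xs @ i # j # ys)" if "Q (y # xs @ j # i # ys)" for xs i j ys
      using Cons.prems(2)[of "y # xs" j i ys] that by simp
    show "Q (y # m)" if "sorted_wrt (<) m" "set m \<subseteq> A" for m
      by (rule adjacent_sort_insert[of Q A]) (use that Cons.prems in auto)
  qed (use Cons.prems in auto)
qed

section \<open>Permuting the letters of a word\<close>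

definition plist :: "nat \<Rightarrow> (nat \<Rightarrow> nat) \<Rightarrow> 'a list \<Rightarrow> 'a list" where
  "plist r \<sigma> xs = map (\<lambda>k. xs ! (\<sigma> k - 1)) [1..<Suc r]"

abbreviation perms :: "nat \<Rightarrow> (nat \<Rightarrow> nat) set" where
  "perms r \<equiv> {\<sigma>. \<sigma> permutes {1..r}}"

abbreviation invp :: "('a \<Rightarrow> 'a) \<Rightarrow> 'a \<Rightarrow> 'a" where
  "invp \<sigma> \<equiv> inv_into UNIV \<sigma>"

lemma length_plist [simp]: "length (plist r \<sigma> xs) = r"
  by (simp add: plist_def)

lemma permutes_range: "\<sigma> permutes {1..r} \<Longrightarrow> 1 \<le> k \<Longrightarrow> k \<le> r \<Longrightarrow> 1 \<le> \<sigma> k \<and> \<sigma> k \<le> r"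
  using permutes_in_image[of \<sigma> "{1..r}" k] by auto

lemma upt_nth1: "1 \<le> k \<Longrightarrow> k \<le> r \<Longrightarrow> [1..<Suc r] ! (k - 1) = k"
  by (subst nth_upt) auto

lemma plist_nth: "1 \<le> k \<Longrightarrow> k \<le> r \<Longrightarrow> plist r \<sigma> xs ! (k - 1) = xs ! (\<sigma> k - 1)"
  unfolding plist_def by (subst nth_map; simp only: upt_nth1 length_upt)

lemma list_eqI1: "length xs = r \<Longrightarrow> length ys = r \<Longrightarrow> (\<And>k. 1 \<le> k \<Longrightarrow> k \<le> r \<Longrightarrow> xs ! (k - 1) = ys ! (k - 1)) \<Longrightarrow> xs = ys"
proof (rule nth_equalityI)
  fix i assume "length xs = r" "i < length xs" "\<And>k. 1 \<le> k \<Longrightarrow> k \<le> r \<Longrightarrow> xs ! (k - 1) = ys ! (k - 1)"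
  then show "xs ! i = ys ! i" by (metis Suc_leI diff_Suc_1 le_add1 plus_1_eq_Suc)
qed simp

lemma plist_plist:
  "\<tau> permutes {1..r} \<Longrightarrow> plist r \<tau> (plist r \<sigma> xs) = plist r (\<sigma> \<circ> \<tau>) xs"
  by (rule list_eqI1[of _ r]) (simp_all add: plist_nth permutes_range)

lemma plist_id: "length xs = r \<Longrightarrow> plist r id xs = xs"
  by (rule list_eqI1[of _ r]) (simp_all add: plist_nth)

lemma set_plist:
  assumes "\<sigma> permutes {1..r}" "length xs = r" shows "set (plist r \<sigma> xs) = set xs"
proof -
  have 1: "set (plist r \<sigma> xs) \<subseteq> set xs" if "\<sigma> permutes {1..r}" "length xs = r" for \<sigma> and xs :: "'a list"
  proof
    fix x assume "x \<in> set (plist r \<sigma> xs)"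
    then obtain k where "1 \<le> k" "k \<le> r" "x = xs ! (\<sigma> k - 1)" by (auto simp: plist_def)
    moreover from this have "\<sigma> k - 1 < length xs" using permutes_range[OF that(1), of k] that(2) by auto
    ultimately show "x \<in> set xs" by simp
  qed
  have "plist r (invp \<sigma>) (plist r \<sigma> xs) = xs"
    using assms by (simp add: plist_plist permutes_inv permutes_inv_o plist_id)
  then have "set xs \<subseteq> set (plist r \<sigma> xs)"
    using 1[OF permutes_inv[OF assms(1)], of "plist r \<sigma> xs"] by simp
  then show ?thesis using 1[OF assms] by auto
qed

lemma plist_seg:
  assumes "\<sigma> permutes {1..r}" shows "plist r \<sigma> (seg 1 r x) = seg 1 r (x \<circ> \<sigma>)"
proof -
  have "seg 1 r x ! (\<sigma> k - 1) = x (\<sigma> k)" if "1 \<le> k" "k \<le> r" for k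
  proof -
    have "1 \<le> \<sigma> k" "\<sigma> k \<le> r" using permutes_range[OF assms that] by auto
    then show ?thesis by (simp add: seg_def upt_nth1 del: upt_Suc)
  qed
  then show ?thesis by (auto simp: plist_def seg_def[of _ _ "x \<circ> \<sigma>"] simp del: upt_Suc)
qed

lemma seg_nth: "length xs = r \<Longrightarrow> seg 1 r (\<lambda>k. xs ! (k - 1)) = xs"
  using plist_id[of xs r] by (simp add: plist_def seg_def)

lemma length_seg [simp]: "length (seg i j x) = Suc j - i"
  by (simp add: seg_def del: upt_Suc)

lemma plist_transpose:
  assumes "length xs + 2 + length ys = r"
  shows "plist r (transpose (length xs + 1) (length xs + 2)) (xs @ i # j # ys) = xs @ j # i # ys"
proof (rule list_eqI1[of _ r])
  fix k assume k: "1 \<le> k" "k \<le> r"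
  consider "k = length xs + 1" | "k = length xs + 2" | "k \<noteq> length xs + 1" "k \<noteq> length xs + 2" by blast
  then show "plist r (transpose (length xs + 1) (length xs + 2)) (xs @ i # j # ys) ! (k - 1) = (xs @ j # i # ys) ! (k - 1)"
  proof cases
    case 3
    then show ?thesis
      using k by (cases "k - 1 < length xs") (auto simp: plist_nth transpose_def nth_append nth_Cons' split: if_splits)
  next
    case 1
    then show ?thesis using k by (simp only: plist_nth) (simp add: nth_append)
  next
    case 2
    then show ?thesis using k by (simp only: plist_nth) (simp add: nth_append)
  qed
qed (use assms in auto)

lemma transpose_permutes:
  "length xs + 2 + length ys = r \<Longrightarrow> transpose (length xs + 1) (length xs + 2) permutes {1..r}"
  by (rule permutes_swap_id) auto

context based
begin

definition eps where "eps \<sigma> = [sign \<sigma>] \<cdot>\<^bsub>K\<^esub> \<one>\<^bsub>K\<^esub>"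

lemma eps_cases: "eps \<sigma> = (if sign \<sigma> = 1 then \<one>\<^bsub>K\<^esub> else \<ominus>\<^bsub>K\<^esub> \<one>\<^bsub>K\<^esub>)"
  by (rule sign_cases[of \<sigma>]) (simp_all add: eps_def add_pow_int_ge add_pow_int_lt)

lemma eps_closed [simp]: "eps \<sigma> \<in> carrier K"
  by (simp add: eps_cases)

lemma eps_id [simp]: "eps id = \<one>\<^bsub>K\<^esub>"
  by (simp add: eps_cases)

lemma eps_neg: "sign \<tau> = - sign \<sigma> \<Longrightarrow> eps \<tau> = \<ominus>\<^bsub>K\<^esub> eps \<sigma>"
  by (rule sign_cases[of \<sigma>]) (simp_all add: eps_cases)

lemma sign_smult_eps: "module K X \<Longrightarrow> x \<in> carrier X \<Longrightarrow> [sign \<sigma>] \<cdot>\<^bsub>X\<^esub> x = eps \<sigma> \<odot>\<^bsub>X\<^esub> x"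
  unfolding eps_def by (rule sign_smult)

lemma perms_finite [simp]: "finite (perms r)"
  by (rule finite_permutations) simp

lemma perms_permutation: "\<sigma> permutes {1..(r::nat)} \<Longrightarrow> permutation \<sigma>"
  by (rule permutes_imp_permutation[of "{1..r}"]) simp_all

text \<open>Cancellation in pairs, organised by an involution \<open>\<phi>\<close> that changes the sign.  The even and the odd
  permutations are matched, so that no division by two occurs and the ground field may have characteristic
  two.\<close>

lemma signed_sum_zero:
  assumes \<phi>: "\<And>\<sigma>. \<sigma> \<in> perms r \<Longrightarrow> \<phi> \<sigma> \<in> perms r" "\<And>\<sigma>. \<sigma> \<in> perms r \<Longrightarrow> \<phi> (\<phi> \<sigma>) = \<sigma>"
    "\<And>\<sigma>. \<sigma> \<in> perms r \<Longrightarrow> sign (\<phi> \<sigma>) = - sign \<sigma>"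
    and D: "\<And>\<sigma>. \<sigma> \<in> perms r \<Longrightarrow> D \<sigma> \<in> carrier K" "\<And>\<sigma>. \<sigma> \<in> perms r \<Longrightarrow> D (\<phi> \<sigma>) = D \<sigma>"
  shows "(\<Oplus>\<^bsub>K\<^esub> \<sigma> \<in> perms r. eps \<sigma> \<otimes>\<^bsub>K\<^esub> D \<sigma>) = \<zero>\<^bsub>K\<^esub>"
proof -
  let ?E = "{\<sigma> \<in> perms r. sign \<sigma> = 1}" and ?O = "{\<sigma> \<in> perms r. sign \<sigma> = -1}"
  let ?f = "\<lambda>\<sigma>. eps \<sigma> \<otimes>\<^bsub>K\<^esub> D \<sigma>"
  have "sign \<sigma> = 1 \<or> sign \<sigma> = -1" for \<sigma> :: "nat \<Rightarrow> nat" by (rule sign_cases[of \<sigma>]) auto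
  then have u: "perms r = ?E \<union> ?O" by auto
  have fin: "finite ?E" "finite ?O" by auto
  have O: "?O = \<phi> ` ?E"
  proof
    show "?O \<subseteq> \<phi> ` ?E"
    proof
      fix \<sigma> assume s: "\<sigma> \<in> ?O"
      then have "\<phi> \<sigma> \<in> ?E" "\<sigma> = \<phi> (\<phi> \<sigma>)" using \<phi>[of \<sigma>] by auto
      then show "\<sigma> \<in> \<phi> ` ?E" by blast
    qed
  qed (use \<phi> in auto)
  have inj: "inj_on \<phi> ?E" by (rule inj_on_inverseI[of _ \<phi>]) (use \<phi> in auto)
  have "(\<Oplus>\<^bsub>K\<^esub> \<sigma> \<in> ?O. ?f \<sigma>) = (\<Oplus>\<^bsub>K\<^esub> \<sigma> \<in> ?E. ?f (\<phi> \<sigma>))"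
    unfolding O by (rule V.R.add.finprod_reindex[OF _ inj]) (use \<phi> D in auto)
  also have "\<dots> = (\<Oplus>\<^bsub>K\<^esub> \<sigma> \<in> ?E. \<ominus>\<^bsub>K\<^esub> ?f \<sigma>)"
  proof (rule V.R.add.finprod_cong')
    show "?f (\<phi> \<sigma>) = \<ominus>\<^bsub>K\<^esub> ?f \<sigma>" if "\<sigma> \<in> ?E" for \<sigma>
      using that \<phi>[of \<sigma>] D[of \<sigma>] by (simp add: eps_neg V.R.l_minus)
  qed (use D in auto)
  finally have "(\<Oplus>\<^bsub>K\<^esub> \<sigma> \<in> ?E. ?f \<sigma>) \<oplus>\<^bsub>K\<^esub> (\<Oplus>\<^bsub>K\<^esub> \<sigma> \<in> ?O. ?f \<sigma>)
      = (\<Oplus>\<^bsub>K\<^esub> \<sigma> \<in> ?E. ?f \<sigma> \<oplus>\<^bsub>K\<^esub> \<ominus>\<^bsub>K\<^esub> ?f \<sigma>)"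
    using D by (subst V.R.finsum_addf) auto
  also have "\<dots> = (\<Oplus>\<^bsub>K\<^esub> \<sigma> \<in> ?E. \<zero>\<^bsub>K\<^esub>)"
    by (rule V.R.add.finprod_cong') (use D in \<open>auto simp: V.R.r_neg\<close>)
  finally have "(\<Oplus>\<^bsub>K\<^esub> \<sigma> \<in> ?E. ?f \<sigma>) \<oplus>\<^bsub>K\<^esub> (\<Oplus>\<^bsub>K\<^esub> \<sigma> \<in> ?O. ?f \<sigma>) = \<zero>\<^bsub>K\<^esub>" by simp
  moreover have "(\<Oplus>\<^bsub>K\<^esub> \<sigma> \<in> ?E \<union> ?O. ?f \<sigma>) = (\<Oplus>\<^bsub>K\<^esub> \<sigma> \<in> ?E. ?f \<sigma>) \<oplus>\<^bsub>K\<^esub> (\<Oplus>\<^bsub>K\<^esub> \<sigma> \<in> ?O. ?f \<sigma>)"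
    by (rule V.R.add.finprod_Un_disjoint[OF fin]) (use D in auto)
  ultimately have "(\<Oplus>\<^bsub>K\<^esub> \<sigma> \<in> ?E \<union> ?O. ?f \<sigma>) = \<zero>\<^bsub>K\<^esub>" by (rule trans[rotated])
  then show ?thesis by (subst u)
qed

lemma plist_idx: "\<sigma> permutes {1..r} \<Longrightarrow> I \<in> idx r \<Longrightarrow> plist r \<sigma> I \<in> idx r"
  by (auto simp: idx_def set_plist)

lemma cp_finprod:
  assumes "length I = r" "length xs = r" "xs \<in> lists (carrier V)"
  shows "cp I xs = (\<Otimes>\<^bsub>K\<^esub> k \<in> {1..r}. coord (I ! (k - 1)) (xs ! (k - 1)))"
  using assms
proof (induction r arbitrary: I xs)
  case 0
  then show ?case by simp
next
  case (Suc r)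
  define I' where "I' = take r I"
  define i where "i = I ! r"
  define xs' where "xs' = take r xs"
  define x where "x = xs ! r"
  have I: "I = I' @ [i]" "length I' = r"
    using Suc.prems by (auto simp: I'_def i_def take_Suc_conv_app_nth[symmetric])
  have xs: "xs = xs' @ [x]" "length xs' = r"
    using Suc.prems by (auto simp: xs'_def x_def take_Suc_conv_app_nth[symmetric])
  have l: "xs' \<in> lists (carrier V)" "x \<in> carrier V" using Suc.prems(3) by (auto simp: xs)
  have xk: "xs' ! (k - 1) \<in> carrier V" if "1 \<le> k" "k \<le> r" for k
    using l(1) that xs(2) by (auto simp: in_lists_conv_set)
  have "(\<Otimes>\<^bsub>K\<^esub> k \<in> {1..Suc r}. coord (I ! (k - 1)) (xs ! (k - 1))) =
      coord i x \<otimes>\<^bsub>K\<^esub> (\<Otimes>\<^bsub>K\<^esub> k \<in> {1..r}. coord (I ! (k - 1)) (xs ! (k - 1)))"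
  proof -
    have "{1..Suc r} = insert (Suc r) {1..r}" by auto
    moreover have "coord (I ! (k - 1)) (xs ! (k - 1)) \<in> carrier K" if "k \<in> {1..r}" for k
      using xk[of k] that I xs by (auto simp: nth_append coord_closed)
    ultimately show ?thesis
      by (simp only:, subst V.R.finprod_insert) (use l in \<open>auto simp: coord_closed I xs nth_append\<close>)
  qed
  also have "(\<Otimes>\<^bsub>K\<^esub> k \<in> {1..r}. coord (I ! (k - 1)) (xs ! (k - 1))) = (\<Otimes>\<^bsub>K\<^esub> k \<in> {1..r}. coord (I' ! (k - 1)) (xs' ! (k - 1)))"
    by (rule V.R.finprod_cong') (use xk in \<open>auto simp: I xs nth_append coord_closed\<close>)
  also have "\<dots> = cp I' xs'" using Suc.IH[OF I(2) xs(2) l(1)] by simp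
  finally show ?case
    using I xs l by (simp add: cp_append cp_closed coord_closed V.R.m_comm)
qed

lemma cp_plist:
  assumes "\<sigma> permutes {1..r}" "length J = r" "length xs = r" "xs \<in> lists (carrier V)"
  shows "cp (plist r \<sigma> J) xs = cp J (plist r (invp \<sigma>) xs)"
proof -
  have inv: "invp \<sigma> permutes {1..r}" by (rule permutes_inv[OF assms(1)])
  have pl: "plist r (invp \<sigma>) xs \<in> lists (carrier V)"
    using assms(4) set_plist[OF inv assms(3)] by (simp add: in_lists_conv_set)
  have xk: "xs ! (k - 1) \<in> carrier V" if "1 \<le> k" "k \<le> r" for k
    using that assms(3,4) by (auto simp: in_lists_conv_set)
  let ?f = "\<lambda>m. coord (J ! (m - 1)) (xs ! (invp \<sigma> m - 1))"
  have "cp J (plist r (invp \<sigma>) xs) = (\<Otimes>\<^bsub>K\<^esub> k \<in> {1..r}. coord (J ! (k - 1)) (plist r (invp \<sigma>) xs ! (k - 1)))"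
    by (rule cp_finprod) (use assms pl in auto)
  also have "\<dots> = (\<Otimes>\<^bsub>K\<^esub> m \<in> {1..r}. ?f m)"
    by (rule V.R.finprod_cong') (use permutes_range[OF inv] xk in \<open>auto simp: plist_nth coord_closed\<close>)
  also have "\<dots> = (\<Otimes>\<^bsub>K\<^esub> m \<in> \<sigma> ` {1..r}. ?f m)" by (simp add: permutes_image[OF assms(1)])
  also have "\<dots> = (\<Otimes>\<^bsub>K\<^esub> k \<in> {1..r}. ?f (\<sigma> k))"
    by (rule V.R.finprod_reindex)
      (use permutes_range[OF inv] xk assms(1) in \<open>auto simp: coord_closed permutes_inj_on permutes_inverses\<close>)
  also have "\<dots> = (\<Otimes>\<^bsub>K\<^esub> k \<in> {1..r}. coord (plist r \<sigma> J ! (k - 1)) (xs ! (k - 1)))"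
    by (rule V.R.finprod_cong') (use xk assms(1) in \<open>auto simp: plist_nth coord_closed permutes_inverses\<close>)
  also have "\<dots> = cp (plist r \<sigma> J) xs"
    by (rule cp_finprod[symmetric]) (use assms in auto)
  finally show ?thesis ..
qed

text \<open>The action of a permutation, prescribed on coefficients.  It is defined on tensors of all degrees,
  projecting to degree \<open>r\<close>, which keeps it linear on the whole tensor algebra.\<close>

definition permute where "permute r \<sigma> z = (\<Oplus>\<^bsub>T\<^esub> J \<in> idx r. coef (plist r \<sigma> J) z \<odot>\<^bsub>T\<^esub> basis_word J)"

lemma permute_linear: "permute r \<sigma> \<in> linear_maps K T T"
  unfolding permute_def[abs_def]
  by (rule finsum_linear[OF Tm _ coef_linear Tm]) (auto simp: idx_def intro: basis_word_closed)

lemma permute_tp: "z \<in> carrier T \<Longrightarrow> permute r \<sigma> z \<in> tp r"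
  unfolding permute_def by (rule combination_tp) simp

lemma coef_permute: "z \<in> carrier T \<Longrightarrow> J \<in> idx r \<Longrightarrow> coef J (permute r \<sigma> z) = coef (plist r \<sigma> J) z"
  unfolding permute_def by (rule coef_combination) simp

lemma permute_word:
  assumes "\<sigma> permutes {1..r}" "xs \<in> lists (carrier V)" "length xs = r"
  shows "permute r \<sigma> (wd xs) = wd (plist r (invp \<sigma>) xs)"
proof -
  have inv: "invp \<sigma> permutes {1..r}" by (rule permutes_inv[OF assms(1)])
  have pl: "plist r (invp \<sigma>) xs \<in> lists (carrier V)"
    using assms(2) set_plist[OF inv assms(3)] by (simp add: in_lists_conv_set)
  show ?thesis
    by (rule tp_eqI[of _ r])
      (use assms pl in \<open>auto simp: permute_tp word_tp coef_permute coef_word cp_plist idx_def\<close>)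
qed

lemma tpow_words_eq:
  "(\<lambda>x. wd (seg 1 r x)) ` ({1..r} \<rightarrow> carrier V) = {wd xs | xs. xs \<in> lists (carrier V) \<and> length xs = r}"
proof -
  have "wd xs \<in> (\<lambda>x. wd (seg 1 r x)) ` ({1..r} \<rightarrow> carrier V)"
    if "xs \<in> lists (carrier V)" "length xs = r" for xs
    using that by (intro image_eqI[of _ _ "\<lambda>k. xs ! (k - 1)"]) (auto simp: seg_nth in_lists_conv_set)
  moreover have "\<exists>xs. wd (seg 1 r x) = wd xs \<and> xs \<in> lists (carrier V) \<and> length xs = r"
    if "x \<in> {1..r} \<rightarrow> carrier V" for x
    using that by (intro exI[of _ "seg 1 r x"]) (auto simp: seg_def in_lists_conv_set Pi_def simp del: upt_Suc)
  ultimately show ?thesis by auto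
qed

lemma perm_act_eq:
  assumes "\<sigma> permutes {1..r}"
  shows "perm_act K V r \<sigma> = restrict (permute r \<sigma>) (tp r)"
  unfolding perm_act_def
proof (rule the_linear_eq[OF tpow_module tpow_module])
  show "permute r \<sigma> \<in> linear_maps K (tpow K V r) (tpow K V r)"
    unfolding tpow_def
    by (rule lin_into[OF lin_sub[OF permute_linear]])
      (use permute_tp subsetD[OF tp_subset] in \<open>auto simp: tp_def[symmetric]\<close>)
  fix x assume x: "x \<in> {1..r} \<rightarrow> carrier V"
  then have "seg 1 r x \<in> lists (carrier V)" by (auto simp: seg_def in_lists_conv_set)
  then show "permute r \<sigma> (wd (seg 1 r x)) = wd (seg 1 r (x \<circ> invp \<sigma>))"
    using assms by (simp add: permute_word plist_seg permutes_inv)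
qed (auto simp: tpow_words_eq tpow_span word_tp)

section \<open>Antisymmetrizers and alternating tensors\<close>

definition antisym where "antisym r z = (\<Oplus>\<^bsub>T\<^esub> \<sigma> \<in> perms r. eps \<sigma> \<odot>\<^bsub>T\<^esub> permute r \<sigma> z)"

lemma permute_closed [simp]: "z \<in> carrier T \<Longrightarrow> permute r \<sigma> z \<in> carrier T"
  by (rule lin_closed[OF permute_linear])

lemma antisym_linear: "antisym r \<in> linear_maps K T T"
  unfolding antisym_def[abs_def]
  by (rule lin_pointwise_finsum[OF Tm lin_pointwise_smult[OF Tm permute_linear] Tm]) simp

lemma antisym_tp: "z \<in> carrier T \<Longrightarrow> antisym r z \<in> tp r"
  unfolding antisym_def
  by (rule submodule_finsum[OF Tm tp_submodule]) (auto intro!: submodule_smult[OF tp_submodule] permute_tp)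

lemma antisym_closed [simp]: "z \<in> carrier T \<Longrightarrow> antisym r z \<in> carrier T"
  by (rule lin_closed[OF antisym_linear])

lemma coef_antisym:
  assumes "z \<in> carrier T" "J \<in> idx r"
  shows "coef J (antisym r z) = (\<Oplus>\<^bsub>K\<^esub> \<sigma> \<in> perms r. eps \<sigma> \<otimes>\<^bsub>K\<^esub> coef (plist r \<sigma> J) z)"
proof -
  have "coef J (antisym r z) = (\<Oplus>\<^bsub>K\<^esub> \<sigma> \<in> perms r. coef J (eps \<sigma> \<odot>\<^bsub>T\<^esub> permute r \<sigma> z))"
    unfolding antisym_def by (rule coef_finsum) (use assms in auto)
  also have "\<dots> = (\<Oplus>\<^bsub>K\<^esub> \<sigma> \<in> perms r. eps \<sigma> \<otimes>\<^bsub>K\<^esub> coef (plist r \<sigma> J) z)"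
    by (rule V.R.add.finprod_cong') (use assms in \<open>auto simp: coef_smult coef_permute\<close>)
  finally show ?thesis .
qed

lemma finsum_sub:
  assumes "module K X" "submodule H K X" "g \<in> A \<rightarrow> H"
  shows "(\<Oplus>\<^bsub>X\<lparr>carrier := H\<rparr>\<^esub> i \<in> A. g i) = (\<Oplus>\<^bsub>X\<^esub> i \<in> A. g i)"
proof (rule lin_finsum[OF submodule.submodule_is_module[OF assms(2,1)] assms(1)])
  show "(\<lambda>x. x) \<in> linear_maps K (X\<lparr>carrier := H\<rparr>) X"
    by (rule linear_mapsI) (use submodule_subset[OF assms(2)] in auto)
qed (use assms(3) in auto)

lemma Ant_eq:
  assumes "z \<in> tp r" shows "Ant K V r z = antisym r z"
proof -
  interpret M: module K "tpow K V r" by (rule tpow_module)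
  have z: "z \<in> carrier T" using assms tp_subset by auto
  have sm: "c \<odot>\<^bsub>tpow K V r\<^esub> x = c \<odot>\<^bsub>T\<^esub> x" for c x by (simp add: tpow_def)
  have "Ant K V r z = (\<Oplus>\<^bsub>tpow K V r\<^esub> \<sigma> \<in> perms r. eps \<sigma> \<odot>\<^bsub>T\<^esub> permute r \<sigma> z)"
    unfolding Ant_def
    by (rule M.M.add.finprod_cong')
      (use assms z in \<open>auto simp: perm_act_eq sign_smult_eps[OF tpow_module] permute_tp sm
        intro!: submodule_smult[OF tp_submodule]\<close>)
  also have "\<dots> = antisym r z"
    unfolding antisym_def
    by (subst tpow_eq, rule finsum_sub[OF Tm tp_submodule])
      (use z in \<open>auto intro!: submodule_smult[OF tp_submodule] permute_tp\<close>)
  finally show ?thesis .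
qed

text \<open>Tensors whose coefficients alternate in the letters at the positions \<open>lo < k \<le> hi\<close>.  Windows are
  needed twice: for the spaces \<open>V\<^sup>i \<otimes> R \<otimes> V\<^sup>j\<close>, and for products of two alternating tensors.\<close>

definition walt where
  "walt r lo hi = {z \<in> tp r. \<forall>xs i j ys. lo \<le> length xs \<longrightarrow> length xs + 2 \<le> hi \<longrightarrow>
      coef (xs @ i # i # ys) z = \<zero>\<^bsub>K\<^esub> \<and> coef (xs @ i # j # ys) z = \<ominus>\<^bsub>K\<^esub> coef (xs @ j # i # ys) z}"

lemma waltI:
  assumes "z \<in> tp r"
    and "\<And>xs i ys. lo \<le> length xs \<Longrightarrow> length xs + 2 \<le> hi \<Longrightarrow> coef (xs @ i # i # ys) z = \<zero>\<^bsub>K\<^esub>"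
    and "\<And>xs i j ys. lo \<le> length xs \<Longrightarrow> length xs + 2 \<le> hi \<Longrightarrow>
      coef (xs @ i # j # ys) z = \<ominus>\<^bsub>K\<^esub> coef (xs @ j # i # ys) z"
  shows "z \<in> walt r lo hi"
  using assms unfolding walt_def by blast

lemma walt_eq: "z \<in> walt r lo hi \<Longrightarrow> lo \<le> length xs \<Longrightarrow> length xs + 2 \<le> hi \<Longrightarrow>
    coef (xs @ i # i # ys) z = \<zero>\<^bsub>K\<^esub>"
  and walt_swap: "z \<in> walt r lo hi \<Longrightarrow> lo \<le> length xs \<Longrightarrow> length xs + 2 \<le> hi \<Longrightarrow>
    coef (xs @ i # j # ys) z = \<ominus>\<^bsub>K\<^esub> coef (xs @ j # i # ys) z"
  unfolding walt_def by blast+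

lemma walt_submodule: "submodule (walt r lo hi) K T"
proof (rule submoduleI_smult[OF Tm])
  show "walt r lo hi \<subseteq> carrier T" using tp_subset by (auto simp: walt_def)
  have "coef I \<zero>\<^bsub>T\<^esub> = \<zero>\<^bsub>K\<^esub>" for I using lin_zero[OF Tm Sm coef_linear] by simp
  then show "\<zero>\<^bsub>T\<^esub> \<in> walt r lo hi" by (intro waltI submodule_zero[OF tp_submodule]) simp_all
  fix x assume x: "x \<in> walt r lo hi"
  then have xtp: "x \<in> tp r" by (simp add: walt_def)
  then have xT: "x \<in> carrier T" using tp_subset by auto
  { fix y assume y: "y \<in> walt r lo hi"
    then have ytp: "y \<in> tp r" by (simp add: walt_def)
    then have yT: "y \<in> carrier T" using tp_subset by auto
    show "x \<oplus>\<^bsub>T\<^esub> y \<in> walt r lo hi"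
    proof (rule waltI[OF submodule_add[OF tp_submodule xtp ytp]])
      fix xs ys :: "nat list" and i j assume l: "lo \<le> length xs" "length xs + 2 \<le> hi"
      show "coef (xs @ i # i # ys) (x \<oplus>\<^bsub>T\<^esub> y) = \<zero>\<^bsub>K\<^esub>"
        using walt_eq[OF x l] walt_eq[OF y l] xT yT by (simp add: coef_add)
      have "coef (xs @ i # j # ys) (x \<oplus>\<^bsub>T\<^esub> y) = \<ominus>\<^bsub>K\<^esub> coef (xs @ j # i # ys) x \<oplus>\<^bsub>K\<^esub> \<ominus>\<^bsub>K\<^esub> coef (xs @ j # i # ys) y"
        unfolding coef_add[OF xT yT] walt_swap[OF x l, of i j ys] walt_swap[OF y l, of i j ys] ..
      also have "\<dots> = \<ominus>\<^bsub>K\<^esub> coef (xs @ j # i # ys) (x \<oplus>\<^bsub>T\<^esub> y)"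
        using xT yT by (simp add: coef_add V.R.minus_add)
      finally show "coef (xs @ i # j # ys) (x \<oplus>\<^bsub>T\<^esub> y) = \<ominus>\<^bsub>K\<^esub> coef (xs @ j # i # ys) (x \<oplus>\<^bsub>T\<^esub> y)" .
    qed }
  { fix c assume c: "c \<in> carrier K"
    show "c \<odot>\<^bsub>T\<^esub> x \<in> walt r lo hi"
    proof (rule waltI[OF submodule_smult[OF tp_submodule c xtp]])
      fix xs ys :: "nat list" and i j assume l: "lo \<le> length xs" "length xs + 2 \<le> hi"
      show "coef (xs @ i # i # ys) (c \<odot>\<^bsub>T\<^esub> x) = \<zero>\<^bsub>K\<^esub>"
        using walt_eq[OF x l] xT c by (simp add: coef_smult)
      have "coef (xs @ i # j # ys) (c \<odot>\<^bsub>T\<^esub> x) = c \<otimes>\<^bsub>K\<^esub> (\<ominus>\<^bsub>K\<^esub> coef (xs @ j # i # ys) x)"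
        unfolding coef_smult[OF c xT] walt_swap[OF x l, of i j ys] ..
      also have "\<dots> = \<ominus>\<^bsub>K\<^esub> coef (xs @ j # i # ys) (c \<odot>\<^bsub>T\<^esub> x)"
        using xT c by (simp add: coef_smult V.R.r_minus)
      finally show "coef (xs @ i # j # ys) (c \<odot>\<^bsub>T\<^esub> x) = \<ominus>\<^bsub>K\<^esub> coef (xs @ j # i # ys) (c \<odot>\<^bsub>T\<^esub> x)" .
    qed }
qed

abbreviation alt where "alt r \<equiv> walt r 0 r"

lemma walt_tp: "walt r lo hi \<subseteq> tp r" by (auto simp: walt_def)

lemma walt_T: "walt r lo hi \<subseteq> carrier T" using walt_tp tp_subset by blast

text \<open>Reindexing the sum by a transposition swaps two letters and changes the sign; if the letters are equal,
  the terms cancel in pairs.\<close>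

lemma antisym_alt:
  assumes z: "z \<in> carrier T" shows "antisym r z \<in> alt r"
proof -
  have "coef (xs @ i # i # ys) (antisym r z) = \<zero>\<^bsub>K\<^esub> \<and> coef (xs @ i # j # ys) (antisym r z) = \<ominus>\<^bsub>K\<^esub> coef (xs @ j # i # ys) (antisym r z)"
    for xs i j ys
  proof
    let ?t = "transpose (length xs + 1) (length xs + 2)"
    let ?I = "xs @ i # i # ys" and ?J = "xs @ i # j # ys" and ?J' = "xs @ j # i # ys"
    have tt: "?t \<circ> ?t = id" by simp
    have cap_sign: "sign (?t \<circ> \<sigma>) = - sign \<sigma>" if "\<sigma> \<in> perms r" "?t permutes {1..r}" for \<sigma>
      using that by (subst sign_compose) (auto intro!: perms_permutation simp: sign_swap_id)
    show "coef ?I (antisym r z) = \<zero>\<^bsub>K\<^esub>"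
    proof (cases "?I \<in> idx r")
      case False
      then show ?thesis by (rule coef_outside[OF antisym_tp[OF z]])
    next
      case True
      then have len: "length xs + 2 + length ys = r" by (auto simp: idx_def)
      note t = transpose_permutes[OF len]
      show ?thesis
        unfolding coef_antisym[OF z True]
      proof (rule signed_sum_zero[of r "\<lambda>\<sigma>. ?t \<circ> \<sigma>"])
        fix \<sigma> assume s: "\<sigma> \<in> perms r"
        show "?t \<circ> \<sigma> \<in> perms r" using s t by (auto intro: permutes_compose)
        show "?t \<circ> (?t \<circ> \<sigma>) = \<sigma>" by (simp add: comp_assoc[symmetric])
        show "sign (?t \<circ> \<sigma>) = - sign \<sigma>" by (rule cap_sign[OF s t])
        have "plist r (?t \<circ> \<sigma>) ?I = plist r \<sigma> (plist r ?t ?I)"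
          using s by (simp only: plist_plist mem_Collect_eq)
        then show "coef (plist r (?t \<circ> \<sigma>) ?I) z = coef (plist r \<sigma> ?I) z"
          by (simp only: plist_transpose[OF len])
      qed (use z in auto)
    qed
    show "coef ?J (antisym r z) = \<ominus>\<^bsub>K\<^esub> coef ?J' (antisym r z)"
    proof (cases "?J \<in> idx r")
      case False
      then have "?J' \<notin> idx r" by (auto simp: idx_def)
      then show ?thesis using False by (simp add: coef_outside[OF antisym_tp[OF z]])
    next
      case True
      then have J': "?J' \<in> idx r" by (auto simp: idx_def)
      from True have len: "length xs + 2 + length ys = r" by (auto simp: idx_def)
      note t = transpose_permutes[OF len]
      have img: "(\<lambda>\<sigma>. ?t \<circ> \<sigma>) ` perms r = perms r"
        using image_compose_permutations_left[OF t] by (auto simp: image_def)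
      have inj: "inj_on (\<lambda>\<sigma>. ?t \<circ> \<sigma>) (perms r)"
        by (rule inj_on_inverseI[of _ "\<lambda>\<sigma>. ?t \<circ> \<sigma>"]) (simp add: comp_assoc[symmetric])
      let ?f = "\<lambda>\<sigma>. eps \<sigma> \<otimes>\<^bsub>K\<^esub> coef (plist r \<sigma> ?J) z"
      have "coef ?J (antisym r z) = (\<Oplus>\<^bsub>K\<^esub> \<sigma> \<in> (\<lambda>\<sigma>. ?t \<circ> \<sigma>) ` perms r. ?f \<sigma>)"
        by (simp only: img coef_antisym[OF z True])
      also have "\<dots> = (\<Oplus>\<^bsub>K\<^esub> \<sigma> \<in> perms r. ?f (?t \<circ> \<sigma>))"
        by (rule V.R.add.finprod_reindex[OF _ inj]) (use z in auto)
      also have "\<dots> = (\<Oplus>\<^bsub>K\<^esub> \<sigma> \<in> perms r. (\<ominus>\<^bsub>K\<^esub> \<one>\<^bsub>K\<^esub>) \<otimes>\<^bsub>K\<^esub> (eps \<sigma> \<otimes>\<^bsub>K\<^esub> coef (plist r \<sigma> ?J') z))"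
      proof (rule V.R.add.finprod_cong')
        fix \<sigma> assume s: "\<sigma> \<in> perms r"
        have "plist r (?t \<circ> \<sigma>) ?J = plist r \<sigma> (plist r ?t ?J)"
          using s by (simp only: plist_plist mem_Collect_eq)
        then show "?f (?t \<circ> \<sigma>) = (\<ominus>\<^bsub>K\<^esub> \<one>\<^bsub>K\<^esub>) \<otimes>\<^bsub>K\<^esub> (eps \<sigma> \<otimes>\<^bsub>K\<^esub> coef (plist r \<sigma> ?J') z)"
          using z by (simp only: plist_transpose[OF len] eps_neg[OF cap_sign[OF s t]]) (simp add: V.R.l_minus)
      qed (use z in auto)
      also have "\<dots> = (\<ominus>\<^bsub>K\<^esub> \<one>\<^bsub>K\<^esub>) \<otimes>\<^bsub>K\<^esub> coef ?J' (antisym r z)"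
        unfolding coef_antisym[OF z J'] by (rule V.R.finsum_rdistr[symmetric]) (use z in auto)
      finally show ?thesis using z by (simp add: V.R.l_minus)
    qed
  qed
  then show ?thesis by (intro waltI antisym_tp[OF z]) blast+
qed

text \<open>The same cancellation as for the coefficients of an antisymmetrized tensor, with the transposition
  acting from the other side.\<close>

lemma antisym_repeated:
  assumes "xs \<in> lists (carrier V)" "ys \<in> lists (carrier V)" "x \<in> carrier V" "length xs + 2 + length ys = r"
  shows "antisym r (wd (xs @ x # x # ys)) = \<zero>\<^bsub>T\<^esub>"
proof -
  let ?w = "xs @ x # x # ys" and ?t = "transpose (length xs + 1) (length xs + 2)"
  have w: "?w \<in> lists (carrier V)" "length ?w = r" using assms by auto
  note t = transpose_permutes[OF assms(4)]
  have it: "invp ?t = ?t" by simp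
  show ?thesis
  proof (rule tp_eqI[of _ r])
    show "antisym r (wd ?w) \<in> tp r" using w by (intro antisym_tp) simp
    show "\<zero>\<^bsub>T\<^esub> \<in> tp r" by (rule submodule_zero[OF tp_submodule])
    fix I assume I: "I \<in> idx r"
    have "(\<Oplus>\<^bsub>K\<^esub> \<sigma> \<in> perms r. eps \<sigma> \<otimes>\<^bsub>K\<^esub> coef (plist r \<sigma> I) (wd ?w)) = \<zero>\<^bsub>K\<^esub>"
    proof (rule signed_sum_zero[of r "\<lambda>\<sigma>. \<sigma> \<circ> ?t"])
      fix \<sigma> assume s: "\<sigma> \<in> perms r"
      show "\<sigma> \<circ> ?t \<in> perms r" using s t by (auto intro: permutes_compose)
      show "\<sigma> \<circ> ?t \<circ> ?t = \<sigma>" by (simp add: comp_assoc)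
      show "sign (\<sigma> \<circ> ?t) = - sign \<sigma>"
        using s t by (subst sign_compose) (auto intro!: perms_permutation simp: sign_swap_id)
      have "cp (plist r ?t (plist r \<sigma> I)) ?w = cp (plist r \<sigma> I) (plist r (invp ?t) ?w)"
        by (rule cp_plist) (use t w in auto)
      also have "\<dots> = cp (plist r \<sigma> I) ?w"
        by (simp only: it plist_transpose[OF assms(4)])
      finally show "coef (plist r (\<sigma> \<circ> ?t) I) (wd ?w) = coef (plist r \<sigma> I) (wd ?w)"
        using w(1) t by (simp only: coef_word plist_plist)
    qed (use w in auto)
    then show "coef I (antisym r (wd ?w)) = coef I \<zero>\<^bsub>T\<^esub>"
      using lin_zero[OF Tm Sm coef_linear, of I] w I by (simp add: coef_antisym)
  qed
qed

definition inc where "inc r = {I \<in> idx r. sorted_wrt (<) I}"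

definition alt_basis where "alt_basis I = antisym (length I) (basis_word I)"

lemma inc_finite [simp]: "finite (inc r)"
  by (rule finite_subset[OF _ idx_finite]) (auto simp: inc_def)

lemma alt_basis_alt: "I \<in> idx r \<Longrightarrow> alt_basis I \<in> alt r"
  using antisym_alt[OF basis_word_closed] by (auto simp: alt_basis_def idx_def)

lemma alt_basis_tp: "I \<in> idx r \<Longrightarrow> alt_basis I \<in> tp r"
  using alt_basis_alt walt_tp by blast

lemma alt_basis_closed: "I \<in> idx r \<Longrightarrow> alt_basis I \<in> carrier T"
  using alt_basis_tp tp_subset by blast

text \<open>If some permutation carries the increasing word \<open>J\<close> to the increasing word \<open>I\<close>, then both have the
  same set of letters, so they are equal, and the permutation is the identity.\<close>

lemma coef_alt_basis:
  assumes I: "I \<in> inc r" and J: "J \<in> inc r"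
  shows "coef J (alt_basis I) = (if I = J then \<one>\<^bsub>K\<^esub> else \<zero>\<^bsub>K\<^esub>)"
proof -
  have I': "set I \<subseteq> {1..n}" "length I = r" "sorted_wrt (<) I" using I by (auto simp: inc_def idx_def)
  have J': "set J \<subseteq> {1..n}" "length J = r" "sorted_wrt (<) J" "J \<in> idx r" using J by (auto simp: inc_def idx_def)
  have iff: "plist r \<sigma> J = I \<longleftrightarrow> \<sigma> = id \<and> I = J" if s: "\<sigma> \<in> perms r" for \<sigma>
  proof
    assume eq: "plist r \<sigma> J = I"
    have "set J = set I" using set_plist[of \<sigma> r J] s J' eq by auto
    then have IJ: "I = J" using strict_sorted_equal[OF J'(3) I'(3)] by simp
    have "\<sigma> k = k" for k
    proof (cases "1 \<le> k \<and> k \<le> r")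
      case True
      then have "J ! (\<sigma> k - 1) = J ! (k - 1)" using eq IJ plist_nth[of k r \<sigma> J] by simp
      moreover have "distinct J" using J'(3) by (simp add: strict_sorted_iff)
      ultimately have "\<sigma> k - 1 = k - 1"
        using True permutes_range[of \<sigma> r k] s J'(2) by (subst (asm) nth_eq_iff_index_eq) auto
      then show ?thesis using True permutes_range[of \<sigma> r k] s by auto
    next
      case False
      then show ?thesis using s by (auto simp: permutes_not_in)
    qed
    then show "\<sigma> = id \<and> I = J" using IJ by auto
  qed (use J' in \<open>auto simp: plist_id\<close>)
  have "coef J (alt_basis I) = (\<Oplus>\<^bsub>K\<^esub> \<sigma> \<in> perms r. eps \<sigma> \<otimes>\<^bsub>K\<^esub> coef (plist r \<sigma> J) (basis_word I))"
    using I' J' by (simp add: alt_basis_def coef_antisym basis_word_closed)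
  also have "\<dots> = (\<Oplus>\<^bsub>K\<^esub> \<sigma> \<in> perms r. if id = \<sigma> then (if I = J then \<one>\<^bsub>K\<^esub> else \<zero>\<^bsub>K\<^esub>) else \<zero>\<^bsub>K\<^esub>)"
    by (rule V.R.add.finprod_cong') (use I' in \<open>auto simp: coef_basis_word iff\<close>)
  also have "\<dots> = (if I = J then \<one>\<^bsub>K\<^esub> else \<zero>\<^bsub>K\<^esub>)"
    by (rule V.R.add.finprod_singleton) (auto simp: permutes_id)
  finally show ?thesis .
qed

text \<open>Sorting the letters in the window carries along the vanishing of the coefficient, since a swap changes
  it only by a sign.\<close>

lemma walt_vanish:
  assumes z: "z \<in> walt r lo hi" and len: "length xs = lo" "lo + a = hi"
    and van: "\<And>m. m \<in> inc a \<Longrightarrow> coef (xs @ m @ ys) z = \<zero>\<^bsub>K\<^esub>" and m: "m \<in> idx a"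
  shows "coef (xs @ m @ ys) z = \<zero>\<^bsub>K\<^esub>"
proof -
  have zT: "z \<in> carrier T" using z walt_T by blast
  note w1 = walt_eq[OF z] and w2 = walt_swap[OF z]
  have "length m = a \<longrightarrow> coef (xs @ m @ ys) z = \<zero>\<^bsub>K\<^esub>"
  proof (rule adjacent_sort[where A = "{1..n}" and Q = "\<lambda>m. length m = a \<longrightarrow> coef (xs @ m @ ys) z = \<zero>\<^bsub>K\<^esub>"])
    show "length (us @ i # i # vs) = a \<longrightarrow> coef (xs @ (us @ i # i # vs) @ ys) z = \<zero>\<^bsub>K\<^esub>" for us i vs
      using w1[of "xs @ us" i "vs @ ys"] len by auto
    show "length (us @ i # j # vs) = a \<longrightarrow> coef (xs @ (us @ i # j # vs) @ ys) z = \<zero>\<^bsub>K\<^esub>"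
      if "length (us @ j # i # vs) = a \<longrightarrow> coef (xs @ (us @ j # i # vs) @ ys) z = \<zero>\<^bsub>K\<^esub>" for us i j vs
      using w2[of "xs @ us" i j "vs @ ys"] len that by auto
  qed (use van m in \<open>auto simp: inc_def idx_def\<close>)
  then show ?thesis using m by (simp add: idx_def)
qed

text \<open>A family with a biorthogonal family of coefficients is a basis as soon as these coefficients separate
  points: the difference of the two sides has all its coefficients zero.\<close>

lemma dual_expand:
  assumes H: "submodule H K T" and X: "finite X" "\<And>x. x \<in> X \<Longrightarrow> g x \<in> H"
    and dual: "\<And>x y. x \<in> X \<Longrightarrow> y \<in> X \<Longrightarrow> coef (L y) (g x) = (if x = y then \<one>\<^bsub>K\<^esub> else \<zero>\<^bsub>K\<^esub>)"
    and sep: "\<And>w. w \<in> H \<Longrightarrow> (\<And>x. x \<in> X \<Longrightarrow> coef (L x) w = \<zero>\<^bsub>K\<^esub>) \<Longrightarrow> w = \<zero>\<^bsub>T\<^esub>" and z: "z \<in> H"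
  shows "z = (\<Oplus>\<^bsub>T\<^esub> x \<in> X. coef (L x) z \<odot>\<^bsub>T\<^esub> g x)"
proof -
  have HT: "H \<subseteq> carrier T" by (rule submodule_subset[OF H])
  have gT: "g x \<in> carrier T" if "x \<in> X" for x using X(2)[OF that] HT by auto
  have zT: "z \<in> carrier T" using z HT by auto
  let ?s = "\<Oplus>\<^bsub>T\<^esub> x \<in> X. coef (L x) z \<odot>\<^bsub>T\<^esub> g x"
  have s: "?s \<in> H"
    by (rule submodule_finsum[OF Tm H]) (use X(2) zT in \<open>auto intro!: submodule_smult[OF H]\<close>)
  then have sT: "?s \<in> carrier T" using HT by auto
  have "z \<ominus>\<^bsub>T\<^esub> ?s = \<zero>\<^bsub>T\<^esub>"
  proof (rule sep)
    have "(\<ominus>\<^bsub>K\<^esub> \<one>\<^bsub>K\<^esub>) \<odot>\<^bsub>T\<^esub> ?s \<in> H" by (rule submodule_smult[OF H _ s]) simp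
    then show "z \<ominus>\<^bsub>T\<^esub> ?s \<in> H"
      using submodule_add[OF H z] sT by (simp add: a_minus_def T.smult_l_minus)
    fix y assume y: "y \<in> X"
    have "coef (L y) ?s = (\<Oplus>\<^bsub>K\<^esub> x \<in> X. coef (L y) (coef (L x) z \<odot>\<^bsub>T\<^esub> g x))"
      by (rule coef_finsum) (use gT zT in auto)
    also have "\<dots> = (\<Oplus>\<^bsub>K\<^esub> x \<in> X. (if x = y then \<one>\<^bsub>K\<^esub> else \<zero>\<^bsub>K\<^esub>) \<odot>\<^bsub>self_module K\<^esub> coef (L x) z)"
      by (rule V.R.add.finprod_cong') (use gT zT dual y in \<open>auto simp: coef_smult\<close>)
    also have "\<dots> = coef (L y) z"
      using finsum_delta[OF Sm X(1) y, of "\<lambda>x. coef (L x) z"] zT by simp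
    finally show "coef (L y) (z \<ominus>\<^bsub>T\<^esub> ?s) = \<zero>\<^bsub>K\<^esub>"
      using lin_diff[OF Tm Sm coef_linear zT sT] diff_eq_zero_iff[OF Sm, of "coef (L y) z" "coef (L y) z"] zT by simp
  qed
  then show ?thesis using diff_eq_zero_iff[OF Tm zT sT] by simp
qed

lemma alt_expand:
  assumes "z \<in> alt r" shows "z = (\<Oplus>\<^bsub>T\<^esub> I \<in> inc r. coef I z \<odot>\<^bsub>T\<^esub> alt_basis I)"
proof (rule dual_expand[OF walt_submodule inc_finite _ _ _ assms])
  show "alt_basis I \<in> alt r" if "I \<in> inc r" for I using that alt_basis_alt by (auto simp: inc_def)
  fix w assume w: "w \<in> alt r" and van: "\<And>I. I \<in> inc r \<Longrightarrow> coef I w = \<zero>\<^bsub>K\<^esub>"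
  show "w = \<zero>\<^bsub>T\<^esub>"
  proof (rule tp_eqI[of _ r])
    fix I assume "I \<in> idx r"
    from walt_vanish[OF w, of "[]" r "[]" I] van this show "coef I w = coef I \<zero>\<^bsub>T\<^esub>"
      using lin_zero[OF Tm Sm coef_linear] by simp
  qed (use w walt_tp submodule_zero[OF tp_submodule] in auto)
qed (simp add: coef_alt_basis)

lemma idx_split:
  assumes "I \<in> idx (a + b)" shows "\<exists>J L. J \<in> idx a \<and> L \<in> idx b \<and> I = J @ L"
proof (intro exI conjI)
  have "set (take a I) \<subseteq> set I" "set (drop a I) \<subseteq> set I" by (auto dest: in_set_takeD in_set_dropD)
  then show "take a I \<in> idx a" "drop a I \<in> idx b" using assms by (auto simp: idx_def)
qed simp

lemma walt_mono: "lo \<le> lo' \<Longrightarrow> hi' \<le> hi \<Longrightarrow> walt r lo hi \<subseteq> walt r lo' hi'"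
proof
  fix z assume le: "lo \<le> lo'" "hi' \<le> hi" and z: "z \<in> walt r lo hi"
  show "z \<in> walt r lo' hi'"
    by (rule waltI[OF subsetD[OF walt_tp z]])
      (use le in \<open>auto intro: walt_eq[OF z] walt_swap[OF z]\<close>)
qed

lemma walt_mult_left:
  assumes u: "u \<in> tp c" and w: "w \<in> walt r lo hi" shows "u \<otimes>\<^bsub>T\<^esub> w \<in> walt (c + r) (c + lo) (c + hi)"
proof -
  have uT: "u \<in> carrier T" and wT: "w \<in> carrier T" and wtp: "w \<in> tp r"
    using u w tp_subset walt_T walt_tp by blast+
  have 1: "\<exists>us vs. xs = us @ vs \<and> length us = c \<and> lo \<le> length vs \<and> length vs + 2 \<le> hi"
    if "c + lo \<le> length xs" "length xs + 2 \<le> c + hi" for xs :: "nat list"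
    using that by (intro exI[of _ "take c xs"] exI[of _ "drop c xs"]) auto
  note w1 = walt_eq[OF w] and w2 = walt_swap[OF w]
  have "coef (xs @ i # i # ys) (u \<otimes>\<^bsub>T\<^esub> w) = \<zero>\<^bsub>K\<^esub> \<and>
      coef (xs @ i # j # ys) (u \<otimes>\<^bsub>T\<^esub> w) = \<ominus>\<^bsub>K\<^esub> coef (xs @ j # i # ys) (u \<otimes>\<^bsub>T\<^esub> w)"
    if xs: "c + lo \<le> length xs" "length xs + 2 \<le> c + hi" for xs i j ys
  proof -
    obtain us vs where us: "xs = us @ vs" "length us = c" "lo \<le> length vs" "length vs + 2 \<le> hi"
      using 1[OF xs] by blast
    have "coef (xs @ l) (u \<otimes>\<^bsub>T\<^esub> w) = coef us u \<otimes>\<^bsub>K\<^esub> coef (vs @ l) w" for l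
      using coef_mult[OF u us(2) wT, of "vs @ l"] by (simp add: us)
    then show ?thesis using w1[OF us(3,4)] w2[OF us(3,4), of i j ys] uT wT by (simp add: V.R.r_minus)
  qed
  then show ?thesis by (intro waltI tp_mult[OF u wtp]) blast+
qed

lemma walt_mult_right:
  assumes t: "t \<in> tp d" and w: "w \<in> walt r lo hi" and hi: "hi \<le> r"
  shows "w \<otimes>\<^bsub>T\<^esub> t \<in> walt (r + d) lo hi"
proof -
  have tT: "t \<in> carrier T" and wT: "w \<in> carrier T" and wtp: "w \<in> tp r"
    using t w tp_subset walt_T walt_tp by blast+
  note w1 = walt_eq[OF w] and w2 = walt_swap[OF w]
  have wt: "w \<otimes>\<^bsub>T\<^esub> t \<in> tp (r + d)" by (rule tp_mult[OF wtp t])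
  have "coef (xs @ i # i # ys) (w \<otimes>\<^bsub>T\<^esub> t) = \<zero>\<^bsub>K\<^esub> \<and>
      coef (xs @ i # j # ys) (w \<otimes>\<^bsub>T\<^esub> t) = \<ominus>\<^bsub>K\<^esub> coef (xs @ j # i # ys) (w \<otimes>\<^bsub>T\<^esub> t)"
    if xs: "lo \<le> length xs" "length xs + 2 \<le> hi" for xs i j ys
  proof (cases "length xs + 2 + length ys = r + d")
    case False
    then have "xs @ i' # j' # ys \<notin> idx (r + d)" for i' j' by (auto simp: idx_def)
    then show ?thesis by (simp add: coef_outside[OF wt])
  next
    case True
    define vs where "vs = take (r - 2 - length xs) ys"
    define ls where "ls = drop (r - 2 - length xs) ys"
    have ys: "ys = vs @ ls" "length xs + 2 + length vs = r" using True xs hi by (auto simp: vs_def ls_def)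
    have "coef (xs @ i' # j' # ys) (w \<otimes>\<^bsub>T\<^esub> t) = coef (xs @ i' # j' # vs) w \<otimes>\<^bsub>K\<^esub> coef ls t" for i' j'
      using coef_mult[OF wtp _ tT, of "xs @ i' # j' # vs" ls] ys by simp
    then show ?thesis using w1[OF xs] w2[OF xs, of i j vs] tT wT by (simp add: V.R.l_minus)
  qed
  then show ?thesis by (intro waltI wt) blast+
qed

text \<open>The expansion takes place in the space of tensors that alternate in the first \<open>a\<close> and in the last \<open>b\<close>
  positions separately; it contains the products of alternating tensors as well as \<open>z\<close>.\<close>

lemma double_expand:
  assumes z: "z \<in> alt (a + b)"
  shows "z = (\<Oplus>\<^bsub>T\<^esub> x \<in> inc a \<times> inc b. coef (fst x @ snd x) z \<odot>\<^bsub>T\<^esub> (alt_basis (fst x) \<otimes>\<^bsub>T\<^esub> alt_basis (snd x)))"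
proof (rule dual_expand[where H = "walt (a + b) 0 a \<inter> walt (a + b) a (a + b)"])
  show "submodule (walt (a + b) 0 a \<inter> walt (a + b) a (a + b)) K T"
    by (rule submoduleI_smult[OF Tm])
      (use walt_T submodule_zero[OF walt_submodule] submodule_add[OF walt_submodule] submodule_smult[OF walt_submodule] in auto)
  show "z \<in> walt (a + b) 0 a \<inter> walt (a + b) a (a + b)"
    using z walt_mono[of 0 0 a "a + b" "a + b"] walt_mono[of 0 a "a + b" "a + b" "a + b"] by auto
  show "alt_basis (fst x) \<otimes>\<^bsub>T\<^esub> alt_basis (snd x) \<in> walt (a + b) 0 a \<inter> walt (a + b) a (a + b)" if x: "x \<in> inc a \<times> inc b" for x
    using walt_mult_left[OF alt_basis_tp alt_basis_alt, of "fst x" a "snd x" b]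
      walt_mult_right[OF alt_basis_tp alt_basis_alt, of "snd x" b "fst x" a] x by (auto simp: inc_def)
  fix x y assume x: "x \<in> inc a \<times> inc b" and y: "y \<in> inc a \<times> inc b"
  have "coef (fst y @ snd y) (alt_basis (fst x) \<otimes>\<^bsub>T\<^esub> alt_basis (snd x)) = coef (fst y) (alt_basis (fst x)) \<otimes>\<^bsub>K\<^esub> coef (snd y) (alt_basis (snd x))"
    by (rule coef_mult[of _ a]) (use x y alt_basis_tp alt_basis_closed in \<open>auto simp: inc_def idx_def\<close>)
  also have "\<dots> = (if x = y then \<one>\<^bsub>K\<^esub> else \<zero>\<^bsub>K\<^esub>)"
    using x y by (cases "fst x = fst y"; cases "snd x = snd y")
      (auto simp: coef_alt_basis prod_eq_iff mem_Times_iff)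
  finally show "coef (fst y @ snd y) (alt_basis (fst x) \<otimes>\<^bsub>T\<^esub> alt_basis (snd x)) = (if x = y then \<one>\<^bsub>K\<^esub> else \<zero>\<^bsub>K\<^esub>)" .
next
  fix w assume w: "w \<in> walt (a + b) 0 a \<inter> walt (a + b) a (a + b)"
    and van: "\<And>x. x \<in> inc a \<times> inc b \<Longrightarrow> coef (fst x @ snd x) w = \<zero>\<^bsub>K\<^esub>"
  have 1: "coef (I @ J) w = \<zero>\<^bsub>K\<^esub>" if I: "I \<in> inc a" and J: "J \<in> idx b" for I J
    using walt_vanish[of w "a + b" a "a + b" I b "[]" J] w van[of "(I, _)"] I J
    by (auto simp: inc_def idx_def)
  have 2: "coef (I @ J) w = \<zero>\<^bsub>K\<^esub>" if I: "I \<in> idx a" and J: "J \<in> idx b" for I J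
    using walt_vanish[of w "a + b" 0 a "[]" a J I] w 1[OF _ J] I by auto
  show "w = \<zero>\<^bsub>T\<^esub>"
  proof (rule tp_eqI[of _ "a + b"])
    fix I assume "I \<in> idx (a + b)"
    then obtain J L where "J \<in> idx a" "L \<in> idx b" "I = J @ L" using idx_split by blast
    then show "coef I w = coef I \<zero>\<^bsub>T\<^esub>" using 2 lin_zero[OF Tm Sm coef_linear] by simp
  qed (use w walt_tp submodule_zero[OF tp_submodule] in auto)
qed simp

text \<open>For \<open>a = N\<close> this exhibits a tensor that alternates in a window of length \<open>N\<close> as an element of
  \<open>V\<^sup>c \<otimes> R \<otimes> V\<^sup>d\<close>.\<close>

lemma triple_expand:
  assumes z: "z \<in> walt (c + (a + d)) c (c + a)"
  shows "z = (\<Oplus>\<^bsub>T\<^esub> x \<in> idx c \<times> inc a \<times> idx d. coef (fst x @ fst (snd x) @ snd (snd x)) z \<odot>\<^bsub>T\<^esub>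
      (basis_word (fst x) \<otimes>\<^bsub>T\<^esub> (alt_basis (fst (snd x)) \<otimes>\<^bsub>T\<^esub> basis_word (snd (snd x)))))"
proof (rule dual_expand[OF walt_submodule _ _ _ _ z])
  show "basis_word (fst x) \<otimes>\<^bsub>T\<^esub> (alt_basis (fst (snd x)) \<otimes>\<^bsub>T\<^esub> basis_word (snd (snd x))) \<in> walt (c + (a + d)) c (c + a)"
    if x: "x \<in> idx c \<times> inc a \<times> idx d" for x
    using walt_mult_left[OF basis_word_tp walt_mult_right[OF basis_word_tp alt_basis_alt], of "fst x" c "snd (snd x)" d "fst (snd x)" a] x
    by (auto simp: inc_def)
  fix x y assume x: "x \<in> idx c \<times> inc a \<times> idx d" and y: "y \<in> idx c \<times> inc a \<times> idx d"
  have x': "fst (snd x) \<in> idx a" using x by (auto simp: inc_def)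
  have ewx: "basis_word (snd (snd x)) \<in> carrier T" "basis_word (fst x) \<in> tp c" "alt_basis (fst (snd x)) \<in> tp a"
    using x basis_word_tp alt_basis_tp[OF x'] basis_word_closed[of "snd (snd x)"] by (auto simp: idx_def)
  have "coef (fst y @ fst (snd y) @ snd (snd y)) (basis_word (fst x) \<otimes>\<^bsub>T\<^esub> (alt_basis (fst (snd x)) \<otimes>\<^bsub>T\<^esub> basis_word (snd (snd x)))) =
      coef (fst y) (basis_word (fst x)) \<otimes>\<^bsub>K\<^esub> (coef (fst (snd y)) (alt_basis (fst (snd x))) \<otimes>\<^bsub>K\<^esub> coef (snd (snd y)) (basis_word (snd (snd x))))"
    using ewx y subsetD[OF tp_subset ewx(3)]
    by (subst coef_mult[OF ewx(2)], simp add: idx_def mem_Times_iff, simp, subst coef_mult[OF ewx(3)])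
      (auto simp: idx_def inc_def)
  also have "\<dots> = (if x = y then \<one>\<^bsub>K\<^esub> else \<zero>\<^bsub>K\<^esub>)"
  proof -
    have "set (fst x) \<subseteq> {1..n}" "set (snd (snd x)) \<subseteq> {1..n}" using x by (auto simp: idx_def)
    then show ?thesis using x y
      by (cases "fst x = fst y"; cases "fst (snd x) = fst (snd y)"; cases "snd (snd x) = snd (snd y)")
        (auto simp: coef_alt_basis coef_basis_word prod_eq_iff mem_Times_iff)
  qed
  finally show "coef (fst y @ fst (snd y) @ snd (snd y)) (basis_word (fst x) \<otimes>\<^bsub>T\<^esub> (alt_basis (fst (snd x)) \<otimes>\<^bsub>T\<^esub> basis_word (snd (snd x))))
      = (if x = y then \<one>\<^bsub>K\<^esub> else \<zero>\<^bsub>K\<^esub>)" .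
next
  fix w assume w: "w \<in> walt (c + (a + d)) c (c + a)"
    and van: "\<And>x. x \<in> idx c \<times> inc a \<times> idx d \<Longrightarrow> coef (fst x @ fst (snd x) @ snd (snd x)) w = \<zero>\<^bsub>K\<^esub>"
  have 1: "coef (I @ J @ L) w = \<zero>\<^bsub>K\<^esub>" if I: "I \<in> idx c" and J: "J \<in> idx a" and L: "L \<in> idx d" for I J L
    using walt_vanish[OF w, of I a L J] van[of "(I, _, L)"] I J L by (auto simp: idx_def)
  show "w = \<zero>\<^bsub>T\<^esub>"
  proof (rule tp_eqI[of _ "c + (a + d)"])
    fix I assume "I \<in> idx (c + (a + d))"
    then obtain J L M where "J \<in> idx c" "L \<in> idx a" "M \<in> idx d" "I = J @ L @ M" using idx_split by metis
    then show "coef I w = coef I \<zero>\<^bsub>T\<^esub>" using 1 lin_zero[OF Tm Sm coef_linear] by simp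
  qed (use w walt_tp submodule_zero[OF tp_submodule] in auto)
qed simp

end


section \<open>Exterior powers\<close>

lemma seg_append: "seg 1 a x @ seg (a + 1) (a + b) x = seg 1 (a + b) x"
proof -
  have "[1..<Suc (a + b)] = [1..<Suc a] @ [a + 1..<Suc (a + b)]"
    using upt_add_eq_append[of 1 "a + 1" b] unfolding Suc_eq_plus1 by (simp add: ac_simps del: upt_Suc)
  then show ?thesis by (simp only: seg_def map_append)
qed

lemma map_seg: "map g (seg i j x) = seg i j (g \<circ> x)"
  by (simp add: seg_def)

lemma set_seg: "set (seg i j x) = x ` {i..j}"
  by (auto simp: seg_def simp del: upt_Suc)

lemma sorted_seg:
  fixes x :: "nat \<Rightarrow> nat"
  shows "sorted_wrt (<) (seg i j x) \<longleftrightarrow> strict_mono_on {i..j} x"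
proof
  assume s: "sorted_wrt (<) (seg i j x)"
  show "strict_mono_on {i..j} x"
  proof (rule strict_mono_onI)
    fix k l assume kl: "k \<in> {i..j}" "l \<in> {i..j}" "k < l"
    have "seg i j x ! (k - i) < seg i j x ! (l - i)"
      by (rule sorted_wrt_nth_less[OF s]) (use kl in auto)
    then show "x k < x l" using kl by (simp add: seg_def del: upt_Suc)
  qed
next
  assume m: "strict_mono_on {i..j} x"
  show "sorted_wrt (<) (seg i j x)"
    unfolding sorted_wrt_iff_nth_less
  proof (intro allI impI)
    fix k l assume "k < l" "l < length (seg i j x)"
    then show "seg i j x ! k < seg i j x ! l"
      using strict_mono_onD[OF m, of "i + k" "i + l"] by (simp add: seg_def del: upt_Suc)
  qed
qed

context based
begin

abbreviation E where "E \<equiv> ealg K V"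
abbreviation wg where "wg \<equiv> wedge K V"
abbreviation ep where "ep r \<equiv> carrier (extpow K V r)"

definition ealg_gens where "ealg_gens = {wd [x] \<otimes>\<^bsub>T\<^esub> wd [x] | x. x \<in> carrier V}"

lemma ealg_gens_closed: "ealg_gens \<subseteq> carrier T"
  by (auto simp: ealg_gens_def)

lemma ealg_kernel_gens: "ealg_kernel K V = Idl\<^bsub>T\<^esub> ealg_gens"
  by (simp add: ealg_kernel_def ealg_gens_def)

lemma ealg_kernel_ideal: "ideal (ealg_kernel K V) T"
  unfolding ealg_kernel_gens by (rule TR.genideal_ideal[OF ealg_gens_closed])

lemma ealg_kernel_submodule: "submodule (ealg_kernel K V) K T"
  by (rule kalg_ideal_submodule[OF talg_kalg ealg_kernel_ideal])

lemma ealg_kalg: "kalg K E"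
  unfolding ealg_def by (rule quot_kalg[OF talg_kalg ealg_kernel_ideal])

lemmas Em = kalg_module[OF ealg_kalg]

sublocale E: module K E by (rule Em)

definition epr where "epr z = ealg_kernel K V +>\<^bsub>T\<^esub> z"

lemma epr_linear: "epr \<in> linear_maps K T E"
  unfolding epr_def[abs_def] ealg_def by (rule quot_proj_linear[OF Tm ealg_kernel_submodule])

lemma wg_epr: "wg xs = epr (wd xs)"
  by (simp add: wedge_def epr_def)

lemma wg_closed [simp]: "xs \<in> lists (carrier V) \<Longrightarrow> wg xs \<in> carrier E"
  by (simp add: wg_epr lin_closed[OF epr_linear])

lemma wg_linear:
  "xs \<in> lists (carrier V) \<Longrightarrow> ys \<in> lists (carrier V) \<Longrightarrow> (\<lambda>x. wg (xs @ x # ys)) \<in> linear_maps K V E"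
  unfolding wg_epr by (rule lin_comp[OF word_linear epr_linear])

lemma wg_repeated:
  assumes "xs \<in> lists (carrier V)" "ys \<in> lists (carrier V)" "x \<in> carrier V"
  shows "wg (xs @ x # x # ys) = \<zero>\<^bsub>E\<^esub>"
proof -
  interpret I: ideal "ealg_kernel K V" T by (rule ealg_kernel_ideal)
  have "wd [x] \<otimes>\<^bsub>T\<^esub> wd [x] \<in> ealg_kernel K V"
    unfolding ealg_kernel_gens
    by (rule subsetD[OF TR.genideal_self[OF ealg_gens_closed]]) (use assms in \<open>auto simp: ealg_gens_def\<close>)
  then have "wd xs \<otimes>\<^bsub>T\<^esub> (wd [x] \<otimes>\<^bsub>T\<^esub> wd [x]) \<in> ealg_kernel K V"
    by (rule I.I_l_closed) (use assms in simp)
  then have "wd xs \<otimes>\<^bsub>T\<^esub> (wd [x] \<otimes>\<^bsub>T\<^esub> wd [x]) \<otimes>\<^bsub>T\<^esub> wd ys \<in> ealg_kernel K V"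
    by (rule I.I_r_closed) (use assms in simp)
  then have "wd (xs @ x # x # ys) \<in> ealg_kernel K V"
    using assms by (simp add: word_mult)
  then have "wd (xs @ x # x # ys) \<ominus>\<^bsub>T\<^esub> \<zero>\<^bsub>T\<^esub> \<in> ealg_kernel K V"
    using assms by (simp add: a_minus_def)
  then have "epr (wd (xs @ x # x # ys)) = epr \<zero>\<^bsub>T\<^esub>"
    unfolding epr_def using assms by (subst quot_eq_iff[OF Tm ealg_kernel_submodule]) auto
  then show ?thesis by (simp add: wg_epr lin_zero[OF Tm Em epr_linear])
qed

text \<open>Polarisation of the vanishing of squares.\<close>

lemma wg_swap:
  assumes "xs \<in> lists (carrier V)" "ys \<in> lists (carrier V)" "x \<in> carrier V" "y \<in> carrier V"
  shows "wg (xs @ x # y # ys) = \<ominus>\<^bsub>E\<^esub> wg (xs @ y # x # ys)"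
proof -
  let ?w = "\<lambda>x y. wg (xs @ x # y # ys)"
  have c: "?w x y \<in> carrier E" if "x \<in> carrier V" "y \<in> carrier V" for x y
    using that assms by simp
  have 1: "?w (x \<oplus>\<^bsub>V\<^esub> y) z = ?w x z \<oplus>\<^bsub>E\<^esub> ?w y z" if "z \<in> carrier V" for z
    by (rule lin_add[OF wg_linear[of xs "z # ys"]]) (use assms that in auto)
  have 2: "?w z (x \<oplus>\<^bsub>V\<^esub> y) = ?w z x \<oplus>\<^bsub>E\<^esub> ?w z y" if "z \<in> carrier V" for z
    using lin_add[OF wg_linear[of "xs @ [z]" "ys"]] assms that by simp
  have "\<zero>\<^bsub>E\<^esub> = ?w (x \<oplus>\<^bsub>V\<^esub> y) (x \<oplus>\<^bsub>V\<^esub> y)" using assms by (simp add: wg_repeated)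
  also have "\<dots> = (?w x x \<oplus>\<^bsub>E\<^esub> ?w y x) \<oplus>\<^bsub>E\<^esub> (?w x y \<oplus>\<^bsub>E\<^esub> ?w y y)"
    using assms by (simp add: 1 2)
  also have "\<dots> = ?w x y \<oplus>\<^bsub>E\<^esub> ?w y x"
    using assms c by (simp add: wg_repeated E.M.add.m_comm)
  finally have "?w x y \<oplus>\<^bsub>E\<^esub> ?w y x = \<zero>\<^bsub>E\<^esub>" ..
  then show ?thesis using c assms by (intro E.minus_equality[symmetric]) simp_all
qed

lemma antisym_wrong_length:
  assumes "w \<in> lists (carrier V)" "length w \<noteq> r" shows "antisym r (wd w) = \<zero>\<^bsub>T\<^esub>"
proof (rule tp_eqI[of _ r])
  show "antisym r (wd w) \<in> tp r" using assms by (intro antisym_tp) simp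
  show "\<zero>\<^bsub>T\<^esub> \<in> tp r" by (rule submodule_zero[OF tp_submodule])
  fix I assume I: "I \<in> idx r"
  have "coef I (antisym r (wd w)) = (\<Oplus>\<^bsub>K\<^esub> \<sigma> \<in> perms r. \<zero>\<^bsub>K\<^esub>)"
    unfolding coef_antisym[OF word_closed[OF assms(1)] I]
    by (rule V.R.add.finprod_cong') (use assms in \<open>auto simp: coef_word cp_length\<close>)
  then show "coef I (antisym r (wd w)) = coef I \<zero>\<^bsub>T\<^esub>" using lin_zero[OF Tm Sm coef_linear] by simp
qed

text \<open>The ideal of the exterior algebra is generated by squares of vectors, and \<open>Ant\<close> kills every word that
  contains one.\<close>

lemma Phi_ex: "\<exists>h \<in> linear_maps K E T. \<forall>z \<in> carrier T. h (epr z) = antisym r z"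
proof -
  have "antisym r z = \<zero>\<^bsub>T\<^esub>" if "z \<in> ealg_kernel K V" for z
  proof (rule lin_vanish_ideal[OF talg_kalg Tm antisym_linear ealg_gens_closed _ talg_span _
        that[unfolded ealg_kernel_gens]])
    fix b g b' assume "b \<in> wd ` lists (carrier V)" "g \<in> ealg_gens" "b' \<in> wd ` lists (carrier V)"
    then obtain xs x ys where w: "xs \<in> lists (carrier V)" "x \<in> carrier V" "ys \<in> lists (carrier V)"
      and eq: "b = wd xs" "g = wd [x] \<otimes>\<^bsub>T\<^esub> wd [x]" "b' = wd ys" by (auto simp: ealg_gens_def)
    have "b \<otimes>\<^bsub>T\<^esub> g \<otimes>\<^bsub>T\<^esub> b' = wd (xs @ x # x # ys)" using w by (simp add: eq word_mult)
    then show "antisym r (b \<otimes>\<^bsub>T\<^esub> g \<otimes>\<^bsub>T\<^esub> b') = \<zero>\<^bsub>T\<^esub>"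
      using w by (cases "length xs + 2 + length ys = r") (auto simp: antisym_repeated antisym_wrong_length)
  qed auto
  from quot_lift[OF Tm ealg_kernel_submodule Tm antisym_linear this] show ?thesis
    by (simp add: ealg_def epr_def)
qed

definition Phi where "Phi r = (SOME h. h \<in> linear_maps K E T \<and> (\<forall>z \<in> carrier T. h (epr z) = antisym r z))"

lemma Phi_linear: "Phi r \<in> linear_maps K E T" and Phi_epr: "z \<in> carrier T \<Longrightarrow> Phi r (epr z) = antisym r z"
proof -
  have ex: "\<exists>h. h \<in> linear_maps K E T \<and> (\<forall>z \<in> carrier T. h (epr z) = antisym r z)"
    using Phi_ex[of r] by blast
  have "Phi r \<in> linear_maps K E T \<and> (\<forall>z \<in> carrier T. Phi r (epr z) = antisym r z)"
    unfolding Phi_def by (fact someI_ex[OF ex])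
  then show "Phi r \<in> linear_maps K E T" "z \<in> carrier T \<Longrightarrow> Phi r (epr z) = antisym r z" by auto
qed

definition basis_wedge where "basis_wedge I = wg (map e I)"

lemma basis_wedge_epr: "basis_wedge I = epr (basis_word I)" by (simp add: basis_wedge_def basis_word_def wg_epr)

lemma basis_wedge_closed: "set I \<subseteq> {1..n} \<Longrightarrow> basis_wedge I \<in> carrier E"
  by (simp add: basis_wedge_def map_e_lists)

lemma ep_def: "ep r = span_of K E {wg xs | xs. xs \<in> lists (carrier V) \<and> length xs = r}"
  by (simp add: extpow_def)

lemma ep_words: "{wg xs | xs. xs \<in> lists (carrier V) \<and> length xs = r} \<subseteq> carrier E"
  by auto

lemma ep_submodule: "submodule (ep r) K E"
  unfolding ep_def by (rule span_submodule[OF Em ep_words])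

lemma ep_subset: "ep r \<subseteq> carrier E"
  by (rule submodule_subset[OF ep_submodule])

lemma wg_ep: "xs \<in> lists (carrier V) \<Longrightarrow> length xs = r \<Longrightarrow> wg xs \<in> ep r"
  unfolding ep_def by (rule subsetD[OF span_incl]) blast

lemma basis_wedge_ep: "I \<in> idx r \<Longrightarrow> basis_wedge I \<in> ep r"
  unfolding basis_wedge_def by (rule wg_ep) (auto simp: idx_def intro: map_e_lists)

lemma extpow_eq: "extpow K V r = E\<lparr>carrier := ep r\<rparr>"
  by (simp add: extpow_def)

lemma extpow_module: "module K (extpow K V r)"
  by (subst extpow_eq) (rule submodule.submodule_is_module[OF ep_submodule Em])

lemma basis_wedge_inc_closed: "basis_wedge ` inc r \<subseteq> carrier E"
  using basis_wedge_closed by (auto simp: inc_def idx_def)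

text \<open>Adjacent swaps only change the sign of a wedge, so sorting applies to the property of lying in the span
  of the increasing wedges.\<close>

lemma ep_span_inc: "ep r \<subseteq> span_of K E (basis_wedge ` inc r)"
proof -
  let ?H = "span_of K E (basis_wedge ` inc r)"
  have sub: "submodule ?H K E" by (rule span_submodule[OF Em basis_wedge_inc_closed])
  have basis_wedge: "m \<in> idx r \<longrightarrow> basis_wedge m \<in> ?H" if "set m \<subseteq> {1..n}" for m
  proof (rule adjacent_sort[where Q = "\<lambda>m. m \<in> idx r \<longrightarrow> basis_wedge m \<in> ?H" and A = "{1..n}"])
    show "us @ i # i # vs \<in> idx r \<longrightarrow> basis_wedge (us @ i # i # vs) \<in> ?H" for us i vs
      using submodule_zero[OF sub] wg_repeated[of "map e us" "map e vs" "e i"] e_closed map_e_lists[of us] map_e_lists[of vs]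
      by (auto simp: basis_wedge_def idx_def)
    show "us @ i # j # vs \<in> idx r \<longrightarrow> basis_wedge (us @ i # j # vs) \<in> ?H"
      if H: "us @ j # i # vs \<in> idx r \<longrightarrow> basis_wedge (us @ j # i # vs) \<in> ?H" for us i j vs
    proof
      assume "us @ i # j # vs \<in> idx r"
      then have l: "map e us \<in> lists (carrier V)" "map e vs \<in> lists (carrier V)" "e i \<in> carrier V" "e j \<in> carrier V"
        and "us @ j # i # vs \<in> idx r"
        using e_closed map_e_lists[of us] map_e_lists[of vs] by (auto simp: idx_def)
      then have h: "basis_wedge (us @ j # i # vs) \<in> ?H" using H by simp
      have "basis_wedge (us @ i # j # vs) = \<ominus>\<^bsub>E\<^esub> basis_wedge (us @ j # i # vs)"
        using wg_swap[OF l] by (simp add: basis_wedge_def)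
      then show "basis_wedge (us @ i # j # vs) \<in> ?H"
        using E.submoduleE(3)[OF sub h] by simp
    qed
    show "m \<in> idx r \<longrightarrow> basis_wedge m \<in> ?H" if "sorted_wrt (<) m" for m
      using that by (auto simp: inc_def intro!: subsetD[OF span_incl])
  qed (rule that)
  have "wg xs \<in> ?H" if "xs \<in> lists (carrier V)" "length xs = r" for xs
    unfolding wg_epr
    by (rule lin_image_span[OF Tm Em epr_linear basis_word_image_closed subsetD[OF tp_span_basis_word word_tp[OF that]] sub])
      (use basis_wedge in \<open>auto simp: basis_wedge_epr[symmetric] idx_def\<close>)
  then show ?thesis
    unfolding ep_def by (intro span_least[OF sub]) auto
qed

lemma extpow_span_inc: "span_of K (extpow K V r) (basis_wedge ` inc r) = ep r"
  by (subst extpow_eq, rule span_in_submodule[OF Em ep_submodule _ ep_span_inc])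
    (use basis_wedge_ep in \<open>auto simp: inc_def\<close>)

lemma Phi_basis_wedge: "I \<in> idx r \<Longrightarrow> Phi r (basis_wedge I) = alt_basis I"
  by (auto simp: basis_wedge_epr Phi_epr alt_basis_def idx_def basis_word_closed)

lemma Phi_alt: "w \<in> ep r \<Longrightarrow> Phi r w \<in> alt r"
  by (rule lin_image_span[OF Em Tm Phi_linear basis_wedge_inc_closed subsetD[OF ep_span_inc] walt_submodule])
    (auto simp: Phi_basis_wedge inc_def alt_basis_alt)

text \<open>The inverse of \<open>\<phi>\<^sub>r\<close>, defined on the whole tensor algebra by the coefficients at increasing words.\<close>

definition Psi where "Psi r z = (\<Oplus>\<^bsub>E\<^esub> I \<in> inc r. coef I z \<odot>\<^bsub>E\<^esub> basis_wedge I)"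

lemma Psi_linear: "Psi r \<in> linear_maps K T E"
  unfolding Psi_def[abs_def]
  by (rule finsum_linear[OF Em _ coef_linear Tm]) (use basis_wedge_inc_closed in auto)

lemma Psi_ep: "z \<in> carrier T \<Longrightarrow> Psi r z \<in> ep r"
  unfolding Psi_def
  by (rule submodule_finsum[OF Em ep_submodule])
    (auto simp: inc_def intro!: submodule_smult[OF ep_submodule] basis_wedge_ep)

lemma Psi_alt_basis: assumes "I \<in> inc r" shows "Psi r (alt_basis I) = basis_wedge I"
proof -
  have basis_wedge: "basis_wedge J \<in> carrier E" if "J \<in> inc r" for J using that basis_wedge_inc_closed by blast
  have "Psi r (alt_basis I) = (\<Oplus>\<^bsub>E\<^esub> J \<in> inc r. (if J = I then \<one>\<^bsub>K\<^esub> else \<zero>\<^bsub>K\<^esub>) \<odot>\<^bsub>E\<^esub> basis_wedge J)"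
    unfolding Psi_def
    by (rule E.M.add.finprod_cong') (use assms basis_wedge in \<open>auto simp: coef_alt_basis\<close>)
  also have "\<dots> = basis_wedge I"
    by (rule finsum_delta[OF Em inc_finite assms]) (use basis_wedge_inc_closed in auto)
  finally show ?thesis .
qed

lemma Phi_Psi: assumes "z \<in> alt r" shows "Phi r (Psi r z) = z"
proof -
  have z: "z \<in> carrier T" using assms walt_T by blast
  have basis_wedge: "basis_wedge I \<in> carrier E" "I \<in> idx r" if "I \<in> inc r" for I using that basis_wedge_closed by (auto simp: inc_def idx_def)
  have "Phi r (Psi r z) = (\<Oplus>\<^bsub>T\<^esub> I \<in> inc r. Phi r (coef I z \<odot>\<^bsub>E\<^esub> basis_wedge I))"
    unfolding Psi_def by (rule lin_finsum[OF Em Tm Phi_linear]) (use basis_wedge z in auto)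
  also have "\<dots> = (\<Oplus>\<^bsub>T\<^esub> I \<in> inc r. coef I z \<odot>\<^bsub>T\<^esub> alt_basis I)"
    by (rule T.M.add.finprod_cong')
      (use basis_wedge z alt_basis_closed[of _ r] in \<open>auto simp: lin_smult[OF Phi_linear] Phi_basis_wedge\<close>)
  also have "\<dots> = z" using alt_expand[OF assms] by simp
  finally show ?thesis .
qed

lemma Psi_Phi: assumes "w \<in> ep r" shows "Psi r (Phi r w) = w"
proof (rule lin_eq_on_span[OF Em Em lin_comp[OF Phi_linear Psi_linear] _ basis_wedge_inc_closed _ subsetD[OF ep_span_inc assms]])
  show "(\<lambda>w. w) \<in> linear_maps K E E" by (rule linear_mapsI) auto
qed (auto simp: Phi_basis_wedge inc_def Psi_alt_basis)

lemma seg_inc: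
  "s \<in> {1..r} \<rightarrow> {1..n} \<Longrightarrow> strict_mono_on {1..r} s \<Longrightarrow> seg 1 r s \<in> inc r"
  by (auto simp: inc_def idx_def sorted_seg set_seg)

lemma inc_seg:
  assumes "I \<in> inc r"
  shows "\<exists>s. s \<in> {1..r} \<rightarrow> {1..n} \<and> strict_mono_on {1..r} s \<and> I = seg 1 r s"
proof -
  let ?s = "\<lambda>k. I ! (k - 1)"
  have I: "set I \<subseteq> {1..n}" "length I = r" "sorted_wrt (<) I" using assms by (auto simp: inc_def idx_def)
  have eq: "seg 1 r ?s = I" by (rule seg_nth[OF I(2)])
  have "?s ` {1..r} = set I" using set_seg[of 1 r ?s] eq by simp
  then have "?s \<in> {1..r} \<rightarrow> {1..n}" using I(1) by blast
  moreover have "strict_mono_on {1..r} ?s" using I(3) sorted_seg[of 1 r ?s] eq by simp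
  ultimately show ?thesis using eq[symmetric] by blast
qed

lemma phi_eq: "phi K V n e r = restrict (Phi r) (ep r)"
  unfolding phi_def
proof (rule the_linear_eq[OF extpow_module tpow_module])
  have P: "Phi r w \<in> tp r" if "w \<in> ep r" for w using Phi_alt[OF that] walt_tp by blast
  show "Phi r \<in> linear_maps K (extpow K V r) (tpow K V r)"
    unfolding tpow_def extpow_def
    by (rule lin_into[OF lin_sub[OF Phi_linear]])
      (use P subsetD[OF ep_subset] in \<open>auto simp: tp_def[symmetric] ep_def[symmetric]\<close>)
  have img: "(\<lambda>s. wg (seg 1 r (e \<circ> s))) ` {s \<in> {1..r} \<rightarrow> {1..n}. strict_mono_on {1..r} s} = basis_wedge ` inc r"
  proof -
    have "wg (seg 1 r (e \<circ> s)) = basis_wedge (seg 1 r s)" for s by (simp add: basis_wedge_def map_seg)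
    then show ?thesis using seg_inc inc_seg by (auto simp: image_iff) metis
  qed
  then show "(\<lambda>s. wg (seg 1 r (e \<circ> s))) ` {s \<in> {1..r} \<rightarrow> {1..n}. strict_mono_on {1..r} s} \<subseteq> ep r"
    using basis_wedge_ep by (auto simp: inc_def)
  show "ep r \<subseteq> span_of K (extpow K V r) ((\<lambda>s. wg (seg 1 r (e \<circ> s))) ` {s \<in> {1..r} \<rightarrow> {1..n}. strict_mono_on {1..r} s})"
    unfolding img extpow_span_inc ..
  fix s assume "s \<in> {s \<in> {1..r} \<rightarrow> {1..n}. strict_mono_on {1..r} s}"
  then have "seg 1 r s \<in> idx r" using seg_inc by (auto simp: inc_def)
  then have "map e (seg 1 r s) \<in> lists (carrier V)" by (auto simp: idx_def intro: map_e_lists)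
  then show "Phi r (wg (seg 1 r (e \<circ> s))) = Ant K V r (wd (seg 1 r (e \<circ> s)))"
    by (simp add: map_seg wg_epr Phi_epr Ant_eq word_tp)
qed

lemma inv_phi:
  assumes "z \<in> alt r" shows "inv_into (ep r) (phi K V n e r) z = Psi r z"
proof (rule inv_into_f_eq)
  show "inj_on (phi K V n e r) (ep r)"
    by (rule inj_on_inverseI[of _ "Psi r"]) (simp add: phi_eq Psi_Phi)
  show "Psi r z \<in> ep r" using Psi_ep assms walt_T by blast
  then show "phi K V n e r (Psi r z) = z" by (simp add: phi_eq Phi_Psi assms)
qed

section \<open>Koszul spaces\<close>

lemma nsym_rel_eq: "nsym_rel K V N = antisym N ` tp N"
  unfolding nsym_rel_def by (rule image_cong) (auto simp: Ant_eq)

lemma nsym_rel_alt: "nsym_rel K V N \<subseteq> alt N"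
  using antisym_alt tp_subset by (auto simp: nsym_rel_eq)

lemma koszul_gen_walt:
  assumes "z \<in> span_of K T {u \<otimes>\<^bsub>T\<^esub> \<rho> \<otimes>\<^bsub>T\<^esub> t | u \<rho> t. u \<in> tp i \<and> \<rho> \<in> nsym_rel K V N \<and> t \<in> tp j}"
  shows "z \<in> walt (i + (N + j)) i (i + N)"
proof -
  have "u \<otimes>\<^bsub>T\<^esub> \<rho> \<otimes>\<^bsub>T\<^esub> t \<in> walt (i + (N + j)) i (i + N)"
    if "u \<in> tp i" "\<rho> \<in> nsym_rel K V N" "t \<in> tp j" for u \<rho> t
  proof -
    have r: "\<rho> \<in> alt N" using that nsym_rel_alt by auto
    have "u \<otimes>\<^bsub>T\<^esub> (\<rho> \<otimes>\<^bsub>T\<^esub> t) \<in> walt (i + (N + j)) (i + 0) (i + N)"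
      by (rule walt_mult_left[OF that(1) walt_mult_right[OF that(3) r]]) simp
    then show ?thesis
      using subsetD[OF tp_subset that(1)] subsetD[OF walt_T r] subsetD[OF tp_subset that(3)]
      by (simp add: TR.m_assoc)
  qed
  then have "{u \<otimes>\<^bsub>T\<^esub> \<rho> \<otimes>\<^bsub>T\<^esub> t | u \<rho> t. u \<in> tp i \<and> \<rho> \<in> nsym_rel K V N \<and> t \<in> tp j}
      \<subseteq> walt (i + (N + j)) i (i + N)" by auto
  from subsetD[OF span_least[OF walt_submodule this] assms] show ?thesis .
qed

lemma walt_koszul_gen:
  assumes "z \<in> walt (i + (N + j)) i (i + N)"
  shows "z \<in> span_of K T {u \<otimes>\<^bsub>T\<^esub> \<rho> \<otimes>\<^bsub>T\<^esub> t | u \<rho> t. u \<in> tp i \<and> \<rho> \<in> nsym_rel K V N \<and> t \<in> tp j}"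
    (is "z \<in> span_of K T ?S")
proof -
  have S: "?S \<subseteq> carrier T"
    using subsetD[OF tp_subset] subsetD[OF walt_T] subsetD[OF nsym_rel_alt] by blast
  note sub = span_submodule[OF Tm S]
  have zT: "z \<in> carrier T" using assms walt_T by blast
  have S': "basis_word u \<otimes>\<^bsub>T\<^esub> (alt_basis m \<otimes>\<^bsub>T\<^esub> basis_word t) \<in> ?S" if u: "u \<in> idx i" and m: "m \<in> inc N" and t: "t \<in> idx j" for u m t
  proof -
    have m': "m \<in> idx N" using m by (simp add: inc_def)
    then have "alt_basis m \<in> nsym_rel K V N" by (auto simp: nsym_rel_eq alt_basis_def idx_def intro!: imageI basis_word_tp)
    moreover have "basis_word u \<otimes>\<^bsub>T\<^esub> (alt_basis m \<otimes>\<^bsub>T\<^esub> basis_word t) = basis_word u \<otimes>\<^bsub>T\<^esub> alt_basis m \<otimes>\<^bsub>T\<^esub> basis_word t"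
      using u t m' alt_basis_closed basis_word_closed by (auto simp: idx_def TR.m_assoc)
    ultimately show ?thesis using u t basis_word_tp by blast
  qed
  show ?thesis
  proof (subst triple_expand[OF assms], rule submodule_finsum[OF Tm sub], rule funcsetI)
    fix x assume x: "x \<in> idx i \<times> inc N \<times> idx j"
    show "coef (fst x @ fst (snd x) @ snd (snd x)) z \<odot>\<^bsub>T\<^esub>
        (basis_word (fst x) \<otimes>\<^bsub>T\<^esub> (alt_basis (fst (snd x)) \<otimes>\<^bsub>T\<^esub> basis_word (snd (snd x)))) \<in> span_of K T ?S"
      by (rule submodule_smult[OF sub coef_closed[OF zT] subsetD[OF span_incl S']]) (use x in auto)
  qed
qed

text \<open>For \<open>r \<ge> N\<close> every pair of neighbouring positions lies in a window of length \<open>N\<close>, because \<open>N \<ge> 2\<close>; for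
  \<open>r \<le> 1\<close> both sides are the full tensor power.  The degrees in between, where \<open>W\<^sub>r\<close> is larger, are not
  values of \<open>\<nu>\<close>.\<close>

lemma Wsp_alt:
  assumes "2 \<le> N" "r \<le> 1 \<or> N \<le> r"
  shows "carrier (Wsp K V N r) = alt r"
proof
  show "alt r \<subseteq> carrier (Wsp K V N r)"
  proof
    fix z assume z: "z \<in> alt r"
    have "z \<in> span_of K T {u \<otimes>\<^bsub>T\<^esub> \<rho> \<otimes>\<^bsub>T\<^esub> t | u \<rho> t. u \<in> tp i \<and> \<rho> \<in> nsym_rel K V N \<and> t \<in> tp j}"
      if "i + N + j = r" for i j
      by (rule walt_koszul_gen) (use z that walt_mono[of 0 i "i + N" r r] in \<open>auto simp: add.assoc\<close>)
    then show "z \<in> carrier (Wsp K V N r)" using subsetD[OF walt_tp z] by (auto simp: Wsp_def)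
  qed
  show "carrier (Wsp K V N r) \<subseteq> alt r"
  proof
    fix z assume z: "z \<in> carrier (Wsp K V N r)"
    then have ztp: "z \<in> tp r" by (simp add: Wsp_def)
    have w: "z \<in> walt r i (i + N)" if "i + N + j = r" for i j
      using koszul_gen_walt[of z i N j] z that by (auto simp: Wsp_def add.assoc)
    have win: "\<exists>i. z \<in> walt r i (i + N) \<and> i \<le> l \<and> l + 2 \<le> i + N" if l: "l + 2 \<le> r" for l
    proof -
      have "N \<le> r" using assms(2) l by auto
      then have "z \<in> walt r (min l (r - N)) (min l (r - N) + N)"
        by (intro w[of _ "r - N - min l (r - N)"]) auto
      then show ?thesis using assms(1) l \<open>N \<le> r\<close> by (intro exI[of _ "min l (r - N)"]) auto
    qed
    show "z \<in> alt r"
    proof (rule waltI[OF ztp])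
      fix xs ys :: "nat list" and i j assume "length xs + 2 \<le> r"
      then obtain k where k: "z \<in> walt r k (k + N)" "k \<le> length xs" "length xs + 2 \<le> k + N"
        using win by blast
      show "coef (xs @ i # i # ys) z = \<zero>\<^bsub>K\<^esub>" by (rule walt_eq[OF k])
      show "coef (xs @ i # j # ys) z = \<ominus>\<^bsub>K\<^esub> coef (xs @ j # i # ys) z" by (rule walt_swap[OF k])
    qed
  qed
qed

lemma Wsp_eq: "2 \<le> N \<Longrightarrow> r \<le> 1 \<or> N \<le> r \<Longrightarrow> Wsp K V N r = T\<lparr>carrier := alt r\<rparr>"
  using Wsp_alt[of N r] by (simp add: Wsp_def)

lemma alt_module: "module K (T\<lparr>carrier := alt r\<rparr>)"
  by (rule submodule.submodule_is_module[OF walt_submodule Tm])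

lemma alt_span: "span_of K (T\<lparr>carrier := alt r\<rparr>) (alt_basis ` inc r) = alt r"
proof (rule span_in_submodule[OF Tm walt_submodule])
  show sub: "alt_basis ` inc r \<subseteq> alt r" using alt_basis_alt by (auto simp: inc_def)
  have sm: "submodule (span_of K T (alt_basis ` inc r)) K T"
    by (rule span_submodule[OF Tm]) (use sub walt_T in blast)
  show "alt r \<subseteq> span_of K T (alt_basis ` inc r)"
  proof
    fix z assume z: "z \<in> alt r"
    then have "z \<in> carrier T" using walt_T by blast
    then show "z \<in> span_of K T (alt_basis ` inc r)"
      by (subst alt_expand[OF z], intro submodule_finsum[OF Tm sm] funcsetI submodule_smult[OF sm])
        (auto intro!: subsetD[OF span_incl])
  qed
qed

end


section \<open>Functoriality of the tensor product\<close>

lemma id_tens_eq: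
  assumes X: "module K X" and Y: "module K Y" and Z: "module K Z" and h: "h \<in> linear_maps K Y Z"
  shows "\<exists>J \<in> linear_maps K (tensor K X Y) (tensor K X Z).
    id_tens K X Y Z h = restrict J (carrier (tensor K X Y)) \<and>
    (\<forall>x \<in> carrier X. \<forall>y \<in> carrier Y. J (tens K X Y x y) = tens K X Z x (h y))"
proof -
  note tZ = tens_bilinear[OF X Z]
  have "bilinear_map K X Y (tensor K X Z) (\<lambda>x y. tens K X Z x (h y))"
    using tZ lin_closed[OF h] lin_comp[OF h] by (auto simp: bilinear_map_def)
  from tensor_lift[OF X Y tensor_module[OF X Z] this] obtain J where
    J: "J \<in> linear_maps K (tensor K X Y) (tensor K X Z)"
    and Jt: "\<And>x y. x \<in> carrier X \<Longrightarrow> y \<in> carrier Y \<Longrightarrow> J (tens K X Y x y) = tens K X Z x (h y)" by blast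
  have tc: "tens K X Y x y \<in> carrier (tensor K X Y)" if "x \<in> carrier X" "y \<in> carrier Y" for x y
    using tens_bilinear[OF X Y] that by (auto simp: bilinear_map_def intro: lin_closed)
  have "id_tens K X Y Z h = restrict J (carrier (tensor K X Y))"
    unfolding id_tens_def
    by (rule the_linear_eq[OF tensor_module[OF X Y] tensor_module[OF X Z] J _ _ tensor_span[OF X Y]])
      (use tc Jt in auto)
  then show ?thesis using J Jt by blast
qed

text \<open>A left inverse of \<open>h\<close>, tensored with the identity, is a left inverse of \<open>id \<otimes> h\<close>.\<close>

lemma id_tens_inj:
  assumes X: "module K X" and Y: "module K Y" and Z: "module K Z" and h: "h \<in> linear_maps K Y Z"
    and h': "h' \<in> linear_maps K Z Y" and inv: "\<And>y. y \<in> carrier Y \<Longrightarrow> h' (h y) = y"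
  shows "inj_on (id_tens K X Y Z h) (carrier (tensor K X Y))"
proof -
  obtain J where J: "J \<in> linear_maps K (tensor K X Y) (tensor K X Z)"
    "id_tens K X Y Z h = restrict J (carrier (tensor K X Y))"
    "\<And>x y. x \<in> carrier X \<Longrightarrow> y \<in> carrier Y \<Longrightarrow> J (tens K X Y x y) = tens K X Z x (h y)"
    using id_tens_eq[OF X Y Z h] by blast
  obtain J' where J': "J' \<in> linear_maps K (tensor K X Z) (tensor K X Y)"
    "\<And>x y. x \<in> carrier X \<Longrightarrow> y \<in> carrier Z \<Longrightarrow> J' (tens K X Z x y) = tens K X Y x (h' y)"
    using id_tens_eq[OF X Z Y h'] by blast
  have tc: "tens K X Y x y \<in> carrier (tensor K X Y)" if "x \<in> carrier X" "y \<in> carrier Y" for x y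
    using tens_bilinear[OF X Y] that by (auto simp: bilinear_map_def intro: lin_closed)
  have id: "(\<lambda>t. t) \<in> linear_maps K (tensor K X Y) (tensor K X Y)" by (rule linear_mapsI) auto
  have "J' (J t) = t" if t: "t \<in> carrier (tensor K X Y)" for t
  proof (rule lin_eq_on_span[OF tensor_module[OF X Y] tensor_module[OF X Y] lin_comp[OF J(1) J'(1)] id])
    show "t \<in> span_of K (tensor K X Y) ((\<lambda>(x, y). tens K X Y x y) ` (carrier X \<times> carrier Y))"
      using tensor_span[OF X Y] t by blast
    fix u assume "u \<in> (\<lambda>(x, y). tens K X Y x y) ` (carrier X \<times> carrier Y)"
    then obtain x y where "u = tens K X Y x y" "x \<in> carrier X" "y \<in> carrier Y" by auto
    then show "J' (J u) = u" using J(3) J'(2) lin_closed[OF h] inv by simp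
  qed (use tc in auto)
  then show ?thesis unfolding J(2) by (intro inj_on_inverseI[of _ J']) simp
qed

section \<open>The cap product\<close>

lemma strict_mono_on_comp_iff:
  fixes s :: "nat \<Rightarrow> nat"
  assumes "\<sigma> permutes {1..c}" "strict_mono_on {1..c} s" "B \<subseteq> {1..c}"
  shows "strict_mono_on B (s \<circ> \<sigma>) \<longleftrightarrow> strict_mono_on B (\<sigma> :: nat \<Rightarrow> nat)"
proof -
  have in_c: "\<sigma> k \<in> {1..c}" if "k \<in> B" for k
    using that assms(3) permutes_in_image[OF assms(1), of k] by auto
  have "s (\<sigma> k) < s (\<sigma> l) \<longleftrightarrow> \<sigma> k < \<sigma> l" if "k \<in> B" "l \<in> B" for k l
    by (rule strict_mono_on_less[OF assms(2) in_c[OF that(1)] in_c[OF that(2)]])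
  then show ?thesis by (auto simp: strict_mono_on_def)
qed

locale cap_setup = based K V n e
  for K :: "('k, 'r) ring_scheme" and V :: "('k, 'v, 'c) module_scheme" and n e +
  fixes N :: nat
    and P :: "('k, ('v list \<Rightarrow> 'k) set set, 'p, 'd) bimod_scheme"
    and M :: "('k, ('v list \<Rightarrow> 'k) set set, 'm, 'e) bimod_scheme"
  assumes N: "2 \<le> N" and P: "bimodule K (nsym K V N) P" and M: "bimodule K (nsym K V N) M"
begin

abbreviation A where "A \<equiv> nsym K V N"
abbreviation PM where "PM \<equiv> tensor_over K A P M"
abbreviation tov where "tov \<equiv> tens_over K A P M"

sublocale P: bimodule K A P by (rule P)
sublocale M: bimodule K A M by (rule M)

lemmas Pm = P.module_axioms and Mm = M.module_axioms

abbreviation FPM where "FPM \<equiv> free_space K (carrier P \<times> carrier M)"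

lemma tensor_over_gens_closed:
  "bilinear_relations K P M \<union> balanced_relations K A P M \<subseteq> carrier FPM"
proof -
  interpret FPM: module K FPM by (rule free_space_module[OF K])
  have "balanced_relations K A P M \<subseteq> carrier FPM"
    unfolding balanced_relations_def Let_def
    by (auto intro!: FPM.minus_closed gen_closed[OF K] P.ract_closed M.lact_closed)
  then show ?thesis using bilinear_relations_closed[OF Pm Mm] by auto
qed

lemma tensor_over_kernel_submodule: "submodule (tensor_over_kernel K A P M) K FPM"
  unfolding tensor_over_kernel_def by (rule span_submodule[OF free_space_module[OF K] tensor_over_gens_closed])

lemma PMm: "module K PM"
  unfolding tensor_over_def by (rule quot_module[OF free_space_module[OF K] tensor_over_kernel_submodule])

lemma tov_bilinear: "bilinear_map K P M PM tov"
proof -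
  have "bilinear_relations K P M \<subseteq> tensor_over_kernel K A P M"
    unfolding tensor_over_kernel_def by (rule subset_trans[OF Un_upper1 span_incl])
  from quot_bilinear[OF Pm Mm tensor_over_kernel_submodule this] show ?thesis
    by (simp add: tensor_over_def tens_over_def[abs_def])
qed

abbreviation W where "W r \<equiv> T\<lparr>carrier := alt r\<rparr>"
abbreviation CT where "CT a \<equiv> tensor K PM (W a)"
abbreviation ct where "ct a y m w \<equiv> tens K PM (W a) (tov y m) w"

definition good where "good r \<longleftrightarrow> r \<le> 1 \<or> N \<le> r"

lemma Wsp_good: "good r \<Longrightarrow> Wsp K V N r = W r"
  using Wsp_eq[OF N] by (simp add: good_def)

lemma CTm: "module K (CT a)"
  by (rule tensor_module[OF PMm alt_module])

lemma tov_closed: "y \<in> carrier P \<Longrightarrow> m \<in> carrier M \<Longrightarrow> tov y m \<in> carrier PM"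
  using tov_bilinear by (auto simp: bilinear_map_def intro: lin_closed)

lemma ct_lin_w: "y \<in> carrier P \<Longrightarrow> m \<in> carrier M \<Longrightarrow> (\<lambda>w. ct a y m w) \<in> linear_maps K (W a) (CT a)"
  using tens_bilinear[OF PMm alt_module[of a]] tov_closed by (auto simp: bilinear_map_def)

lemma tens_lin_left: "w \<in> alt a \<Longrightarrow> (\<lambda>x. tens K PM (W a) x w) \<in> linear_maps K PM (CT a)"
  using tens_bilinear[OF PMm alt_module[of a]] by (auto simp: bilinear_map_def)

lemma ct_lin_y: "m \<in> carrier M \<Longrightarrow> w \<in> alt a \<Longrightarrow> (\<lambda>y. ct a y m w) \<in> linear_maps K P (CT a)"
  using tov_bilinear by (intro lin_comp[OF _ tens_lin_left]) (auto simp: bilinear_map_def)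

lemma ct_lin_m: "y \<in> carrier P \<Longrightarrow> w \<in> alt a \<Longrightarrow> (\<lambda>m. ct a y m w) \<in> linear_maps K M (CT a)"
  using tov_bilinear by (intro lin_comp[OF _ tens_lin_left]) (auto simp: bilinear_map_def)

lemma ct_closed: "y \<in> carrier P \<Longrightarrow> m \<in> carrier M \<Longrightarrow> w \<in> alt a \<Longrightarrow> ct a y m w \<in> carrier (CT a)"
  by (rule lin_closed[OF ct_lin_y])

end

locale cap_contraction = cap_setup K V n e N P M
  for K :: "('k, 'r) ring_scheme" and V :: "('k, 'v, 'c) module_scheme" and n e N
    and P :: "('k, ('v list \<Rightarrow> 'k) set set, 'p, 'd) bimod_scheme"
    and M :: "('k, ('v list \<Rightarrow> 'k) set set, 'm, 'e) bimod_scheme" +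
  fixes a b :: nat and f
  assumes good: "good a" "good b" "good (a + b)" and f: "f \<in> linear_maps K (extpow K V b) P"
begin

text \<open>The cochain \<open>f\<close> as a linear map on the whole tensor algebra; on alternating tensors of degree \<open>b\<close> it
  agrees with \<open>f \<circ> \<phi>\<^sub>b\<^sup>-\<^sup>1\<close>, called \<open>fi\<close> below.\<close>

definition h where "h z = f (Psi b z)"

lemma h_linear: "h \<in> linear_maps K T P"
proof -
  have "Psi b \<in> linear_maps K T (E\<lparr>carrier := ep b\<rparr>)"
    by (rule lin_into[OF Psi_linear Psi_ep])
  moreover have "f \<in> linear_maps K (E\<lparr>carrier := ep b\<rparr>) P" using f by (simp add: extpow_def)
  ultimately show ?thesis unfolding h_def[abs_def] by (rule lin_comp)
qed

definition fi where "fi = f \<circ> inv_into (ep b) (phi K V n e b)"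

lemma fi_eq: "z \<in> alt b \<Longrightarrow> fi z = h z"
  by (simp add: fi_def h_def inv_phi)

text \<open>The map \<open>w w' \<mapsto> (f(w') \<otimes> m) \<otimes> w\<close>, which is well defined because the coefficient of \<open>w w'\<close> at \<open>I @ J\<close> is
  the product of those of \<open>w\<close> at \<open>I\<close> and of \<open>w'\<close> at \<open>J\<close>.\<close>

definition contr where
  "contr m z = (\<Oplus>\<^bsub>CT a\<^esub> x \<in> inc a \<times> inc b. coef (fst x @ snd x) z \<odot>\<^bsub>CT a\<^esub> ct a (h (alt_basis (snd x))) m (alt_basis (fst x)))"

lemma inc_alt: "I \<in> inc r \<Longrightarrow> alt_basis I \<in> alt r"
  using alt_basis_alt by (auto simp: inc_def)

lemma inc_T: "I \<in> inc r \<Longrightarrow> alt_basis I \<in> carrier T"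
  using inc_alt walt_T by blast

lemma h_inc: "J \<in> inc b \<Longrightarrow> h (alt_basis J) \<in> carrier P"
  by (rule lin_closed[OF h_linear inc_T])

lemma term_closed:
  "m \<in> carrier M \<Longrightarrow> x \<in> inc a \<times> inc b \<Longrightarrow> ct a (h (alt_basis (snd x))) m (alt_basis (fst x)) \<in> carrier (CT a)"
  by (rule ct_closed) (auto simp: inc_alt h_inc)

lemma contr_linear: "m \<in> carrier M \<Longrightarrow> contr m \<in> linear_maps K T (CT a)"
  unfolding contr_def[abs_def]
  by (rule finsum_linear[OF CTm _ coef_linear Tm]) (rule term_closed)

lemma contr_linear_m:
  assumes "z \<in> carrier T" shows "(\<lambda>m. contr m z) \<in> linear_maps K M (CT a)"
  unfolding contr_def
proof (rule lin_pointwise_finsum[OF CTm lin_pointwise_smult[OF CTm ct_lin_m] Mm])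
  fix x assume "x \<in> inc a \<times> inc b"
  then show "h (alt_basis (snd x)) \<in> carrier P" "alt_basis (fst x) \<in> alt a"
    by (auto simp: inc_alt h_inc)
qed (use assms in simp)

lemma contr_basis:
  assumes m: "m \<in> carrier M" and I: "I \<in> inc a" and J: "J \<in> inc b"
  shows "contr m (alt_basis I \<otimes>\<^bsub>T\<^esub> alt_basis J) = ct a (h (alt_basis J)) m (alt_basis I)"
proof -
  interpret CT: module K "CT a" by (rule CTm)
  have "contr m (alt_basis I \<otimes>\<^bsub>T\<^esub> alt_basis J) = (\<Oplus>\<^bsub>CT a\<^esub> x \<in> inc a \<times> inc b.
      (if x = (I, J) then \<one>\<^bsub>K\<^esub> else \<zero>\<^bsub>K\<^esub>) \<odot>\<^bsub>CT a\<^esub> ct a (h (alt_basis (snd x))) m (alt_basis (fst x)))"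
    unfolding contr_def
  proof (rule CT.M.add.finprod_cong')
    fix x assume x: "x \<in> inc a \<times> inc b"
    have "coef (fst x @ snd x) (alt_basis I \<otimes>\<^bsub>T\<^esub> alt_basis J) = coef (fst x) (alt_basis I) \<otimes>\<^bsub>K\<^esub> coef (snd x) (alt_basis J)"
      by (rule coef_mult[of _ a]) (use x I J alt_basis_tp inc_T in \<open>auto simp: inc_def idx_def\<close>)
    also have "\<dots> = (if x = (I, J) then \<one>\<^bsub>K\<^esub> else \<zero>\<^bsub>K\<^esub>)"
      using x I J by (cases "fst x = I"; cases "snd x = J") (auto simp: coef_alt_basis prod_eq_iff mem_Times_iff)
    finally show "coef (fst x @ snd x) (alt_basis I \<otimes>\<^bsub>T\<^esub> alt_basis J) \<odot>\<^bsub>CT a\<^esub> ct a (h (alt_basis (snd x))) m (alt_basis (fst x)) =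
      (if x = (I, J) then \<one>\<^bsub>K\<^esub> else \<zero>\<^bsub>K\<^esub>) \<odot>\<^bsub>CT a\<^esub> ct a (h (alt_basis (snd x))) m (alt_basis (fst x))" by simp
  next
    show "(\<lambda>x. (if x = (I, J) then \<one>\<^bsub>K\<^esub> else \<zero>\<^bsub>K\<^esub>) \<odot>\<^bsub>CT a\<^esub> ct a (h (alt_basis (snd x))) m (alt_basis (fst x)))
      \<in> inc a \<times> inc b \<rightarrow> carrier (CT a)"
      by (rule funcsetI, rule CT.smult_closed[OF _ term_closed[OF m]]) auto
  qed simp
  also have "\<dots> = ct a (h (alt_basis (snd (I, J)))) m (alt_basis (fst (I, J)))"
    by (rule finsum_delta[OF CTm]) (use I J in \<open>auto intro!: funcsetI term_closed[OF m]\<close>)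
  finally show ?thesis by simp
qed

lemma alt_basis_inc_alt: "alt_basis ` inc r \<subseteq> carrier (W r)"
  using inc_alt by auto

lemma W_lin: "g \<in> linear_maps K T X \<Longrightarrow> g \<in> linear_maps K (W r) X"
  by (rule lin_sub[OF _ walt_T])

lemma contr_mult:
  assumes m: "m \<in> carrier M" and w: "w \<in> alt a" and w': "w' \<in> alt b"
  shows "contr m (w \<otimes>\<^bsub>T\<^esub> w') = ct a (h w') m w"
proof -
  have wT: "w \<in> carrier T" "w' \<in> carrier T" using w w' walt_T by blast+
  have 1: "contr m (alt_basis I \<otimes>\<^bsub>T\<^esub> w') = ct a (h w') m (alt_basis I)" if I: "I \<in> inc a" for I
  proof (rule lin_eq_on_span[where h = "\<lambda>w'. contr m (alt_basis I \<otimes>\<^bsub>T\<^esub> w')" and g = "\<lambda>w'. ct a (h w') m (alt_basis I)",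
        OF alt_module CTm _ _ alt_basis_inc_alt])
    show "(\<lambda>w'. contr m (alt_basis I \<otimes>\<^bsub>T\<^esub> w')) \<in> linear_maps K (W b) (CT a)"
      by (rule W_lin[OF lin_comp[OF Tl[OF inc_T[OF I]] contr_linear[OF m]]])
    show "(\<lambda>w'. ct a (h w') m (alt_basis I)) \<in> linear_maps K (W b) (CT a)"
      by (rule W_lin[OF lin_comp[OF h_linear ct_lin_y[OF m inc_alt[OF I]]]])
    show "w' \<in> span_of K (W b) (alt_basis ` inc b)" using w' by (simp add: alt_span)
  qed (use contr_basis[OF m I] in auto)
  show ?thesis
  proof (rule lin_eq_on_span[where h = "\<lambda>w. contr m (w \<otimes>\<^bsub>T\<^esub> w')" and g = "\<lambda>w. ct a (h w') m w",
        OF alt_module CTm _ _ alt_basis_inc_alt])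
    show "(\<lambda>w. contr m (w \<otimes>\<^bsub>T\<^esub> w')) \<in> linear_maps K (W a) (CT a)"
      by (rule W_lin[OF lin_comp[OF Tr[OF wT(2)] contr_linear[OF m]]])
    show "(\<lambda>w. ct a (h w') m w) \<in> linear_maps K (W a) (CT a)"
      by (rule ct_lin_w[OF lin_closed[OF h_linear wT(2)] m])
    show "w \<in> span_of K (W a) (alt_basis ` inc a)" using w by (simp add: alt_span)
  qed (use 1 in auto)
qed

text \<open>Both contractions of the cap product are the unique linear maps with prescribed values on a span of
  products, and both are identified with \<open>contr m\<close> by this lemma.  They differ in their index sets.\<close>

lemma the_linear_span:
  assumes g: "g ` I \<subseteq> carrier T" and sub: "S \<subseteq> g ` I" and m: "m \<in> carrier M"
    and eq: "\<And>i. i \<in> I \<Longrightarrow> contr m (g i) = h' i" and z: "z \<in> span_of K T S"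
  shows "the_linear K (T\<lparr>carrier := span_of K T (g ` I)\<rparr>) (CT a) I g h' z = contr m z"
proof -
  have sm: "submodule (span_of K T (g ` I)) K T" by (rule span_submodule[OF Tm g])
  have "the_linear K (T\<lparr>carrier := span_of K T (g ` I)\<rparr>) (CT a) I g h' =
      restrict (contr m) (carrier (T\<lparr>carrier := span_of K T (g ` I)\<rparr>))"
  proof (rule the_linear_eq[OF submodule.submodule_is_module[OF sm Tm] CTm])
    show "contr m \<in> linear_maps K (T\<lparr>carrier := span_of K T (g ` I)\<rparr>) (CT a)"
      by (rule lin_sub[OF contr_linear[OF m] submodule_subset[OF sm]])
    show "carrier (T\<lparr>carrier := span_of K T (g ` I)\<rparr>) \<subseteq> span_of K (T\<lparr>carrier := span_of K T (g ` I)\<rparr>) (g ` I)"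
      by (subst span_in_submodule[OF Tm sm span_incl]) auto
    show "g ` I \<subseteq> carrier (T\<lparr>carrier := span_of K T (g ` I)\<rparr>)" using span_incl by simp
  qed (rule eq)
  moreover have "z \<in> span_of K T (g ` I)" using span_mono[OF sub] z by blast
  ultimately show ?thesis by simp
qed

text \<open>The inclusion \<open>W\<^sub>a\<^sub>+\<^sub>b \<subseteq> W\<^sub>a \<otimes> W\<^sub>b\<close>.\<close>

lemma alt_span_products:
  assumes "z \<in> alt (a + b)"
  shows "z \<in> span_of K T {w \<otimes>\<^bsub>T\<^esub> w' | w w'. w \<in> alt a \<and> w' \<in> alt b}" (is "_ \<in> span_of K T ?S")
proof -
  have "?S \<subseteq> carrier T" using subsetD[OF walt_T] by blast
  note sub = span_submodule[OF Tm this]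
  have zT: "z \<in> carrier T" using assms walt_T by blast
  show ?thesis
  proof (subst double_expand[OF assms], rule submodule_finsum[OF Tm sub], rule funcsetI)
    fix x assume x: "x \<in> inc a \<times> inc b"
    have "alt_basis (fst x) \<otimes>\<^bsub>T\<^esub> alt_basis (snd x) \<in> ?S" using inc_alt x by force
    then show "coef (fst x @ snd x) z \<odot>\<^bsub>T\<^esub> (alt_basis (fst x) \<otimes>\<^bsub>T\<^esub> alt_basis (snd x)) \<in> span_of K T ?S"
      by (rule submodule_smult[OF sub coef_closed[OF zT] subsetD[OF span_incl]])
  qed
qed

lemma cap_target_good: "cap_target K V N P M a = CT a"
  by (simp add: cap_target_def Wsp_good[OF good(1)])

lemma cap_tens_good: "cap_tens K V N P M a y m w = ct a y m w"
  by (simp add: cap_tens_def Wsp_good[OF good(1)])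

lemma contract0_eq:
  assumes m: "m \<in> carrier M" and z: "z \<in> alt (a + b)"
  shows "contract0 K V N P M fi m a b z = contr m z"
  unfolding contract0_def Let_def cap_target_good cap_tens_good Wsp_good[OF good(1)] Wsp_good[OF good(2)]
proof (rule the_linear_span[OF _ _ m _ alt_span_products[OF z]])
  fix x assume "x \<in> carrier (W a) \<times> carrier (W b)"
  then show "contr m (case x of (w, w') \<Rightarrow> w \<otimes>\<^bsub>T\<^esub> w') = (case x of (w, w') \<Rightarrow> ct a (fi w') m w)"
    by (auto simp: contr_mult[OF m] fi_eq)
qed (use subsetD[OF walt_T] in \<open>auto simp: image_iff\<close>)

lemma tp0: assumes "u \<in> tp 0" shows "u = coef [] u \<odot>\<^bsub>T\<^esub> \<one>\<^bsub>T\<^esub>"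
proof -
  have "idx 0 = {[]}" by (auto simp: idx_def)
  moreover have "u \<in> carrier T" using assms tp_subset by blast
  ultimately show ?thesis
    by (subst tp_expand[OF assms]) (simp add: basis_word_def word_one)
qed

lemma nsym_kernel_ideal: "ideal (Idl\<^bsub>T\<^esub> (nsym_rel K V N)) T"
  by (rule TR.genideal_ideal) (use nsym_rel_alt walt_T in blast)

lemma nsym_scalar:
  assumes "c \<in> carrier K"
  shows "nsym_proj K V N (c \<odot>\<^bsub>T\<^esub> \<one>\<^bsub>T\<^esub>) = c \<odot>\<^bsub>A\<^esub> \<one>\<^bsub>A\<^esub>" "\<one>\<^bsub>A\<^esub> \<in> carrier A"
  using quot_smult[OF Tm kalg_ideal_submodule[OF talg_kalg nsym_kernel_ideal] assms TR.one_closed]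
  by (auto simp: nsym_proj_def nsym_def ideal_quot_one quot_carrier)

text \<open>The outer and middle factors have degree zero, so they are scalars and move through all products.\<close>

lemma contract_eq:
  assumes m: "m \<in> carrier M" and z: "z \<in> alt (a + b)"
  shows "contract K V N P M fi m 0 a 0 b 0 z = contr m z"
  unfolding contract_def Let_def cap_target_good cap_tens_good Wsp_good[OF good(1)] Wsp_good[OF good(2)]
proof (rule the_linear_span[OF _ _ m _ alt_span_products[OF z]])
  interpret CT: module K "CT a" by (rule CTm)
  fix x assume "x \<in> tp 0 \<times> carrier (W a) \<times> tp 0 \<times> carrier (W b) \<times> tp 0"
  then obtain u w v w' t where x: "x = (u, w, v, w', t)" and tp: "u \<in> tp 0" "v \<in> tp 0" "t \<in> tp 0"
    and w: "w \<in> alt a" "w' \<in> alt b" by auto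
  define c d k where "c = coef [] u" and "d = coef [] v" and "k = coef [] t"
  have cK: "c \<in> carrier K" "d \<in> carrier K" "k \<in> carrier K"
    using tp subsetD[OF tp_subset] by (auto simp: c_def d_def k_def)
  have u: "u = c \<odot>\<^bsub>T\<^esub> \<one>\<^bsub>T\<^esub>" "v = d \<odot>\<^bsub>T\<^esub> \<one>\<^bsub>T\<^esub>" "t = k \<odot>\<^bsub>T\<^esub> \<one>\<^bsub>T\<^esub>"
    unfolding c_def d_def k_def using tp tp0 by blast+
  have wT: "w \<in> carrier T" "w' \<in> carrier T" using w walt_T by blast+
  have sl: "(c \<odot>\<^bsub>T\<^esub> y) \<otimes>\<^bsub>T\<^esub> y' = c \<odot>\<^bsub>T\<^esub> (y \<otimes>\<^bsub>T\<^esub> y')" if "c \<in> carrier K" "y \<in> carrier T" "y' \<in> carrier T" for c y y'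
    by (rule lin_smult[OF Tr[OF that(3)] that(1,2)])
  have sr: "y \<otimes>\<^bsub>T\<^esub> (c \<odot>\<^bsub>T\<^esub> y') = c \<odot>\<^bsub>T\<^esub> (y \<otimes>\<^bsub>T\<^esub> y')" if "c \<in> carrier K" "y \<in> carrier T" "y' \<in> carrier T" for c y y'
    by (rule lin_smult[OF Tl[OF that(2)] that(1,3)])
  have prod: "u \<otimes>\<^bsub>T\<^esub> w \<otimes>\<^bsub>T\<^esub> v \<otimes>\<^bsub>T\<^esub> w' \<otimes>\<^bsub>T\<^esub> t = k \<odot>\<^bsub>T\<^esub> (d \<odot>\<^bsub>T\<^esub> (c \<odot>\<^bsub>T\<^esub> (w \<otimes>\<^bsub>T\<^esub> w')))"
    unfolding u using cK wT by (simp add: sl sr)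
  have FMl: "contr m (c \<odot>\<^bsub>T\<^esub> y) = c \<odot>\<^bsub>CT a\<^esub> contr m y" if "c \<in> carrier K" "y \<in> carrier T" for c y
    by (rule lin_smult[OF contr_linear[OF m] that])
  have hw: "h w' \<in> carrier P" by (rule lin_closed[OF h_linear wT(2)])
  have lhs: "contr m (u \<otimes>\<^bsub>T\<^esub> w \<otimes>\<^bsub>T\<^esub> v \<otimes>\<^bsub>T\<^esub> w' \<otimes>\<^bsub>T\<^esub> t)
      = k \<odot>\<^bsub>CT a\<^esub> (d \<odot>\<^bsub>CT a\<^esub> (c \<odot>\<^bsub>CT a\<^esub> ct a (h w') m w))"
    unfolding prod using cK wT by (simp add: FMl contr_mult[OF m w])
  have lP: "lact P (nsym_proj K V N v) (h w') = d \<odot>\<^bsub>P\<^esub> h w'"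
    unfolding u using nsym_scalar cK hw by (simp add: P.smult_lact P.lact_one)
  have lM: "ract M (lact M (nsym_proj K V N t) m) (nsym_proj K V N u) = c \<odot>\<^bsub>M\<^esub> (k \<odot>\<^bsub>M\<^esub> m)"
    unfolding u using nsym_scalar cK m by (simp add: M.smult_lact M.lact_one M.smult_ract M.ract_one)
  have "ct a (d \<odot>\<^bsub>P\<^esub> h w') (c \<odot>\<^bsub>M\<^esub> (k \<odot>\<^bsub>M\<^esub> m)) w = c \<odot>\<^bsub>CT a\<^esub> (k \<odot>\<^bsub>CT a\<^esub> (d \<odot>\<^bsub>CT a\<^esub> ct a (h w') m w))"
    using cK m hw by (simp add: lin_smult[OF ct_lin_y[OF _ w(1)]] lin_smult[OF ct_lin_m[OF _ w(1)]])
  also have "\<dots> = k \<odot>\<^bsub>CT a\<^esub> (d \<odot>\<^bsub>CT a\<^esub> (c \<odot>\<^bsub>CT a\<^esub> ct a (h w') m w))"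
    using cK ct_closed[OF hw m w(1)] by (simp add: CT.smult_assoc1[symmetric] V.R.m_ac)
  finally show "contr m (case x of (u, w, v, w', t) \<Rightarrow> u \<otimes>\<^bsub>T\<^esub> w \<otimes>\<^bsub>T\<^esub> v \<otimes>\<^bsub>T\<^esub> w' \<otimes>\<^bsub>T\<^esub> t) =
      (case x of (u, w, v, w', t) \<Rightarrow>
        ct a (lact P (nsym_proj K V N v) (fi w')) (ract M (lact M (nsym_proj K V N t) m) (nsym_proj K V N u)) w)"
    unfolding x prod.case lhs using w by (simp add: fi_eq lP lM)
next
  show "(\<lambda>(u, w, v, w', t). u \<otimes>\<^bsub>T\<^esub> w \<otimes>\<^bsub>T\<^esub> v \<otimes>\<^bsub>T\<^esub> w' \<otimes>\<^bsub>T\<^esub> t) ` (tp 0 \<times> carrier (W a) \<times> tp 0 \<times> carrier (W b) \<times> tp 0) \<subseteq> carrier T"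
    using subsetD[OF walt_T] subsetD[OF tp_subset] by auto
  show "{w \<otimes>\<^bsub>T\<^esub> w' |w w'. w \<in> alt a \<and> w' \<in> alt b}
    \<subseteq> (\<lambda>(u, w, v, w', t). u \<otimes>\<^bsub>T\<^esub> w \<otimes>\<^bsub>T\<^esub> v \<otimes>\<^bsub>T\<^esub> w' \<otimes>\<^bsub>T\<^esub> t) ` (tp 0 \<times> carrier (W a) \<times> tp 0 \<times> carrier (W b) \<times> tp 0)"
  proof clarify
    fix w w' assume w: "w \<in> alt a" "w' \<in> alt b"
    have "\<one>\<^bsub>T\<^esub> \<in> tp 0" unfolding word_one by (rule word_tp) auto
    moreover have "w \<otimes>\<^bsub>T\<^esub> w' = \<one>\<^bsub>T\<^esub> \<otimes>\<^bsub>T\<^esub> w \<otimes>\<^bsub>T\<^esub> \<one>\<^bsub>T\<^esub> \<otimes>\<^bsub>T\<^esub> w' \<otimes>\<^bsub>T\<^esub> \<one>\<^bsub>T\<^esub>"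
      using subsetD[OF walt_T w(1)] subsetD[OF walt_T w(2)] by simp
    ultimately show "w \<otimes>\<^bsub>T\<^esub> w' \<in> (\<lambda>(u, w, v, w', t). u \<otimes>\<^bsub>T\<^esub> w \<otimes>\<^bsub>T\<^esub> v \<otimes>\<^bsub>T\<^esub> w' \<otimes>\<^bsub>T\<^esub> t) ` (tp 0 \<times> carrier (W a) \<times> tp 0 \<times> carrier (W b) \<times> tp 0)"
      using w by (intro image_eqI[of _ _ "(\<one>\<^bsub>T\<^esub>, w, \<one>\<^bsub>T\<^esub>, w', \<one>\<^bsub>T\<^esub>)"]) auto
  qed
qed

lemma contr_word:
  assumes m: "m \<in> carrier M" and L: "L \<in> idx (a + b)"
  shows "contr m (basis_word L) = (if take a L \<in> inc a \<and> drop a L \<in> inc b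
    then ct a (h (alt_basis (drop a L))) m (alt_basis (take a L)) else \<zero>\<^bsub>CT a\<^esub>)"
proof -
  interpret CT: module K "CT a" by (rule CTm)
  let ?g = "\<lambda>x. ct a (h (alt_basis (snd x))) m (alt_basis (fst x))"
  have L': "set L \<subseteq> {1..n}" "length L = a + b" using L by (auto simp: idx_def)
  have iff: "fst x @ snd x = L \<longleftrightarrow> x = (take a L, drop a L)" if "x \<in> inc a \<times> inc b" for x
  proof -
    have "length (fst x) = a" using that by (auto simp: inc_def idx_def)
    then show ?thesis by (simp add: append_eq_conv_conj prod_eq_iff)
  qed
  have 1: "contr m (basis_word L) = (\<Oplus>\<^bsub>CT a\<^esub> x \<in> inc a \<times> inc b.
      (if x = (take a L, drop a L) then \<one>\<^bsub>K\<^esub> else \<zero>\<^bsub>K\<^esub>) \<odot>\<^bsub>CT a\<^esub> ?g x)"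
    unfolding contr_def
  proof (rule CT.M.add.finprod_cong')
    show "(\<lambda>x. (if x = (take a L, drop a L) then \<one>\<^bsub>K\<^esub> else \<zero>\<^bsub>K\<^esub>) \<odot>\<^bsub>CT a\<^esub> ?g x) \<in> inc a \<times> inc b \<rightarrow> carrier (CT a)"
      by (rule funcsetI, rule CT.smult_closed[OF _ term_closed[OF m]]) auto
  qed (simp_all add: coef_basis_word[OF L'(1)] iff)
  show ?thesis
  proof (cases "take a L \<in> inc a \<and> drop a L \<in> inc b")
    case True
    have "contr m (basis_word L) = ?g (take a L, drop a L)"
      unfolding 1 by (rule finsum_delta[OF CTm]) (use True in \<open>auto intro!: funcsetI term_closed[OF m]\<close>)
    then show ?thesis using True by simp
  next
    case False
    have "contr m (basis_word L) = (\<Oplus>\<^bsub>CT a\<^esub> x \<in> inc a \<times> inc b. \<zero>\<^bsub>CT a\<^esub>)"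
      unfolding 1
    proof (rule CT.M.add.finprod_cong')
      fix x assume x: "x \<in> inc a \<times> inc b"
      then have "x \<noteq> (take a L, drop a L)" using False by auto
      then show "(if x = (take a L, drop a L) then \<one>\<^bsub>K\<^esub> else \<zero>\<^bsub>K\<^esub>) \<odot>\<^bsub>CT a\<^esub> ?g x = \<zero>\<^bsub>CT a\<^esub>"
        using CT.smult_l_null[OF term_closed[OF m x]] by simp
    qed auto
    then show ?thesis using False by auto
  qed
qed

lemma seg_inc_shift:
  assumes "\<sigma> permutes {1..a + b}" "s \<in> {1..a + b} \<rightarrow> {1..n}" "strict_mono_on {1..a + b} s"
  shows "seg 1 a (s \<circ> \<sigma>) \<in> inc a \<longleftrightarrow> strict_mono_on {1..a} \<sigma>"
    and "seg (a + 1) (a + b) (s \<circ> \<sigma>) \<in> inc b \<longleftrightarrow> strict_mono_on {a + 1..a + b} \<sigma>"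
proof -
  have "(s \<circ> \<sigma>) ` {1..a} \<subseteq> {1..n}" "(s \<circ> \<sigma>) ` {a + 1..a + b} \<subseteq> {1..n}"
    using assms(2) permutes_in_image[OF assms(1)] by (auto simp: Pi_iff)
  then show "seg 1 a (s \<circ> \<sigma>) \<in> inc a \<longleftrightarrow> strict_mono_on {1..a} \<sigma>"
    "seg (a + 1) (a + b) (s \<circ> \<sigma>) \<in> inc b \<longleftrightarrow> strict_mono_on {a + 1..a + b} \<sigma>"
    using strict_mono_on_comp_iff[OF assms(1,3), of "{1..a}"]
      strict_mono_on_comp_iff[OF assms(1,3), of "{a + 1..a + b}"]
    by (auto simp: inc_def idx_def set_seg sorted_seg)
qed

text \<open>The antisymmetrized word is the signed sum of the words permuted by inverse permutations; the sum is
  reindexed by inversion.  A permuted increasing word has two increasing parts exactly if the permutation is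
  a shuffle, and the other terms vanish.\<close>

lemma contr_shuffle:
  assumes m: "m \<in> carrier M" and s: "s \<in> {1..a + b} \<rightarrow> {1..n}" "strict_mono_on {1..a + b} s"
  shows "contr m (alt_basis (seg 1 (a + b) s)) = (\<Oplus>\<^bsub>CT a\<^esub> \<sigma> \<in> shuffles_of a b.
    eps \<sigma> \<odot>\<^bsub>CT a\<^esub> ct a (h (alt_basis (seg (a + 1) (a + b) (s \<circ> \<sigma>)))) m (alt_basis (seg 1 a (s \<circ> \<sigma>))))"
proof -
  interpret CT: module K "CT a" by (rule CTm)
  let ?c = "a + b"
  define I where "I = seg 1 ?c s"
  have I: "I \<in> idx ?c" using seg_inc[OF s] by (simp add: I_def inc_def)
  then have IT: "basis_word I \<in> carrier T" "length I = ?c" by (auto simp: idx_def basis_word_closed)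
  have FMc: "contr m z \<in> carrier (CT a)" if "z \<in> carrier T" for z by (rule lin_closed[OF contr_linear[OF m] that])
  have PAI: "permute ?c \<sigma> (basis_word I) = basis_word (plist ?c (invp \<sigma>) I)" if "\<sigma> \<in> perms ?c" for \<sigma>
  proof -
    have "map e I \<in> lists (carrier V)" using I by (auto simp: idx_def intro: map_e_lists)
    then have "permute ?c \<sigma> (basis_word I) = wd (plist ?c (invp \<sigma>) (map e I))"
      unfolding basis_word_def using that IT(2) by (intro permute_word) auto
    also have "plist ?c (invp \<sigma>) (map e I) = map e (plist ?c (invp \<sigma>) I)"
    proof -
      have "map e I ! (invp \<sigma> k - 1) = e (I ! (invp \<sigma> k - 1))" if k: "k \<in> {1..?c}" for k
      proof -
        have "invp \<sigma> permutes {1..?c}" using \<open>\<sigma> \<in> perms ?c\<close> by (auto intro: permutes_inv)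
        from permutes_range[OF this, of k] k have "invp \<sigma> k - 1 < length I" using IT(2) by auto
        then show ?thesis by simp
      qed
      then show ?thesis by (auto simp: plist_def simp del: upt_Suc)
    qed
    finally show ?thesis by (simp add: basis_word_def)
  qed
  have plT: "basis_word (plist ?c \<sigma> I) \<in> carrier T" if "\<sigma> \<in> perms ?c" for \<sigma>
    using plist_idx[OF _ I] that by (auto simp: idx_def intro: basis_word_closed)
  have "contr m (alt_basis I) = (\<Oplus>\<^bsub>CT a\<^esub> \<sigma> \<in> perms ?c. contr m (eps \<sigma> \<odot>\<^bsub>T\<^esub> permute ?c \<sigma> (basis_word I)))"
    unfolding alt_basis_def IT(2) antisym_def
    by (rule lin_finsum[OF Tm CTm contr_linear[OF m]]) (use IT in auto)
  also have "\<dots> = (\<Oplus>\<^bsub>CT a\<^esub> \<sigma> \<in> perms ?c. eps (invp \<sigma>) \<odot>\<^bsub>CT a\<^esub> contr m (basis_word (plist ?c (invp \<sigma>) I)))"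
  proof (rule CT.M.add.finprod_cong')
    fix \<sigma> assume s: "\<sigma> \<in> perms ?c"
    have "eps (invp \<sigma>) = eps \<sigma>" using s by (simp add: eps_cases sign_inverse perms_permutation)
    then show "contr m (eps \<sigma> \<odot>\<^bsub>T\<^esub> permute ?c \<sigma> (basis_word I)) = eps (invp \<sigma>) \<odot>\<^bsub>CT a\<^esub> contr m (basis_word (plist ?c (invp \<sigma>) I))"
      using lin_smult[OF contr_linear[OF m] eps_closed permute_closed[OF IT(1), of ?c \<sigma>], of \<sigma>]
      by (simp add: PAI[OF s])
  qed (use plT FMc in \<open>auto simp: permutes_inv\<close>)
  also have "\<dots> = (\<Oplus>\<^bsub>CT a\<^esub> \<sigma> \<in> invp ` perms ?c. eps \<sigma> \<odot>\<^bsub>CT a\<^esub> contr m (basis_word (plist ?c \<sigma> I)))"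
  proof (rule CT.M.add.finprod_reindex[symmetric])
    show "inj_on invp (perms ?c)"
      by (rule inj_on_inverseI[of _ invp]) (auto simp: permutes_inv_inv)
  qed (use plT FMc in \<open>auto simp: permutes_inv\<close>)
  also have "invp ` perms ?c = perms ?c"
    using image_inverse_permutations[of "{1..?c}"] by (auto simp: image_def)
  also have "(\<Oplus>\<^bsub>CT a\<^esub> \<sigma> \<in> perms ?c. eps \<sigma> \<odot>\<^bsub>CT a\<^esub> contr m (basis_word (plist ?c \<sigma> I))) =
    (\<Oplus>\<^bsub>CT a\<^esub> \<sigma> \<in> shuffles_of a b.
      eps \<sigma> \<odot>\<^bsub>CT a\<^esub> ct a (h (alt_basis (seg (a + 1) ?c (s \<circ> \<sigma>)))) m (alt_basis (seg 1 a (s \<circ> \<sigma>))))"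
  proof (rule CT.M.add.finprod_mono_neutral_cong_right)
    have split: "take a (plist ?c \<sigma> I) = seg 1 a (s \<circ> \<sigma>)" "drop a (plist ?c \<sigma> I) = seg (a + 1) ?c (s \<circ> \<sigma>)"
      if "\<sigma> \<in> perms ?c" for \<sigma>
      using that plist_seg[of \<sigma> ?c s] seg_append[of a "s \<circ> \<sigma>" b, symmetric] by (auto simp: I_def)
    have FMw: "contr m (basis_word (plist ?c \<sigma> I)) = (if \<sigma> \<in> shuffles_of a b
        then ct a (h (alt_basis (seg (a + 1) ?c (s \<circ> \<sigma>)))) m (alt_basis (seg 1 a (s \<circ> \<sigma>))) else \<zero>\<^bsub>CT a\<^esub>)"
      if "\<sigma> \<in> perms ?c" for \<sigma>
      using contr_word[OF m plist_idx[OF _ I], of \<sigma>] that seg_inc_shift[OF _ s, of \<sigma>]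
      by (simp add: split shuffles_of_def)
    show "shuffles_of a b \<subseteq> perms ?c" by (auto simp: shuffles_of_def)
    show "eps \<sigma> \<odot>\<^bsub>CT a\<^esub> contr m (basis_word (plist ?c \<sigma> I)) = \<zero>\<^bsub>CT a\<^esub>" if "\<sigma> \<in> perms ?c - shuffles_of a b" for \<sigma>
      using that FMw[of \<sigma>] by simp
    show "eps \<sigma> \<odot>\<^bsub>CT a\<^esub> contr m (basis_word (plist ?c \<sigma> I)) =
        eps \<sigma> \<odot>\<^bsub>CT a\<^esub> ct a (h (alt_basis (seg (a + 1) ?c (s \<circ> \<sigma>)))) m (alt_basis (seg 1 a (s \<circ> \<sigma>)))"
      if "\<sigma> \<in> shuffles_of a b" for \<sigma>
      using that FMw[of \<sigma>] by (simp add: shuffles_of_def)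
  qed (use plT FMc in auto)
  finally show ?thesis by (simp add: I_def)
qed


section \<open>The shuffle formula\<close>

definition cap_sign :: "nat \<Rightarrow> nat \<Rightarrow> 'k" where
  "cap_sign p q = (if odd p \<and> odd (q - p) then \<ominus>\<^bsub>K\<^esub> \<one>\<^bsub>K\<^esub> else \<one>\<^bsub>K\<^esub>)"

lemma cap_sign_closed [simp]: "cap_sign p q \<in> carrier K"
  by (simp add: cap_sign_def)

lemma cap_sign_smult:
  assumes "module K X" "x \<in> carrier X"
  shows "[((-1 :: int) ^ ((q - p) * p))] \<cdot>\<^bsub>X\<^esub> x = cap_sign p q \<odot>\<^bsub>X\<^esub> x"
proof -
  interpret X: module K X by fact
  show ?thesis using assms(2)
    by (cases "odd p \<and> odd (q - p)") (auto simp: cap_sign_def add_pow_int_ge add_pow_int_lt X.smult_l_minus)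
qed

lemma cap_pure_eq:
  assumes pq: "nu N (q - p) = a" "nu N p = b" "odd p \<and> odd (q - p) \<longrightarrow> N = 2"
    and m: "m \<in> carrier M" and z: "z \<in> alt (a + b)"
  shows "cap_pure K V N P M p q fi m z = cap_sign p q \<odot>\<^bsub>CT a\<^esub> contr m z"
proof -
  interpret CT: module K "CT a" by (rule CTm)
  have c: "contr m z \<in> carrier (CT a)" by (rule lin_closed[OF contr_linear[OF m] subsetD[OF walt_T z]])
  show ?thesis
  proof (cases "odd p \<and> odd (q - p)")
    case True
    then have N2: "N - 2 = 0" using pq(3) by simp
    have set: "{(i, j). i + j \<le> N - 2} = {(0 :: nat, 0 :: nat)}"
      unfolding N2 by (auto simp: set_eq_iff)
    have "(\<Oplus>\<^bsub>CT a\<^esub> ij \<in> {(0, 0)}. contract K V N P M fi m (fst ij) a (N - 2 - fst ij - snd ij) b (snd ij) z)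
        = contract K V N P M fi m 0 a 0 b 0 z"
      using N2 contract_eq[OF m z] c by (subst CT.M.finsum_insert) auto
    then show ?thesis
      using True c unfolding cap_pure_def pq(1,2) cap_target_good set
      by (simp add: contract_eq[OF m z] cap_sign_def CT.smult_l_minus)
  next
    case False
    then show ?thesis
      using c unfolding cap_pure_def pq(1,2) by (auto simp: contract0_eq[OF m z] cap_sign_def)
  qed
qed

lemma koszul_cap_eq:
  assumes pq: "nu N (q - p) = a" "nu N p = b" "nu N q = a + b" "odd p \<and> odd (q - p) \<longrightarrow> N = 2"
    and m: "m \<in> carrier M" and z: "z \<in> alt (a + b)"
  shows "koszul_cap K V N P M p q fi (tens K M (W (a + b)) m z) = cap_sign p q \<odot>\<^bsub>CT a\<^esub> contr m z"
proof -
  let ?W = "W (a + b)"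
  have "bilinear_map K M ?W (CT a) (\<lambda>m w. cap_sign p q \<odot>\<^bsub>CT a\<^esub> contr m w)"
    unfolding bilinear_map_def
  proof (intro conjI ballI)
    show "(\<lambda>w. cap_sign p q \<odot>\<^bsub>CT a\<^esub> contr m w) \<in> linear_maps K ?W (CT a)" if "m \<in> carrier M" for m
      by (rule lin_pointwise_smult[OF CTm W_lin[OF contr_linear[OF that]] cap_sign_closed])
    show "(\<lambda>m. cap_sign p q \<odot>\<^bsub>CT a\<^esub> contr m w) \<in> linear_maps K M (CT a)" if "w \<in> carrier ?W" for w
      by (rule lin_pointwise_smult[OF CTm contr_linear_m cap_sign_closed]) (use that subsetD[OF walt_T] in auto)
  qed
  from tensor_lift[OF Mm alt_module CTm this] obtain F where
    F: "F \<in> linear_maps K (tensor K M ?W) (CT a)"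
    and Ft: "\<And>m w. m \<in> carrier M \<Longrightarrow> w \<in> carrier ?W \<Longrightarrow> F (tens K M ?W m w) = cap_sign p q \<odot>\<^bsub>CT a\<^esub> contr m w" by blast
  have tc: "tens K M ?W m w \<in> carrier (tensor K M ?W)" if "m \<in> carrier M" "w \<in> carrier ?W" for m w
    using tens_bilinear[OF Mm alt_module[of "a + b"]] that by (auto simp: bilinear_map_def intro: lin_closed)
  have "koszul_cap K V N P M p q fi = restrict F (carrier (tensor K M ?W))"
    unfolding koszul_cap_def pq(1,3) cap_target_good Wsp_good[OF good(3)]
  proof (rule the_linear_eq[OF tensor_module[OF Mm alt_module] CTm F _ _ tensor_span[OF Mm alt_module]])
    fix x assume "x \<in> carrier M \<times> carrier ?W"
    then show "F (case x of (m, w) \<Rightarrow> tens K M ?W m w) = (case x of (m, w) \<Rightarrow> cap_pure K V N P M p q fi m w)"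
      using Ft by (auto simp: cap_pure_eq[OF pq(1,2,4)])
  qed (use tc in auto)
  then show ?thesis using tc Ft m z by simp
qed

lemma phi_linear: "phi K V n e r \<in> linear_maps K (extpow K V r) (W r)"
proof -
  have "Phi r \<in> linear_maps K (extpow K V r) (W r)"
    by (subst extpow_eq) (rule lin_into[OF lin_sub[OF Phi_linear ep_subset]], simp add: Phi_alt)
  then show ?thesis unfolding phi_eq by (rule lin_restrict[OF extpow_module])
qed

lemma Psi_extpow: "Psi r \<in> linear_maps K (W r) (extpow K V r)"
  unfolding extpow_def
  by (rule lin_into[OF W_lin[OF Psi_linear]]) (use Psi_ep subsetD[OF walt_T] in \<open>auto simp: ep_def[symmetric]\<close>)

lemma cap_ext_formula:
  assumes pq: "nu N (q - p) = a" "nu N p = b" "nu N q = a + b" "odd p \<and> odd (q - p) \<longrightarrow> N = 2"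
    and m: "m \<in> carrier M"
    and s: "s \<in> {1..a + b} \<rightarrow> {1..n}" "strict_mono_on {1..a + b} s"
  shows "koszul_cap_ext K V n e N P M p q f (tens K M (extpow K V (a + b)) m (wg (seg 1 (a + b) (e \<circ> s)))) =
    [((-1 :: int) ^ ((q - p) * p))] \<cdot>\<^bsub>tensor K PM (extpow K V a)\<^esub>
      (\<Oplus>\<^bsub>tensor K PM (extpow K V a)\<^esub> \<sigma> \<in> shuffles_of a b.
        [sign \<sigma>] \<cdot>\<^bsub>tensor K PM (extpow K V a)\<^esub>
          tens K PM (extpow K V a) (tov (f (wg (seg (a + 1) (a + b) (e \<circ> s \<circ> \<sigma>)))) m) (wg (seg 1 a (e \<circ> s \<circ> \<sigma>))))"
proof -
  let ?c = "a + b" and ?X = "tensor K PM (extpow K V a)"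
  note Xm = tensor_module[OF PMm extpow_module[of a]]
  interpret X: module K ?X by (rule Xm)
  interpret CT: module K "CT a" by (rule CTm)
  have wg_basis_wedge: "wg (seg i j (e \<circ> t)) = basis_wedge (seg i j t)" for i j t by (simp add: basis_wedge_def map_seg)
  have inc_c: "seg 1 ?c s \<in> inc ?c" by (rule seg_inc[OF s])
  have phi_basis_wedge: "phi K V n e r (basis_wedge I) = alt_basis I" if "I \<in> inc r" for I r
    using that basis_wedge_ep[of I r] by (auto simp: phi_eq Phi_basis_wedge inc_def)
  obtain J where J: "id_tens K M (extpow K V ?c) (W ?c) (phi K V n e ?c) = restrict J (carrier (tensor K M (extpow K V ?c)))"
    "\<And>x y. x \<in> carrier M \<Longrightarrow> y \<in> ep ?c \<Longrightarrow> J (tens K M (extpow K V ?c) x y) = tens K M (W ?c) x (phi K V n e ?c y)"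
    using id_tens_eq[OF Mm extpow_module[of ?c] alt_module[of ?c] phi_linear[of ?c]] by metis
  have wc: "basis_wedge (seg 1 ?c s) \<in> ep ?c" using inc_c by (auto simp: inc_def intro: basis_wedge_ep)
  have "tens K M (extpow K V ?c) m (basis_wedge (seg 1 ?c s)) \<in> carrier (tensor K M (extpow K V ?c))"
    using tens_bilinear[OF Mm extpow_module[of ?c]] wc m by (auto simp: bilinear_map_def intro: lin_closed)
  then have chain: "id_tens K M (extpow K V ?c) (W ?c) (phi K V n e ?c) (tens K M (extpow K V ?c) m (basis_wedge (seg 1 ?c s)))
      = tens K M (W ?c) m (alt_basis (seg 1 ?c s))"
    using m wc by (simp add: J phi_basis_wedge[OF inc_c])
  have cap: "koszul_cap K V N P M p q fi (tens K M (W ?c) m (alt_basis (seg 1 ?c s))) = cap_sign p q \<odot>\<^bsub>CT a\<^esub> contr m (alt_basis (seg 1 ?c s))"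
    by (rule koszul_cap_eq[OF pq m inc_alt[OF inc_c]])
  \<comment> \<open>Since \<open>id \<otimes> \<phi>\<^sub>a\<close> is injective, it suffices that it maps the asserted value to the cap product.\<close>
  define t where "t \<sigma> = tens K PM (extpow K V a) (tov (f (basis_wedge (seg (a + 1) ?c (s \<circ> \<sigma>)))) m) (basis_wedge (seg 1 a (s \<circ> \<sigma>)))" for \<sigma>
  define R where "R = cap_sign p q \<odot>\<^bsub>?X\<^esub> (\<Oplus>\<^bsub>?X\<^esub> \<sigma> \<in> shuffles_of a b. eps \<sigma> \<odot>\<^bsub>?X\<^esub> t \<sigma>)"
  have sh: "seg 1 a (s \<circ> \<sigma>) \<in> inc a" "seg (a + 1) ?c (s \<circ> \<sigma>) \<in> inc b" if "\<sigma> \<in> shuffles_of a b" for \<sigma>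
    using that seg_inc_shift[OF _ s, of \<sigma>] by (auto simp: shuffles_of_def)
  have ye: "f (basis_wedge (seg (a + 1) ?c (s \<circ> \<sigma>))) = h (alt_basis (seg (a + 1) ?c (s \<circ> \<sigma>)))" if "\<sigma> \<in> shuffles_of a b" for \<sigma>
    using sh(2)[OF that] by (simp add: h_def Psi_alt_basis)
  have yP: "f (basis_wedge (seg (a + 1) ?c (s \<circ> \<sigma>))) \<in> carrier P" if "\<sigma> \<in> shuffles_of a b" for \<sigma>
    unfolding ye[OF that] by (rule h_inc[OF sh(2)[OF that]])
  have basis_wedge_a: "basis_wedge (seg 1 a (s \<circ> \<sigma>)) \<in> ep a" if "\<sigma> \<in> shuffles_of a b" for \<sigma>
    using sh(1)[OF that] by (auto simp: inc_def intro: basis_wedge_ep)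
  have tX: "t \<sigma> \<in> carrier ?X" if "\<sigma> \<in> shuffles_of a b" for \<sigma>
    using tens_bilinear[OF PMm extpow_module[of a]] basis_wedge_a[OF that] tov_closed[OF yP[OF that] m]
    by (auto simp: t_def bilinear_map_def intro: lin_closed)
  have SX: "(\<Oplus>\<^bsub>?X\<^esub> \<sigma> \<in> shuffles_of a b. eps \<sigma> \<odot>\<^bsub>?X\<^esub> t \<sigma>) \<in> carrier ?X"
    by (rule X.M.finsum_closed) (use tX in auto)
  have RX: "R \<in> carrier ?X" unfolding R_def using SX by simp
  have rhs: "[((-1 :: int) ^ ((q - p) * p))] \<cdot>\<^bsub>?X\<^esub> (\<Oplus>\<^bsub>?X\<^esub> \<sigma> \<in> shuffles_of a b. [sign \<sigma>] \<cdot>\<^bsub>?X\<^esub> t \<sigma>) = R"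
  proof -
    have "(\<Oplus>\<^bsub>?X\<^esub> \<sigma> \<in> shuffles_of a b. [sign \<sigma>] \<cdot>\<^bsub>?X\<^esub> t \<sigma>) = (\<Oplus>\<^bsub>?X\<^esub> \<sigma> \<in> shuffles_of a b. eps \<sigma> \<odot>\<^bsub>?X\<^esub> t \<sigma>)"
      by (rule X.M.add.finprod_cong') (use tX in \<open>auto simp: sign_smult_eps[OF Xm]\<close>)
    then show ?thesis using cap_sign_smult[OF Xm SX] by (simp add: R_def)
  qed
  obtain J' where J': "J' \<in> linear_maps K ?X (CT a)"
    "id_tens K PM (extpow K V a) (W a) (phi K V n e a) = restrict J' (carrier ?X)"
    "\<And>x y. x \<in> carrier PM \<Longrightarrow> y \<in> ep a \<Longrightarrow> J' (tens K PM (extpow K V a) x y) = tens K PM (W a) x (phi K V n e a y)"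
    using id_tens_eq[OF PMm extpow_module[of a] alt_module[of a] phi_linear[of a]] by metis
  have J't: "J' (t \<sigma>) = ct a (h (alt_basis (seg (a + 1) ?c (s \<circ> \<sigma>)))) m (alt_basis (seg 1 a (s \<circ> \<sigma>)))" if "\<sigma> \<in> shuffles_of a b" for \<sigma>
    using J'(3)[OF tov_closed[OF yP[OF that] m] basis_wedge_a[OF that]]
    by (simp add: t_def phi_basis_wedge[OF sh(1)[OF that]] ye[OF that])
  have "J' R = cap_sign p q \<odot>\<^bsub>CT a\<^esub> J' (\<Oplus>\<^bsub>?X\<^esub> \<sigma> \<in> shuffles_of a b. eps \<sigma> \<odot>\<^bsub>?X\<^esub> t \<sigma>)"
    unfolding R_def by (rule lin_smult[OF J'(1) cap_sign_closed SX])
  also have "J' (\<Oplus>\<^bsub>?X\<^esub> \<sigma> \<in> shuffles_of a b. eps \<sigma> \<odot>\<^bsub>?X\<^esub> t \<sigma>) = (\<Oplus>\<^bsub>CT a\<^esub> \<sigma> \<in> shuffles_of a b. J' (eps \<sigma> \<odot>\<^bsub>?X\<^esub> t \<sigma>))"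
    by (rule lin_finsum[OF Xm CTm J'(1)]) (use tX in auto)
  also have "\<dots> = (\<Oplus>\<^bsub>CT a\<^esub> \<sigma> \<in> shuffles_of a b.
      eps \<sigma> \<odot>\<^bsub>CT a\<^esub> ct a (h (alt_basis (seg (a + 1) ?c (s \<circ> \<sigma>)))) m (alt_basis (seg 1 a (s \<circ> \<sigma>))))"
  proof (rule CT.M.add.finprod_cong')
    show "(\<lambda>\<sigma>. eps \<sigma> \<odot>\<^bsub>CT a\<^esub> ct a (h (alt_basis (seg (a + 1) ?c (s \<circ> \<sigma>)))) m (alt_basis (seg 1 a (s \<circ> \<sigma>))))
        \<in> shuffles_of a b \<rightarrow> carrier (CT a)"
      using term_closed[OF m] sh by force
  qed (use tX J't in \<open>auto simp: lin_smult[OF J'(1)]\<close>)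
  also have "\<dots> = contr m (alt_basis (seg 1 ?c s))"
    by (rule contr_shuffle[OF m s, symmetric])
  finally have J'R: "id_tens K PM (extpow K V a) (W a) (phi K V n e a) R = cap_sign p q \<odot>\<^bsub>CT a\<^esub> contr m (alt_basis (seg 1 ?c s))"
    using RX by (simp add: J'(2))
  have inj: "inj_on (id_tens K PM (extpow K V a) (W a) (phi K V n e a)) (carrier ?X)"
    by (rule id_tens_inj[OF PMm extpow_module alt_module phi_linear Psi_extpow]) (simp add: phi_eq Psi_Phi)
  have "koszul_cap_ext K V n e N P M p q f (tens K M (extpow K V ?c) m (basis_wedge (seg 1 ?c s))) = R"
    unfolding koszul_cap_ext_def Let_def pq(1-3) Wsp_good[OF good(1)] Wsp_good[OF good(3)] chain fi_def[symmetric] cap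
    by (rule inv_into_f_eq[OF inj RX J'R])
  then show ?thesis
    unfolding rhs[symmetric] t_def comp_assoc wg_basis_wedge .
qed

end

lemma nu_small_or_large: "2 \<le> N \<Longrightarrow> nu N r \<le> 1 \<or> N \<le> nu N r"
  by (cases "r div 2 = 0") (auto simp: nu_def trans_le_add1)

lemma nu_mono:
  assumes "2 \<le> N" "p \<le> q" shows "nu N p \<le> nu N q"
proof (cases "p div 2 = q div 2")
  case True
  then have "even q \<Longrightarrow> even p" using assms(2) by presburger
  then show ?thesis using True by (auto simp: nu_def)
next
  case False
  then have d: "p div 2 + 1 \<le> q div 2" using div_le_mono[OF assms(2), of 2] by simp
  have "N * (p div 2 + 1) \<le> N * (q div 2)" by (rule mult_le_mono2[OF d])
  then have "N * (p div 2) + N \<le> N * (q div 2)" by (simp add: distrib_left)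
  then show ?thesis using assms(1) d by (auto simp: nu_def)
qed

text \<open>With \<open>p = 2 i + 1\<close> and \<open>q - p = 2 j + 1\<close> the hypothesis reads \<open>N j + 1 = N j + N - 1\<close>.\<close>

lemma nu_both_odd:
  assumes "2 \<le> N" "p \<le> q" "nu N (q - p) = nu N q - nu N p" "odd p" "odd (q - p)"
  shows "N = 2"
proof -
  obtain i where i: "p = 2 * i + 1" using assms(4) by (rule oddE)
  obtain j where j: "q - p = 2 * j + 1" using assms(5) by (rule oddE)
  have q: "q = 2 * (i + j + 1)" using i j assms(2) by auto
  have "nu N p = N * i + 1" "nu N (q - p) = N * j + 1" "nu N q = N * (i + j + 1)"
    unfolding i j by (simp_all add: nu_def q distrib_left)
  then have "N * j + 1 = N * j + N - 1" using assms(3) by (simp add: algebra_simps)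
  then show ?thesis using assms(1) by simp
qed

theorem mainTheorem3:
  fixes K :: "('k, 'r) ring_scheme"
    and V :: "('k, 'v, 'c) module_scheme"
    and P :: "('k, ('v list \<Rightarrow> 'k) set set, 'p, 'd) bimod_scheme"
    and M :: "('k, ('v list \<Rightarrow> 'k) set set, 'm, 'e) bimod_scheme"
    and e :: "nat \<Rightarrow> 'v" and s :: "nat \<Rightarrow> nat"
    and n N p q :: nat
  assumes "field K"
    and "module K V"
    and "ordered_basis K V n e" and "2 \<le> n"
    and "2 \<le> N" and "N \<le> n"
    and "bimodule K (nsym K V N) P"
    and "bimodule K (nsym K V N) M"
    and "p \<le> q"
    and "nu N (q - p) = nu N q - nu N p"
    and "f \<in> linear_maps K (extpow K V (nu N p)) P"
    and "m \<in> carrier M"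
    and "s \<in> {1..nu N q} \<rightarrow> {1..n}" and "strict_mono_on {1..nu N q} s"
    and "\<And>k. x k = e (s k)"
  shows "koszul_cap_ext K V n e N P M p q f
           (tens K M (extpow K V (nu N q)) m (wedge K V (seg 1 (nu N q) x))) =
         (let PM = tensor_over K (nsym K V N) P M;
              E = extpow K V (nu N (q - p));
              T = tensor K PM E
          in [((-1 :: int) ^ ((q - p) * p))] \<cdot>\<^bsub>T\<^esub>
             (\<Oplus>\<^bsub>T\<^esub> \<sigma> \<in> shuffles_of (nu N (q - p)) (nu N p).
                [sign \<sigma>] \<cdot>\<^bsub>T\<^esub>
                tens K PM E
                  (tens_over K (nsym K V N) P M
                     (f (wedge K V (seg (nu N (q - p) + 1) (nu N q) (x \<circ> \<sigma>)))) m)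
                  (wedge K V (seg 1 (nu N (q - p)) (x \<circ> \<sigma>)))))"
proof -
  have x: "x = e \<circ> s" using assms(15) by auto
  have c: "nu N q = nu N (q - p) + nu N p"
    using assms(10) nu_mono[OF assms(5,9)] by simp
  interpret cap_setup K V n e N P M
    using assms by (intro_locales; intro vmod.intro based_axioms.intro cap_setup_axioms.intro)
  have good: "good (nu N r)" for r
    unfolding good_def by (rule nu_small_or_large[OF assms(5)])
  interpret cap_contraction K V n e N P M "nu N (q - p)" "nu N p" f
    by unfold_locales (use good c[symmetric] assms(11) in auto)
  show ?thesis
    unfolding Let_def x c
    by (rule cap_ext_formula) (use assms nu_both_odd[OF assms(5,9,10)] c in auto)
qed


end
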